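(* Let $\Omega\subset\mathbb{R}^d$ ($d=2$ or $3$) be a bounded polyhedral domain with Lipschitz boundary, and consider the reduced-order scheme (LPS-ROM) described in the context with data $\nu>0$, $\sigma>0$, $\Delta t=T/N$, $\mathbf{f}^{n+1}\in \mathbf{H}^{-1}(\Omega)$ ($n=0,\dots,N-1$) and initial value $\mathbf{u}_r^0\in\mathbf{X}_r$. Then for every $n=0,\dots,N-1$ the scheme admits a solution $(\mathbf{u}_r^{n+1},p_r^{n+1})\in\mathbf{X}_r\times Q_r$, and the solutions satisfy, for every $k=0,\dots,N$, $$ \|\mathbf{u}_r^{k}\|_{\mathbf{L}^2}^2+\sum_{n=0}^{k-1}\|\mathbf{u}_r^{n+1}-\mathbf{u}_r^{n}\|_{\mathbf{L}^2}^2+\Delta t\sum_{n=0}^{k-1}\Big(\nu\|\nabla\mathbf{u}_r^{n+1}\|_{\mathbf{L}^2}^2+\|\Pi_h^*(\nabla p_r^{n+1})\|_{\tau}^2+\sigma\|p_r^{n+1}\|_{L^2}^2\Big) \le \|\mathbf{u}_r^{0}\|_{\mathbf{L}^2}^2+\frac{4\Delta t}{\nu}\sum_{n=0}^{N-1}\|\mathbf{f}^{n+1}\|_{\mathbf{H}^{-1}}^2 . $$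
   Context: Notation: $(\cdot,\cdot)$ is the $L^2(\Omega)$ inner product, $\langle\cdot,\cdot\rangle$ the duality between $\mathbf{H}^{-1}(\Omega)$ and $\mathbf{X}=[H^1_0(\Omega)]^d$. The trilinear form is $b(\mathbf{u},\mathbf{v},\mathbf{w})=\frac12[(\mathbf{u}\cdot\nabla\mathbf{v},\mathbf{w})-(\mathbf{u}\cdot\nabla\mathbf{w},\mathbf{v})]$. Let $\{\mathcal{T}_h\}$ be a conforming, regular, affine-equivalent triangulation of $\overline\Omega$ (simplices or quadrilaterals/hexahedra), with cell diameters $h_K$. For an integer $l\ge2$ let $Y_h^l=\{v_h\in C^0(\overline\Omega): v_h|_K\in\mathbb{R}^l(K)\ \forall K\}$, where $\mathbb{R}^l(K)$ is $\mathbb{P}^l(K)$ (simplices) or $\mathbb{Q}^l(K)$ (quadrilaterals/hexahedra); $\mathbf{Y}_h^l=[Y_h^l]^d$, $\mathbf{X}_h=\mathbf{Y}_h^l\cap\mathbf{X}$, $Q_h=Y_h^l$. Let $\Pi_h$ be a locally $L^2$-stable projection or interpolation operator from $\mathbf{L}^2(\Omega)$ onto $\mathbf{Y}_h^{l-1}$ and $\Pi_h^*=\mathrm{Id}-\Pi_h$. For positive stabilization parameters $\tau_K$, $(\mathbf{v},\mathbf{w})_\tau=\sum_{K\in\mathcal{T}_h}\tau_K(\mathbf{v},\mathbf{w})_K$ and $\|\mathbf{v}\|_\tau=(\mathbf{v},\mathbf{v})_\tau^{1/2}$. The reduced spaces are $\mathbf{X}_r=\mathrm{span}\{\boldsymbol\varphi_1,\dots,\boldsymbol\varphi_r\}\subset\mathbf{X}_h$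 and $Q_r=\mathrm{span}\{\psi_1,\dots,\psi_r\}\subset Q_h$ (POD velocity and pressure modes, $L^2$-orthonormal). LPS-ROM: given $\mathbf{u}_r^n\in\mathbf{X}_r$, find $(\mathbf{u}_r^{n+1},p_r^{n+1})\in\mathbf{X}_r\times Q_r$ with, for all $(\boldsymbol\varphi,\psi)\in\mathbf{X}_r\times Q_r$, $\big(\frac{\mathbf{u}_r^{n+1}-\mathbf{u}_r^n}{\Delta t},\boldsymbol\varphi\big)+b(\mathbf{u}_r^{n+1},\mathbf{u}_r^{n+1},\boldsymbol\varphi)+\nu(\nabla\mathbf{u}_r^{n+1},\nabla\boldsymbol\varphi)-(p_r^{n+1},\nabla\cdot\boldsymbol\varphi)=\langle\mathbf{f}^{n+1},\boldsymbol\varphi\rangle$ and $(\nabla\cdot\mathbf{u}_r^{n+1},\psi)+(\Pi_h^*(\nabla p_r^{n+1}),\Pi_h^*(\nabla\psi))_\tau+\sigma(p_r^{n+1},\psi)=0$. *)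

theory Defs
  imports "HOL-Analysis.Analysis"
begin

definition polyhedral_domain :: "(real ^ 'd::finite) set \<Rightarrow> bool" where
  "polyhedral_domain \<Omega> \<longleftrightarrow> open \<Omega> \<and> connected \<Omega> \<and> \<Omega> \<noteq> {} \<and> bounded \<Omega> \<and>
     (\<exists>P. finite P \<and> (\<forall>S\<in>P. polytope S) \<and> closure \<Omega> = \<Union>P)"

definition lipschitz_boundary :: "(real ^ 'd::finite) set \<Rightarrow> bool" where
  "lipschitz_boundary \<Omega> \<longleftrightarrow>
     (\<forall>x\<in>frontier \<Omega>. \<exists>r>0. \<exists>e::real^'d. norm e = 1 \<and>
        (\<exists>(g::real^'d \<Rightarrow> real) C. C-lipschitz_on UNIV g \<and>
           \<Omega> \<inter> ball x r = {y \<in> ball x r. inner y e < g (y - inner y e *\<^sub>R e)}))"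

text \<open>simp = True: simplicial mesh; simp = False: quadrilateral/hexahedral mesh whose cells are
  affine images of the reference cube (affine equivalence).  Conforming: two distinct cells
  meet in a common face (possibly empty).\<close>

definition triangulation :: "(real ^ 'd::finite) set \<Rightarrow> bool \<Rightarrow> (real ^ 'd) set set \<Rightarrow> bool" where
  "triangulation \<Omega> simp T \<longleftrightarrow> finite T \<and> \<Union>T = closure \<Omega> \<and>
     (\<forall>K\<in>T. if simp then (int CARD('d)) simplex K
             else (\<exists>(A::real^'d^'d) b. invertible A \<and> K = (\<lambda>x. A *v x + b) ` cbox 0 One)) \<and>
     (\<forall>K\<in>T. \<forall>K'\<in>T. K \<noteq> K' \<longrightarrow> (K \<inter> K') face_of K \<and> (K \<inter> K') face_of K')"

definition mono_set :: "bool \<Rightarrow> nat \<Rightarrow> ('d::finite \<Rightarrow> nat) set" where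
  "mono_set simp l = (if simp then {\<alpha>. sum \<alpha> UNIV \<le> l} else {\<alpha>. \<forall>j. \<alpha> j \<le> l})"

definition poly_on :: "(real ^ 'd::finite) set \<Rightarrow> bool \<Rightarrow> nat \<Rightarrow> (real ^ 'd \<Rightarrow> real) \<Rightarrow> bool" where
  "poly_on K simp l v \<longleftrightarrow> (\<exists>c::('d \<Rightarrow> nat) \<Rightarrow> real. \<forall>x\<in>K.
      v x = (\<Sum>\<alpha>\<in>mono_set simp l. c \<alpha> * (\<Prod>j\<in>UNIV. (x $ j) ^ (\<alpha> j))))"

definition Yh :: "(real ^ 'd::finite) set \<Rightarrow> bool \<Rightarrow> (real ^ 'd) set set \<Rightarrow> nat \<Rightarrow> (real ^ 'd \<Rightarrow> real) set" where
  "Yh \<Omega> simp T l = {v. continuous_on (closure \<Omega>) v \<and> (\<forall>K\<in>T. poly_on K simp l v)}"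

definition Yhv :: "(real ^ 'd::finite) set \<Rightarrow> bool \<Rightarrow> (real ^ 'd) set set \<Rightarrow> nat \<Rightarrow> (real ^ 'd \<Rightarrow> real ^ 'd) set" where
  "Yhv \<Omega> simp T l = {v. \<forall>i. (\<lambda>x. v x $ i) \<in> Yh \<Omega> simp T l}"

definition L2 :: "(real ^ 'd::finite) set \<Rightarrow> (real ^ 'd \<Rightarrow> 'b::euclidean_space) \<Rightarrow> bool" where
  "L2 \<Omega> v \<longleftrightarrow> v \<in> borel_measurable (lebesgue_on \<Omega>) \<and>
              integrable (lebesgue_on \<Omega>) (\<lambda>x. (norm (v x))\<^sup>2)"

text \<open>L^2 inner product and squared L^2 norm over a set (of scalar, vector or matrix fields;
  for matrices the inner product/norm of real^'d^'d is the Frobenius one).\<close>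

definition L2ip :: "(real ^ 'd::finite) set \<Rightarrow> (real ^ 'd \<Rightarrow> 'b::euclidean_space) \<Rightarrow> (real ^ 'd \<Rightarrow> 'b) \<Rightarrow> real" where
  "L2ip \<Omega> u v = (LINT x|lebesgue_on \<Omega>. inner (u x) (v x))"

definition L2sq :: "(real ^ 'd::finite) set \<Rightarrow> (real ^ 'd \<Rightarrow> 'b::euclidean_space) \<Rightarrow> real" where
  "L2sq \<Omega> v = (LINT x|lebesgue_on \<Omega>. (norm (v x))\<^sup>2)"

definition pd :: "(real ^ 'd::finite \<Rightarrow> real) \<Rightarrow> 'd \<Rightarrow> real ^ 'd \<Rightarrow> real" where
  "pd \<phi> j x = frechet_derivative \<phi> (at x) (axis j 1)"

definition jac :: "(real ^ 'd::finite \<Rightarrow> real ^ 'd) \<Rightarrow> real ^ 'd \<Rightarrow> real ^ 'd ^ 'd" where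
  "jac \<phi> x = (\<chi> i j. pd (\<lambda>y. \<phi> y $ i) j x)"

definition test_fn :: "(real ^ 'd::finite) set \<Rightarrow> (real ^ 'd \<Rightarrow> real) \<Rightarrow> bool" where
  "test_fn \<Omega> \<phi> \<longleftrightarrow> (\<forall>x. \<phi> differentiable (at x)) \<and> (\<forall>j. continuous_on UNIV (pd \<phi> j)) \<and>
     (\<exists>K. compact K \<and> K \<subseteq> \<Omega> \<and> (\<forall>x. x \<notin> K \<longrightarrow> \<phi> x = 0))"

text \<open>Weak gradient on \<Omega> (in L^2).  For vector fields, row i of the gradient is the
  gradient of component i, i.e. (G x) $ i $ j = d_j v_i.\<close>

definition weak_grad_s :: "(real ^ 'd::finite) set \<Rightarrow> (real ^ 'd \<Rightarrow> real) \<Rightarrow> (real ^ 'd \<Rightarrow> real ^ 'd) \<Rightarrow> bool" where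
  "weak_grad_s \<Omega> p g \<longleftrightarrow> L2 \<Omega> p \<and> L2 \<Omega> g \<and>
     (\<forall>\<phi>. test_fn \<Omega> \<phi> \<longrightarrow> (\<forall>j. (LINT x|lebesgue_on \<Omega>. p x * pd \<phi> j x)
                                  = - (LINT x|lebesgue_on \<Omega>. g x $ j * \<phi> x)))"

definition weak_grad_v :: "(real ^ 'd::finite) set \<Rightarrow> (real ^ 'd \<Rightarrow> real ^ 'd) \<Rightarrow> (real ^ 'd \<Rightarrow> real ^ 'd ^ 'd) \<Rightarrow> bool" where
  "weak_grad_v \<Omega> v G \<longleftrightarrow> (\<forall>i. weak_grad_s \<Omega> (\<lambda>x. v x $ i) (\<lambda>x. G x $ i))"

definition grad_s :: "(real ^ 'd::finite) set \<Rightarrow> (real ^ 'd \<Rightarrow> real) \<Rightarrow> (real ^ 'd \<Rightarrow> real ^ 'd)" where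
  "grad_s \<Omega> p = (SOME g. weak_grad_s \<Omega> p g)"

definition grad_v :: "(real ^ 'd::finite) set \<Rightarrow> (real ^ 'd \<Rightarrow> real ^ 'd) \<Rightarrow> (real ^ 'd \<Rightarrow> real ^ 'd ^ 'd)" where
  "grad_v \<Omega> v = (SOME G. weak_grad_v \<Omega> v G)"

definition div_w :: "(real ^ 'd::finite) set \<Rightarrow> (real ^ 'd \<Rightarrow> real ^ 'd) \<Rightarrow> (real ^ 'd \<Rightarrow> real)" where
  "div_w \<Omega> v = (\<lambda>x. \<Sum>i\<in>UNIV. grad_v \<Omega> v x $ i $ i)"

definition H10 :: "(real ^ 'd::finite) set \<Rightarrow> (real ^ 'd \<Rightarrow> real ^ 'd) \<Rightarrow> bool" where
  "H10 \<Omega> v \<longleftrightarrow> (\<exists>G. weak_grad_v \<Omega> v G \<and>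
     (\<exists>\<phi>::nat \<Rightarrow> real ^ 'd \<Rightarrow> real ^ 'd. (\<forall>k i. test_fn \<Omega> (\<lambda>x. \<phi> k x $ i)) \<and>
        (\<lambda>k. L2sq \<Omega> (\<lambda>x. \<phi> k x - v x)) \<longlonglongrightarrow> 0 \<and>
        (\<lambda>k. L2sq \<Omega> (\<lambda>x. jac (\<phi> k) x - G x)) \<longlonglongrightarrow> 0))"

text \<open>H^{-1}(\<Omega>) = dual of X, with X normed by the L^2 norm of the gradient;
  \<langle>f, v\<rangle> is written f v.\<close>

definition Hm1 :: "(real ^ 'd::finite) set \<Rightarrow> ((real ^ 'd \<Rightarrow> real ^ 'd) \<Rightarrow> real) \<Rightarrow> bool" where
  "Hm1 \<Omega> f \<longleftrightarrow>
     (\<forall>u v a b. H10 \<Omega> u \<longrightarrow> H10 \<Omega> v \<longrightarrow> f (\<lambda>x. a *\<^sub>R u x + b *\<^sub>R v x) = a * f u + b * f v) \<and>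
     (\<exists>C. \<forall>v. H10 \<Omega> v \<longrightarrow> \<bar>f v\<bar> \<le> C * sqrt (L2sq \<Omega> (grad_v \<Omega> v)))"

definition Hm1_norm :: "(real ^ 'd::finite) set \<Rightarrow> ((real ^ 'd \<Rightarrow> real ^ 'd) \<Rightarrow> real) \<Rightarrow> real" where
  "Hm1_norm \<Omega> f = Sup {\<bar>f v\<bar> | v. H10 \<Omega> v \<and> L2sq \<Omega> (grad_v \<Omega> v) \<le> 1}"

definition Xh :: "(real ^ 'd::finite) set \<Rightarrow> bool \<Rightarrow> (real ^ 'd) set set \<Rightarrow> nat \<Rightarrow> (real ^ 'd \<Rightarrow> real ^ 'd) set" where
  "Xh \<Omega> simp T l = Yhv \<Omega> simp T l \<inter> {v. H10 \<Omega> v}"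

definition Qh :: "(real ^ 'd::finite) set \<Rightarrow> bool \<Rightarrow> (real ^ 'd) set set \<Rightarrow> nat \<Rightarrow> (real ^ 'd \<Rightarrow> real) set" where
  "Qh \<Omega> simp T l = Yh \<Omega> simp T l"

definition patch :: "(real ^ 'd::finite) set set \<Rightarrow> (real ^ 'd) set \<Rightarrow> (real ^ 'd) set" where
  "patch T K = \<Union>{K'\<in>T. K' \<inter> K \<noteq> {}}"

definition loc_stable_proj ::
  "(real ^ 'd::finite) set \<Rightarrow> bool \<Rightarrow> (real ^ 'd) set set \<Rightarrow> nat \<Rightarrow>
   ((real ^ 'd \<Rightarrow> real ^ 'd) \<Rightarrow> (real ^ 'd \<Rightarrow> real ^ 'd)) \<Rightarrow> bool" where
  "loc_stable_proj \<Omega> simp T l Proj \<longleftrightarrow>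
     (\<forall>v. L2 \<Omega> v \<longrightarrow> Proj v \<in> Yhv \<Omega> simp T (l - 1)) \<and>
     (\<forall>u v a b. L2 \<Omega> u \<longrightarrow> L2 \<Omega> v \<longrightarrow>
         Proj (\<lambda>x. a *\<^sub>R u x + b *\<^sub>R v x) = (\<lambda>x. a *\<^sub>R Proj u x + b *\<^sub>R Proj v x)) \<and>
     (\<exists>C. \<forall>K\<in>T. \<forall>v. L2 \<Omega> v \<longrightarrow> L2sq K (Proj v) \<le> C * L2sq (patch T K) v)"

definition Pistar :: "((real ^ 'd::finite \<Rightarrow> real ^ 'd) \<Rightarrow> (real ^ 'd \<Rightarrow> real ^ 'd)) \<Rightarrow>
                      (real ^ 'd \<Rightarrow> real ^ 'd) \<Rightarrow> (real ^ 'd \<Rightarrow> real ^ 'd)" where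
  "Pistar Proj v = (\<lambda>x. v x - Proj v x)"

definition tau_ip :: "(real ^ 'd::finite) set set \<Rightarrow> ((real ^ 'd) set \<Rightarrow> real) \<Rightarrow>
                      (real ^ 'd \<Rightarrow> real ^ 'd) \<Rightarrow> (real ^ 'd \<Rightarrow> real ^ 'd) \<Rightarrow> real" where
  "tau_ip T \<tau> v w = (\<Sum>K\<in>T. \<tau> K * L2ip K v w)"

definition tau_sq :: "(real ^ 'd::finite) set set \<Rightarrow> ((real ^ 'd) set \<Rightarrow> real) \<Rightarrow>
                      (real ^ 'd \<Rightarrow> real ^ 'd) \<Rightarrow> real" where
  "tau_sq T \<tau> v = tau_ip T \<tau> v v"

text \<open>Skew-symmetrized trilinear form b(u,v,w) = 1/2[(u.grad v, w) - (u.grad w, v)],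
  where (u.grad v)_i = sum_j u_j d_j v_i.\<close>

definition btri :: "(real ^ 'd::finite) set \<Rightarrow> (real ^ 'd \<Rightarrow> real ^ 'd) \<Rightarrow> (real ^ 'd \<Rightarrow> real ^ 'd) \<Rightarrow>
                    (real ^ 'd \<Rightarrow> real ^ 'd) \<Rightarrow> real" where
  "btri \<Omega> u v w = (L2ip \<Omega> (\<lambda>x. grad_v \<Omega> v x *v u x) w - L2ip \<Omega> (\<lambda>x. grad_v \<Omega> w x *v u x) v) / 2"

definition span_modes :: "nat \<Rightarrow> (nat \<Rightarrow> real ^ 'd::finite \<Rightarrow> 'b::real_vector) \<Rightarrow> (real ^ 'd \<Rightarrow> 'b) set" where
  "span_modes r \<phi> = {(\<lambda>x. \<Sum>i<r. a i *\<^sub>R \<phi> i x) | a. True}"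

definition LPS_step ::
  "(real ^ 'd::finite) set \<Rightarrow> (real ^ 'd) set set \<Rightarrow>
   ((real ^ 'd \<Rightarrow> real ^ 'd) \<Rightarrow> (real ^ 'd \<Rightarrow> real ^ 'd)) \<Rightarrow> ((real ^ 'd) set \<Rightarrow> real) \<Rightarrow>
   real \<Rightarrow> real \<Rightarrow> real \<Rightarrow> (real ^ 'd \<Rightarrow> real ^ 'd) set \<Rightarrow> (real ^ 'd \<Rightarrow> real) set \<Rightarrow>
   ((real ^ 'd \<Rightarrow> real ^ 'd) \<Rightarrow> real) \<Rightarrow>
   (real ^ 'd \<Rightarrow> real ^ 'd) \<Rightarrow> (real ^ 'd \<Rightarrow> real ^ 'd) \<Rightarrow> (real ^ 'd \<Rightarrow> real) \<Rightarrow> bool" where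
  "LPS_step \<Omega> T Proj \<tau> \<nu> \<sigma> dt Xr Qr f uold u p \<longleftrightarrow>
     (\<forall>\<phi>\<in>Xr.
        L2ip \<Omega> (\<lambda>x. (1 / dt) *\<^sub>R (u x - uold x)) \<phi> + btri \<Omega> u u \<phi>
        + \<nu> * L2ip \<Omega> (grad_v \<Omega> u) (grad_v \<Omega> \<phi>) - L2ip \<Omega> p (div_w \<Omega> \<phi>) = f \<phi>) \<and>
     (\<forall>\<psi>\<in>Qr.
        L2ip \<Omega> (div_w \<Omega> u) \<psi> + tau_ip T \<tau> (Pistar Proj (grad_s \<Omega> p)) (Pistar Proj (grad_s \<Omega> \<psi>))
        + \<sigma> * L2ip \<Omega> p \<psi> = 0)"

end

theory Submission
  imports Defs
begin

text \<open>Testing one step of the scheme with its own solution \<open>(u, p)\<close> annihilates the skew-symmetric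
  convection term and makes the two pressure terms cancel.  The polarisation identity for
  \<open>(u - w, u)\<close> together with Young's inequality for \<open>\<langle>f, u\<rangle>\<close> then gives the energy inequality of
  the step, and the sum over the steps telescopes.  The same computation shows that the residual,
  a continuous vector field of the \<open>2r\<close> coefficients, points outwards on a large cube, so that it
  has a zero by a Brouwer-type argument.

  As \<open>grad_s\<close> and \<open>grad_v\<close> choose an arbitrary weak gradient, all linearity statements
  hold almost everywhere only.  They rest on the fundamental lemma of the calculus of variations and
  on the weak differentiability of continuous piecewise polynomials.  The projection sees values on
  \<open>closure \<Omega>\<close>, where the chosen gradient is arbitrary on the boundary; this is harmless because the
  boundary, being locally a Lipschitz graph, is a null set.\<close>

section \<open>Zeros of coercive vector fields\<close>

text \<open>Existence rests on two lower-order terms. The velocity modes are L2-orthonormal, so the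
  time derivative contributes \<open>1 / dt\<close> times the squared velocity coefficients; the
  term with \<open>\<sigma>\<close> does the same for the pressure coefficients, so that no inf-sup
  condition has to link the two spaces. The viscous and stabilization terms only have to be
  nonnegative. The smaller of \<open>1 / dt\<close> and \<open>\<sigma>\<close> is the coercivity
  constant and, with the data, fixes the size of the cube.

  Continuity of the residual is immediate once every form is expanded in the modes, because it is
  then a polynomial of degree two in the coefficients. The expansion is where linearity of the
  chosen gradients is required.

  No uniqueness of a step is claimed. Solvability is therefore shown from every previous velocity in
  the reduced space, and the bound is shown for every sequence of solutions. Young's inequality with
  weight \<open>\<nu>\<close> yields the factor 1 in front of the data, so the 4 leaves
  slack.\<close>

lemma tendsto_fun_iff:
  fixes X :: "'b \<Rightarrow> 'i \<Rightarrow> 'a::topological_space"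
  shows "(X \<longlongrightarrow> a) F \<longleftrightarrow> (\<forall>i. ((\<lambda>m. X m i) \<longlongrightarrow> a i) F)"
proof -
  have "(X \<longlongrightarrow> a) F \<longleftrightarrow> limitin (product_topology (\<lambda>i. euclidean) UNIV) X a F"
    by (simp only: euclidean_product_topology limitin_canonical_iff)
  then show ?thesis
    by (simp add: limitin_componentwise)
qed

text \<open>Pinning the coordinates from \<open>n\<close> on to 0 makes the box a product of compact
  sets, so Tychonoff's theorem applies although the index type is infinite.\<close>

lemma compact_coordinate_box:
  fixes R :: real
  shows "compact {x::nat \<Rightarrow> real. \<forall>i. if i < n then \<bar>x i\<bar> \<le> R else x i = 0}"
proof -
  have "{x::nat \<Rightarrow> real. \<forall>i. if i < n then \<bar>x i\<bar> \<le> R else x i = 0}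
      = PiE UNIV (\<lambda>i. if i < n then {-R..R} else {0})"
    by (auto simp: PiE_def Pi_def abs_le_iff minus_le_iff split: if_splits)
  moreover have "compactin (product_topology (\<lambda>i. euclidean) UNIV)
      (PiE UNIV (\<lambda>i::nat. if i < n then {-R..R} else {0}))"
    by (subst compactin_PiE) auto
  ultimately show ?thesis
    by (simp add: euclidean_product_topology)
qed

text \<open>The dimension is a natural number rather than a type here, so Brouwer's theorem for
  Euclidean spaces does not apply; Kuhn's combinatorial lemma is used instead.  A grid point is
  labelled by the signs of the components of \<open>F\<close>.\<close>

lemma box_coercive_zero:
  fixes F :: "(nat \<Rightarrow> real) \<Rightarrow> nat \<Rightarrow> real"
  assumes cont: "\<And>i. i < n \<Longrightarrow> continuous_on UNIV (\<lambda>x. F x i)" and R: "0 < R"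
    and coer: "\<And>x. (\<forall>i<n. \<bar>x i\<bar> \<le> R) \<Longrightarrow> (\<exists>i<n. \<bar>x i\<bar> = R) \<Longrightarrow> 0 < (\<Sum>i<n. F x i * x i)"
  shows "\<exists>x. \<forall>i<n. F x i = 0"
proof -
  \<comment> \<open>Sends the grid \<open>{0..p}^n\<close> into the cube \<open>[-R, R]^n\<close>.
    The remaining coordinates are 0, which keeps the images of grid points in one compact
    set.\<close>
  define pt where "pt = (\<lambda>p (r::nat \<Rightarrow> nat) i. if i < n then - R + 2 * R * real (r i) / real p else 0)"
  \<comment> \<open>The first two cases are the face labels that Kuhn's lemma prescribes, whatever
    the sign of \<open>F\<close>. Hence label 1 off the upper face means \<open>F \<ge> 0\<close>,
    and label 0 off the lower face means \<open>F < 0\<close>.\<close>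
  define label :: "nat \<Rightarrow> (nat \<Rightarrow> nat) \<Rightarrow> nat \<Rightarrow> nat" where
    "label = (\<lambda>p r i. if r i = 0 then 0 else if r i = p then 1 else if F (pt p r) i \<ge> 0 then 1 else 0)"
  have ex: "\<exists>q. (\<forall>i<n. q i < Suc m) \<and> (\<forall>i<n. \<exists>r s.
      (\<forall>j<n. q j \<le> r j \<and> r j \<le> q j + 1) \<and> (\<forall>j<n. q j \<le> s j \<and> s j \<le> q j + 1) \<and>
      label (Suc m) r i = 1 \<and> label (Suc m) s i = 0)" for m
  proof -
    have lab01: "label (Suc m) x i = 0 \<or> label (Suc m) x i = 1" for x i
      by (auto simp: label_def)
    obtain q where q: "\<forall>i<n. q i < Suc m"
      "\<forall>i<n. \<exists>r s. (\<forall>j<n. q j \<le> r j \<and> r j \<le> q j + 1) \<and> (\<forall>j<n. q j \<le> s j \<and> s j \<le> q j + 1) \<and>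
          label (Suc m) r i \<noteq> label (Suc m) s i"
      by (rule kuhn_lemma[of "Suc m" n "label (Suc m)"]) (auto simp: label_def)
    have "\<exists>r s. (\<forall>j<n. q j \<le> r j \<and> r j \<le> q j + 1) \<and> (\<forall>j<n. q j \<le> s j \<and> s j \<le> q j + 1) \<and>
      label (Suc m) r i = 1 \<and> label (Suc m) s i = 0" if "i < n" for i
      using q(2)[rule_format, OF that] lab01 by metis
    with q(1) show ?thesis by blast
  qed
  then obtain q where q: "\<And>m i. i < n \<Longrightarrow> q m i < Suc m" and
    "\<And>m. \<forall>i<n. \<exists>r s. (\<forall>j<n. q m j \<le> r j \<and> r j \<le> q m j + 1) \<and>
        (\<forall>j<n. q m j \<le> s j \<and> s j \<le> q m j + 1) \<and> label (Suc m) r i = 1 \<and> label (Suc m) s i = 0"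
    by metis
  then have "\<forall>m i. \<exists>r s. i < n \<longrightarrow> (\<forall>j<n. q m j \<le> r j \<and> r j \<le> q m j + 1) \<and>
        (\<forall>j<n. q m j \<le> s j \<and> s j \<le> q m j + 1) \<and> label (Suc m) r i = 1 \<and> label (Suc m) s i = 0"
    by blast
  then obtain r s where r: "\<And>m i j. i < n \<Longrightarrow> j < n \<Longrightarrow> q m j \<le> r m i j \<and> r m i j \<le> q m j + 1"
    and s: "\<And>m i j. i < n \<Longrightarrow> j < n \<Longrightarrow> q m j \<le> s m i j \<and> s m i j \<le> q m j + 1"
    and lab_r: "\<And>m i. i < n \<Longrightarrow> label (Suc m) (r m i) i = 1"
    and lab_s: "\<And>m i. i < n \<Longrightarrow> label (Suc m) (s m i) i = 0"
    by metis
  define S where "S = {x::nat \<Rightarrow> real. \<forall>i. if i < n then \<bar>x i\<bar> \<le> R else x i = 0}"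
  have "pt (Suc m) (q m) \<in> S" for m
  proof -
    have "\<bar>- R + 2 * R * real (q m i) / real (Suc m)\<bar> \<le> R" if "i < n" for i
    proof -
      have "real (q m i) \<le> real (Suc m)" using q[OF that, of m] by simp
      then have "2 * R * real (q m i) / real (Suc m) \<le> 2 * R"
        using R by (simp add: field_simps del: of_nat_Suc)
      moreover have "0 \<le> 2 * R * real (q m i) / real (Suc m)" using R by simp
      ultimately show ?thesis by (simp add: abs_le_iff)
    qed
    then show ?thesis by (auto simp: S_def pt_def)
  qed
  moreover have "seq_compact S"
    unfolding S_def using compact_coordinate_box by (rule compact_imp_seq_compact)
  ultimately obtain a \<rho> where a: "a \<in> S" "strict_mono (\<rho>::nat \<Rightarrow> nat)"
    and lim: "((\<lambda>m. pt (Suc m) (q m)) \<circ> \<rho>) \<longlonglongrightarrow> a"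
    by (metis (no_types, lifting) seq_compactE)
  \<comment> \<open>Every vertex of the cell at \<open>q m\<close> differs from its base point by at
    most \<open>2 * R / (m + 1)\<close> in each coordinate, so any choice of vertices has the limit
    \<open>a\<close>.\<close>
  have near: "(\<lambda>m. pt (Suc (\<rho> m)) (t (\<rho> m))) \<longlonglongrightarrow> a"
    if t: "\<And>m j. j < n \<Longrightarrow> q m j \<le> t m j \<and> t m j \<le> q m j + 1" for t
    unfolding tendsto_fun_iff
  proof
    fix j
    have lj: "(\<lambda>m. pt (Suc (\<rho> m)) (q (\<rho> m)) j) \<longlonglongrightarrow> a j"
      using lim by (simp add: tendsto_fun_iff o_def)
    have "(\<lambda>m. 2 * R / real (Suc m)) \<longlonglongrightarrow> 0"
      by (rule LIMSEQ_Suc[OF lim_const_over_n])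
    from LIMSEQ_subseq_LIMSEQ[OF this a(2)]
    have z: "(\<lambda>m. 2 * R / real (Suc (\<rho> m))) \<longlonglongrightarrow> 0"
      by (simp add: o_def)
    have "norm (pt (Suc m) (t m) j - pt (Suc m) (q m) j) \<le> 2 * R / real (Suc m)" for m
    proof (cases "j < n")
      case True
      then have "\<bar>real (t m j) - real (q m j)\<bar> \<le> 1" using t[OF True, of m] by linarith
      then have "2 * R * \<bar>real (t m j) - real (q m j)\<bar> / real (Suc m) \<le> 2 * R * 1 / real (Suc m)"
        using R by (intro divide_right_mono mult_left_mono) auto
      moreover have "pt (Suc m) (t m) j - pt (Suc m) (q m) j
          = 2 * R * (real (t m j) - real (q m j)) / real (Suc m)"
        using True by (simp add: pt_def diff_divide_distrib right_diff_distrib del: of_nat_Suc)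
      ultimately show ?thesis
        using R by (simp add: abs_mult del: of_nat_Suc)
    next
      case False
      then show ?thesis using R by (simp add: pt_def del: of_nat_Suc)
    qed
    then have "(\<lambda>m. pt (Suc (\<rho> m)) (t (\<rho> m)) j - pt (Suc (\<rho> m)) (q (\<rho> m)) j) \<longlonglongrightarrow> 0"
      by (intro Lim_null_comparison[OF _ z] always_eventually allI)
    from tendsto_add[OF this lj] show "(\<lambda>m. pt (Suc (\<rho> m)) (t (\<rho> m)) j) \<longlonglongrightarrow> a j"
      by simp
  qed
  have Flim: "(\<lambda>m. F (pt (Suc (\<rho> m)) (t (\<rho> m))) i) \<longlonglongrightarrow> F a i"
    if "i < n" "\<And>m j. j < n \<Longrightarrow> q m j \<le> t m j \<and> t m j \<le> q m j + 1" for t i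
    using continuous_on_tendsto_compose[OF cont[OF that(1)] near[OF that(2)]] by simp
  \<comment> \<open>Vertices labelled 1 converge to \<open>a\<close>. If \<open>F a i < 0\<close>,
    the sign eventually cannot be the source of that label, so these vertices lie on the upper
    face.\<close>
  have neg: "a i = R" if "i < n" "F a i < 0" for i
  proof -
    have "\<forall>\<^sub>F m in sequentially. F (pt (Suc (\<rho> m)) (r (\<rho> m) i)) i < 0"
      by (rule order_tendstoD(2)[OF Flim[where t = "\<lambda>m. r m i"]]) (use that r in auto)
    then have "\<forall>\<^sub>F m in sequentially. pt (Suc (\<rho> m)) (r (\<rho> m) i) i = R"
    proof eventually_elim
      case (elim m)
      then have "r (\<rho> m) i i = Suc (\<rho> m)"
        using lab_r[OF that(1), of "\<rho> m"] by (auto simp: label_def split: if_splits)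
      then show ?case using that by (simp add: pt_def)
    qed
    moreover have "(\<lambda>m. pt (Suc (\<rho> m)) (r (\<rho> m) i) i) \<longlonglongrightarrow> a i"
      using near[of "\<lambda>m. r m i"] r[OF that(1)] by (simp add: tendsto_fun_iff)
    ultimately show ?thesis
      by (blast intro: LIMSEQ_unique tendsto_eventually)
  qed
  have pos: "a i = - R" if "i < n" "0 < F a i" for i
  proof -
    have "\<forall>\<^sub>F m in sequentially. 0 < F (pt (Suc (\<rho> m)) (s (\<rho> m) i)) i"
      by (rule order_tendstoD(1)[OF Flim[where t = "\<lambda>m. s m i"]]) (use that s in auto)
    then have "\<forall>\<^sub>F m in sequentially. pt (Suc (\<rho> m)) (s (\<rho> m) i) i = - R"
    proof eventually_elim
      case (elim m)
      then have "s (\<rho> m) i i = 0"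
        using lab_s[OF that(1), of "\<rho> m"] by (auto simp: label_def split: if_splits)
      then show ?case using that by (simp add: pt_def)
    qed
    moreover have "(\<lambda>m. pt (Suc (\<rho> m)) (s (\<rho> m) i) i) \<longlonglongrightarrow> a i"
      using near[of "\<lambda>m. s m i"] s[OF that(1)] by (simp add: tendsto_fun_iff)
    ultimately show ?thesis
      by (blast intro: LIMSEQ_unique tendsto_eventually)
  qed
  \<comment> \<open>A nonzero component would put \<open>a\<close> on the surface of the cube, while
    \<open>neg\<close> and \<open>pos\<close> make every product \<open>F a j * a j\<close>
    nonpositive, against coercivity.\<close>
  have "F a i = 0" if "i < n" for i
  proof (rule ccontr)
    assume "F a i \<noteq> 0"
    then have "\<bar>a i\<bar> = R"
      using pos[OF that] neg[OF that] R by fastforce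
    then have "0 < (\<Sum>i<n. F a i * a i)"
      using a(1) that by (intro coer) (auto simp: S_def split: if_splits)
    moreover have "F a j * a j \<le> 0" if "j < n" for j
      using pos[OF that] neg[OF that] R
      by (cases "F a j" "0::real" rule: linorder_cases) (auto simp: mult_nonpos_nonneg mult_nonneg_nonpos)
    ultimately show False
      by (meson lessThan_iff not_less sum_nonpos)
  qed
  then show ?thesis by blast
qed

section \<open>Square-integrable fields\<close>

lemma L2_measurable: "L2 S v \<Longrightarrow> v \<in> borel_measurable (lebesgue_on S)"
  by (simp add: L2_def)

lemma L2_inner_integrable:
  assumes "L2 S u" "L2 S v"
  shows "integrable (lebesgue_on S) (\<lambda>x. u x \<bullet> v x)"
proof (rule Bochner_Integration.integrable_bound)
  show "integrable (lebesgue_on S) (\<lambda>x. (norm (u x))\<^sup>2 + (norm (v x))\<^sup>2)"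
    using assms by (simp add: L2_def)
  show "(\<lambda>x. u x \<bullet> v x) \<in> borel_measurable (lebesgue_on S)"
    using assms by (intro borel_measurable_inner) (auto simp: L2_def)
  have "norm (a \<bullet> b) \<le> norm ((norm a)\<^sup>2 + (norm b)\<^sup>2)" for a b :: 'b
  proof -
    have "\<bar>a \<bullet> b\<bar> \<le> norm a * norm b" by (rule Cauchy_Schwarz_ineq2)
    also have "\<dots> \<le> (norm a)\<^sup>2 + (norm b)\<^sup>2"
      using sum_squares_bound[of "norm a" "norm b"] mult_nonneg_nonneg[OF norm_ge_zero norm_ge_zero, of a b]
      by linarith
    finally show ?thesis by simp
  qed
  then show "AE x in lebesgue_on S. norm (u x \<bullet> v x) \<le> norm ((norm (u x))\<^sup>2 + (norm (v x))\<^sup>2)"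
    by simp
qed

lemma L2_scaleR: "L2 S u \<Longrightarrow> L2 S (\<lambda>x. a *\<^sub>R u x)"
  by (auto simp: L2_def power_mult_distrib)

lemma L2_add:
  assumes "L2 S u" "L2 S v"
  shows "L2 S (\<lambda>x. u x + v x)"
proof -
  have "(norm (a + b))\<^sup>2 = (norm a)\<^sup>2 + 2 * (a \<bullet> b) + (norm b)\<^sup>2" for a b :: 'b
    by (simp add: power2_norm_eq_inner inner_add_left inner_add_right inner_commute)
  then show ?thesis
    using assms L2_inner_integrable[OF assms] by (auto simp: L2_def)
qed

lemma L2_zero [simp]: "L2 S (\<lambda>x. 0)"
  by (simp add: L2_def)

lemma L2_diff: "L2 S u \<Longrightarrow> L2 S v \<Longrightarrow> L2 S (\<lambda>x. u x - v x)"
  using L2_add[of S u "\<lambda>x. -1 *\<^sub>R v x"] L2_scaleR[of S v "-1"] by simp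

lemma L2_sum: "(\<And>i. i \<in> I \<Longrightarrow> L2 S (U i)) \<Longrightarrow> L2 S (\<lambda>x. \<Sum>i\<in>I. a i *\<^sub>R U i x)"
  by (induction I rule: infinite_finite_induct) (auto intro!: L2_add[where u = "\<lambda>x. _ *\<^sub>R _ x"] L2_scaleR)

text \<open>The two codomains may differ, so one domination argument serves components, embeddings
  of components and products with bounded fields.\<close>

lemma L2_bounded_mult:
  fixes u :: "real ^ 'd::finite \<Rightarrow> 'b::euclidean_space"
  assumes "L2 S u" "v \<in> borel_measurable (lebesgue_on S)" "\<And>x. x \<in> S \<Longrightarrow> norm (v x) \<le> C * norm (u x)"
  shows "L2 S (v :: _ \<Rightarrow> 'c::euclidean_space)"
  unfolding L2_def
proof (intro conjI)
  show "integrable (lebesgue_on S) (\<lambda>x. (norm (v x))\<^sup>2)"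
  proof (rule Bochner_Integration.integrable_bound)
    show "integrable (lebesgue_on S) (\<lambda>x. C\<^sup>2 * (norm (u x))\<^sup>2)"
      using assms(1) by (simp add: L2_def)
    have "(norm (v x))\<^sup>2 \<le> C\<^sup>2 * (norm (u x))\<^sup>2" if "x \<in> S" for x
      using power_mono[OF assms(3)[OF that], of 2] by (simp add: power_mult_distrib)
    then show "AE x in lebesgue_on S. norm ((norm (v x))\<^sup>2) \<le> norm (C\<^sup>2 * (norm (u x))\<^sup>2)"
      by (intro AE_I2) (simp add: space_restrict_space)
  qed (use assms(2) in measurable)
qed (use assms in auto)

lemma L2_vec_nth:
  fixes u :: "real ^ 'd::finite \<Rightarrow> ('b::euclidean_space) ^ 'm::finite"
  assumes "L2 S u" shows "L2 S (\<lambda>x. u x $ i)"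
proof (rule L2_bounded_mult[OF assms, where C = 1])
  show "(\<lambda>x. u x $ i) \<in> borel_measurable (lebesgue_on S)"
    using L2_measurable[OF assms]
    by (rule borel_measurable_continuous_on[OF continuous_on_component[OF continuous_on_id]])
qed (simp add: Finite_Cartesian_Product.norm_nth_le)

lemma norm_axis: "norm (axis i a :: ('b::real_normed_vector) ^ 'm::finite) = norm a"
proof -
  have "(norm (axis i a $ j :: 'b))\<^sup>2 = (if j = i then (norm a)\<^sup>2 else 0)" for j :: 'm
    by (simp add: axis_def)
  then have "(norm (axis i a :: 'b ^ 'm))\<^sup>2 = (norm a)\<^sup>2"
    by (simp add: norm_vec_def L2_set_def sum_nonneg)
  then show ?thesis by simp
qed

lemma L2_vec_lambda:
  fixes u :: "real ^ 'd::finite \<Rightarrow> ('b::euclidean_space) ^ 'm::finite"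
  assumes "\<And>i. L2 S (\<lambda>x. u x $ i)" shows "L2 S u"
proof -
  have eq: "axis i a = (\<chi> j. if j = i then a else 0)" for i :: 'm and a :: 'b
    by (simp add: axis_def)
  have ax: "L2 S (\<lambda>x. axis i (u x $ i))" for i
  proof (rule L2_bounded_mult[OF assms[of i], where C = 1])
    have "continuous_on UNIV (\<lambda>a. axis i a :: 'b ^ 'm)"
      by (intro linear_continuous_on linear_conv_bounded_linear[THEN iffD1] linearI)
         (auto simp: vec_eq_iff axis_def)
    then show "(\<lambda>x. axis i (u x $ i)) \<in> borel_measurable (lebesgue_on S)"
      using L2_measurable[OF assms[of i]] by (rule borel_measurable_continuous_on)
  qed (simp add: norm_axis)
  have "u x = (\<Sum>i\<in>UNIV. 1 *\<^sub>R axis i (u x $ i))" for x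
    by (simp add: vec_eq_iff axis_def)
  then have "u = (\<lambda>x. \<Sum>i\<in>UNIV. 1 *\<^sub>R axis i (u x $ i))" by blast
  then show ?thesis using L2_sum[of UNIV S "\<lambda>i x. axis i (u x $ i)" "\<lambda>_. 1"] ax by simp
qed

text \<open>Lebesgue measure is complete, so changing a measurable function on a null set keeps it
  measurable. Extension by zero reduces the restricted measure to the full one.\<close>

lemma borel_measurable_lebesgue_on_AE:
  fixes u :: "'a::euclidean_space \<Rightarrow> 'b::euclidean_space"
  assumes "u \<in> borel_measurable (lebesgue_on S)" "AE x in lebesgue_on S. u x = v x"
    and S: "S \<in> sets lebesgue"
  shows "v \<in> borel_measurable (lebesgue_on S)"
proof -
  have "AE x in lebesgue. indicator S x *\<^sub>R u x = indicator S x *\<^sub>R v x"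
    using assms(2) S by (auto simp: AE_restrict_space_iff indicator_def elim: AE_mp)
  with assms(1) S have "(\<lambda>x. indicator S x *\<^sub>R v x) \<in> borel_measurable lebesgue"
    by (simp add: borel_measurable_restrict_space_iff borel_measurable_AE[of "\<lambda>x. indicator S x *\<^sub>R u x"])
  then show ?thesis
    using S by (simp add: borel_measurable_restrict_space_iff)
qed

lemma L2_cong_AE:
  assumes "AE x in lebesgue_on S. u x = v x" "S \<in> sets lebesgue" "L2 S u"
  shows "L2 S v"
proof -
  have "v \<in> borel_measurable (lebesgue_on S)"
    using assms by (blast intro: borel_measurable_lebesgue_on_AE L2_measurable)
  moreover from this have "integrable (lebesgue_on S) (\<lambda>x. (norm (v x))\<^sup>2)"
    using assms by (subst integrable_cong_AE[where g = "\<lambda>x. (norm (u x))\<^sup>2"]) (auto simp: L2_def elim: AE_mp)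
  ultimately show ?thesis by (simp add: L2_def)
qed

lemma L2ip_cong_AE:
  assumes "AE x in lebesgue_on S. u x = u' x" "AE x in lebesgue_on S. v x = v' x"
    and "L2 S u" "L2 S u'" "L2 S v" "L2 S v'"
  shows "L2ip S u v = L2ip S u' v'"
  unfolding L2ip_def
proof (rule integral_cong_AE)
  show "AE x in lebesgue_on S. u x \<bullet> v x = u' x \<bullet> v' x"
    using assms(1,2) by eventually_elim simp
qed (use assms in \<open>auto intro!: borel_measurable_inner simp: L2_def\<close>)

lemma L2sq_eq_L2ip: "L2sq S v = L2ip S v v"
  by (simp add: L2sq_def L2ip_def power2_norm_eq_inner)

lemma L2ip_commute: "L2ip S u v = L2ip S v u"
  by (simp add: L2ip_def inner_commute)

lemma L2sq_nonneg: "0 \<le> L2sq S v"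
  by (simp add: L2sq_def)

lemma L2ip_sum_left:
  assumes "\<And>i. i \<in> I \<Longrightarrow> L2 S (U i)" "L2 S v"
  shows "L2ip S (\<lambda>x. \<Sum>i\<in>I. a i *\<^sub>R U i x) v = (\<Sum>i\<in>I. a i * L2ip S (U i) v)"
  unfolding L2ip_def inner_sum_left
  by (subst Bochner_Integration.integral_sum)
     (use assms in \<open>auto intro!: integrable_mult_right L2_inner_integrable\<close>)

text \<open>The coefficients of the second argument stand outside: a form tested with a combination
  of modes then reads \<open>\<Sum>j. b j * (component j)\<close>, the shape in which the residual
  of the scheme is assembled.\<close>

lemma L2ip_sum_sum:
  assumes "\<And>i. i \<in> I \<Longrightarrow> L2 S (U i)" "\<And>j. j \<in> J \<Longrightarrow> L2 S (V j)"
  shows "L2ip S (\<lambda>x. \<Sum>i\<in>I. a i *\<^sub>R U i x) (\<lambda>x. \<Sum>j\<in>J. b j *\<^sub>R V j x)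
       = (\<Sum>j\<in>J. b j * (\<Sum>i\<in>I. a i * L2ip S (U i) (V j)))"
proof -
  have "L2ip S (\<lambda>x. \<Sum>i\<in>I. a i *\<^sub>R U i x) (\<lambda>x. \<Sum>j\<in>J. b j *\<^sub>R V j x)
      = (\<Sum>j\<in>J. b j * L2ip S (V j) (\<lambda>x. \<Sum>i\<in>I. a i *\<^sub>R U i x))"
    by (subst L2ip_commute) (rule L2ip_sum_left[OF assms(2) L2_sum[OF assms(1)]])
  also have "\<dots> = (\<Sum>j\<in>J. b j * (\<Sum>i\<in>I. a i * L2ip S (U i) (V j)))"
    by (subst L2ip_commute) (auto intro!: sum.cong L2ip_sum_left assms)
  finally show ?thesis .
qed

lemma L2sq_add_le:
  assumes "L2 S u" "L2 S v"
  shows "L2sq S (\<lambda>x. u x + v x) \<le> 2 * L2sq S u + 2 * L2sq S v"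
proof -
  have "(norm (a + b))\<^sup>2 \<le> 2 * (norm a)\<^sup>2 + 2 * (norm b)\<^sup>2" for a b :: 'b
    using inner_ge_zero[of "a - b"]
    by (simp add: power2_norm_eq_inner inner_add_left inner_add_right inner_commute
        inner_diff_left inner_diff_right)
  then have "(LINT x|lebesgue_on S. (norm (u x + v x))\<^sup>2)
      \<le> (LINT x|lebesgue_on S. 2 * (norm (u x))\<^sup>2 + 2 * (norm (v x))\<^sup>2)"
    using assms L2_add[OF assms] by (intro integral_mono) (auto simp: L2_def)
  then show ?thesis using assms by (simp add: L2sq_def L2_def)
qed

lemma L2sq_scaleR: "L2sq S (\<lambda>x. a *\<^sub>R u x) = a\<^sup>2 * L2sq S u"
  by (simp add: L2sq_def power_mult_distrib)

section \<open>Uniqueness of weak gradients\<close>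

text \<open>The positive and the negative part of \<open>h\<close> are densities of two finite
  measures that agree on closed boxes. Boxes are stable under intersection and generate the Borel
  sets, so the measures coincide, and with them the densities almost everywhere.\<close>

lemma AE_0_if_cbox_integrals_0:
  fixes h :: "'a::euclidean_space \<Rightarrow> real"
  assumes h: "integrable lborel h"
    and zero: "\<And>a b. (LINT x|lborel. indicator (cbox a b) x * h x) = 0"
  shows "AE x in lborel. h x = 0"
proof -
  \<comment> \<open>\<open>ennreal\<close> truncates at 0, so these are the positive and the
    negative part of \<open>h\<close>.\<close>
  let ?p = "\<lambda>x. ennreal (h x)" and ?n = "\<lambda>x. ennreal (- h x)"
  have [measurable]: "h \<in> borel_measurable borel" using h by auto
  have enn2real_inj: "a = b" if "enn2real a = enn2real b" "a \<noteq> \<infinity>" "b \<noteq> \<infinity>" for a b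
    using that by (cases a; cases b) auto
  have eq: "emeasure (density lborel ?p) (cbox a b) = emeasure (density lborel ?n) (cbox a b)" for a b
  proof -
    let ?f = "\<lambda>x. indicator (cbox a b) x * h x"
    have int: "integrable lborel ?f"
      using integrable_real_mult_indicator[OF _ h, of "cbox a b"] by (simp add: mult.commute)
    have "enn2real (\<integral>\<^sup>+x. ennreal (?f x) \<partial>lborel) = enn2real (\<integral>\<^sup>+x. ennreal (- ?f x) \<partial>lborel)"
      using real_lebesgue_integral_def[OF int] zero[of a b] by simp
    moreover have "(\<integral>\<^sup>+x. ennreal (?f x) \<partial>lborel) \<noteq> \<infinity>" "(\<integral>\<^sup>+x. ennreal (- ?f x) \<partial>lborel) \<noteq> \<infinity>"
      using real_integrable_def[THEN iffD1, OF int] by auto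
    ultimately have "(\<integral>\<^sup>+x. ennreal (?f x) \<partial>lborel) = (\<integral>\<^sup>+x. ennreal (- ?f x) \<partial>lborel)"
      by (rule enn2real_inj)
    moreover have "ennreal (?f x) = ?p x * indicator (cbox a b) x"
      "ennreal (- ?f x) = ?n x * indicator (cbox a b) x" for x
      by (auto simp: indicator_def)
    ultimately show ?thesis by (simp add: emeasure_density)
  qed
  \<comment> \<open>Closed boxes generate the Borel sets because every open set is a countable union
    of them.\<close>
  have sig: "sets borel = sigma_sets UNIV (range (\<lambda>(a, b). cbox a b :: 'a set))"
  proof -
    have "borel = sigma UNIV (range (\<lambda>(a, b). cbox a b :: 'a set))"
    proof (rule borel_eq_sigmaI1[OF borel_def])
      fix M :: "'a set" assume "M \<in> {S. open S}"
      then have "open M" by simp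
      then obtain D where "countable D" "\<And>X. X \<in> D \<Longrightarrow> \<exists>a b. X = cbox a b" "\<Union>D = M"
        by (metis open_countable_Union_open_cbox)
      moreover from this have "X \<in> sets (sigma UNIV (range (\<lambda>(a, b). cbox a b :: 'a set)))" if "X \<in> D" for X
        using that by fastforce
      ultimately show "M \<in> sets (sigma UNIV (range (\<lambda>(a, b). cbox a b :: 'a set)))"
        by (metis sets.countable_Union subsetI)
    qed auto
    then show ?thesis by (metis sets_measure_of subset_UNIV Pow_UNIV)
  qed
  have fin: "integral\<^sup>N lborel ?p \<noteq> \<infinity>"
    using real_integrable_def[THEN iffD1, OF h] by auto
  have "density lborel ?p = density lborel ?n"
  proof (rule measure_eqI_generator_eq[where E = "range (\<lambda>(a, b). cbox a b :: 'a set)"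
        and A = "\<lambda>k. cbox (- (real k *\<^sub>R One)) (real k *\<^sub>R One)" and \<Omega> = UNIV])
    show "Int_stable (range (\<lambda>(a, b). cbox a b :: 'a set))"
      by (auto simp: Int_stable_def Int_interval)
    show "(\<Union>k. cbox (- (real k *\<^sub>R One)) (real k *\<^sub>R One)) = (UNIV :: 'a set)"
    proof -
      have "\<exists>k. x \<in> cbox (- (real k *\<^sub>R One)) (real k *\<^sub>R One)" for x :: 'a
      proof -
        obtain k where k: "norm x \<le> real k" using real_arch_simple by blast
        have "\<bar>x \<bullet> i\<bar> \<le> real k" if "i \<in> Basis" for i
          using Basis_le_norm[OF that, of x] k by linarith
        then show ?thesis by (intro exI[of _ k]) (auto simp: mem_box abs_le_iff minus_le_iff)
      qed
      then show ?thesis by blast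
    qed
    have "emeasure (density lborel ?p) A \<le> integral\<^sup>N lborel ?p" if "A \<in> sets borel" for A
      using that by (auto simp: emeasure_density intro!: nn_integral_mono split: split_indicator)
    then show "emeasure (density lborel ?p) (cbox (- (real k *\<^sub>R One)) (real k *\<^sub>R One)) \<noteq> \<infinity>" for k
      using fin by (metis cbox_borel infinity_ennreal_def neq_top_trans)
  qed (auto simp: eq sig)
  then have "AE x in lborel. ?p x = ?n x"
    using fin by (subst (asm) finite_density_unique) auto
  \<comment> \<open>One of the two parts is 0 at every point; where they are equal, both are 0 and
    so is \<open>h\<close>.\<close>
  then show ?thesis
    by eventually_elim (metis ennreal_eq_0_iff ennreal_neg linorder_linear neg_0_le_iff_le neg_le_0_iff_le order_antisym)
qed

text \<open>The derivative is carried as a gradient field: its continuity is that of a single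
  function, and the partial derivatives are its components.\<close>

definition c1_field :: "(real ^ 'd::finite \<Rightarrow> real) \<Rightarrow> bool" where
  "c1_field f \<longleftrightarrow> (\<exists>g::real ^ 'd \<Rightarrow> real ^ 'd. continuous_on UNIV g \<and>
      (\<forall>x. (f has_derivative (\<lambda>h. g x \<bullet> h)) (at x)))"

lemma c1_field_const: "c1_field (\<lambda>x::real ^ 'd::finite. c)"
proof -
  have "((\<lambda>x::real ^ 'd. c) has_derivative (\<lambda>h. 0 \<bullet> h)) (at x)" for x
    by simp
  then show ?thesis
    unfolding c1_field_def by (intro exI[of _ "\<lambda>x. 0"] conjI allI continuous_on_const)
qed

lemma c1_field_coord: "c1_field (\<lambda>x. x $ i)"
  unfolding c1_field_def
  by (intro exI[of _ "\<lambda>x. axis i 1"])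
     (auto simp: cart_eq_inner_axis inner_commute intro!: derivative_eq_intros)

lemma c1_field_mult:
  assumes "c1_field f" "c1_field g" shows "c1_field (\<lambda>x. f x * g x)"
proof -
  obtain F G where F: "continuous_on UNIV F" "\<And>x. (f has_derivative (\<lambda>h. F x \<bullet> h)) (at x)"
    and G: "continuous_on UNIV G" "\<And>x. (g has_derivative (\<lambda>h. G x \<bullet> h)) (at x)"
    using assms unfolding c1_field_def by blast
  have "continuous_on UNIV f" "continuous_on UNIV g"
    using F(2) G(2) by (meson continuous_at_imp_continuous_on has_derivative_continuous)+
  then show ?thesis
    unfolding c1_field_def using F(1) G(1)
    by (intro exI[of _ "\<lambda>x. f x *\<^sub>R G x + g x *\<^sub>R F x"])
       (auto intro!: continuous_intros derivative_eq_intros F(2) G(2)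
         simp: inner_add_left algebra_simps)
qed

lemma c1_field_prod: "(\<And>i. i \<in> I \<Longrightarrow> c1_field (f i)) \<Longrightarrow> c1_field (\<lambda>x. \<Prod>i\<in>I. f i x)"
  by (induction I rule: infinite_finite_induct) (auto intro: c1_field_mult c1_field_const)

text \<open>The outer function is constrained on the range of \<open>f\<close> only. This admits
  \<open>k * t / (1 + k * t)\<close>, which for positive \<open>k\<close> has a pole at a negative
  \<open>t\<close>.\<close>

lemma c1_field_compose:
  assumes "c1_field f" "\<And>x. (h has_real_derivative h' (f x)) (at (f x))" "continuous_on (range f) h'"
  shows "c1_field (\<lambda>x. h (f x))"
proof -
  obtain F where F: "continuous_on UNIV F" "\<And>x. (f has_derivative (\<lambda>h. F x \<bullet> h)) (at x)"
    using assms(1) unfolding c1_field_def by blast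
  have "continuous_on UNIV f"
    using F(2) by (meson continuous_at_imp_continuous_on has_derivative_continuous)
  then have "continuous_on UNIV (\<lambda>x. h' (f x))"
    by (rule continuous_on_compose2[OF assms(3)]) auto
  moreover have "((\<lambda>x. h (f x)) has_derivative (\<lambda>k. (h' (f x) *\<^sub>R F x) \<bullet> k)) (at x)" for x
    using has_derivative_compose[OF F(2) assms(2)[unfolded has_field_derivative_def]] by simp
  ultimately show ?thesis
    unfolding c1_field_def using F(1)
    by (intro exI[of _ "\<lambda>x. h' (f x) *\<^sub>R F x"] conjI allI continuous_on_scaleR)
qed

lemma c1_field_test_fn:
  assumes "c1_field f" "compact K" "K \<subseteq> \<Omega>" "\<And>x. x \<notin> K \<Longrightarrow> f x = 0"
  shows "test_fn \<Omega> f"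
proof -
  obtain F where F: "continuous_on UNIV F" "\<And>x. (f has_derivative (\<lambda>h. F x \<bullet> h)) (at x)"
    using assms(1) unfolding c1_field_def by blast
  have "pd f j = (\<lambda>x. F x $ j)" for j
    unfolding pd_def frechet_derivative_at[OF F(2), symmetric]
    by (simp add: inner_axis)
  then show ?thesis
    unfolding test_fn_def using F assms(2-)
    by (auto simp: differentiable_def intro!: continuous_intros)
qed

text \<open>Squaring removes the kink of \<open>max 0 t\<close>: at 0 the difference quotient is
  bounded by \<open>\<bar>h\<bar>\<close>. The result is a one-sided building block for
  bumps.\<close>

lemma max_0_square_DERIV: "((\<lambda>t::real. (max 0 t)\<^sup>2) has_real_derivative 2 * max 0 t) (at t)"
proof (cases t "0::real" rule: linorder_cases)
  case less
  have "((\<lambda>t. 0) has_real_derivative 2 * max 0 t) (at t)"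
    using less by (auto intro!: derivative_eq_intros)
  then show ?thesis
    by (rule has_field_derivative_transform_within_open[where S = "{..<0}"]) (use less in auto)
next
  case greater
  have "((\<lambda>t. t\<^sup>2) has_real_derivative 2 * max 0 t) (at t)"
    using greater by (auto intro!: derivative_eq_intros)
  then show ?thesis
    by (rule has_field_derivative_transform_within_open[where S = "{0<..}"]) (use greater in auto)
next
  case equal
  have "((\<lambda>h::real. (max 0 h)\<^sup>2 / h) \<longlongrightarrow> 0) (at 0)"
  proof (rule Lim_null_comparison)
    show "\<forall>\<^sub>F h in at 0. norm ((max 0 h)\<^sup>2 / h) \<le> \<bar>h::real\<bar>"
      by (auto simp: max_def power2_eq_square)
    show "((\<lambda>h::real. \<bar>h\<bar>) \<longlongrightarrow> 0) (at 0)"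
      by (intro tendsto_eq_intros) auto
  qed
  then show ?thesis using equal by (simp add: has_field_derivative_iff)
qed

text \<open>Saturating \<open>s/(1/k + s)\<close> of a \<open>C\<^sup>1\<close> function \<open>s\<close> that is positive exactly in the box.\<close>

lemma test_fn_approximates_box:
  fixes a b :: "real ^ 'd::finite"
  assumes "cbox a b \<subseteq> \<Omega>"
  obtains \<phi> :: "nat \<Rightarrow> real ^ 'd \<Rightarrow> real" where
    "\<And>k. test_fn \<Omega> (\<phi> k)" "\<And>k x. \<bar>\<phi> k x\<bar> \<le> indicator (box a b) x"
    "\<And>x. (\<lambda>k. \<phi> k x) \<longlonglongrightarrow> indicator (box a b) x"
proof -
  \<comment> \<open>Each factor vanishes beyond one face of the box and touches 0 there with zero
    slope, so the product is continuously differentiable across all faces.\<close>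
  define s where "s x = (\<Prod>i\<in>UNIV. (max 0 (x $ i - a $ i))\<^sup>2 * (max 0 (b $ i - x $ i))\<^sup>2)" for x
  define \<phi> where "\<phi> k x = real k * s x / (1 + real k * s x)" for k x
  have s0: "0 \<le> s x" for x unfolding s_def by (intro prod_nonneg) auto
  have out: "s x = 0" if "x \<notin> box a b" for x
  proof -
    obtain i where "\<not> (a $ i < x $ i \<and> x $ i < b $ i)" using \<open>x \<notin> box a b\<close> by (auto simp: mem_box_cart)
    then show ?thesis unfolding s_def by (intro prod_zero) (auto intro!: exI[of _ i] simp: max_def)
  qed
  have inside: "0 < s x" if "x \<in> box a b" for x
    unfolding s_def
  proof (rule prod_pos)
    fix i
    have "a $ i < x $ i" "x $ i < b $ i" using that by (auto simp: mem_box_cart)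
    then show "0 < (max 0 (x $ i - a $ i))\<^sup>2 * (max 0 (b $ i - x $ i))\<^sup>2" by (simp add: max_def)
  qed
  have d1: "((\<lambda>t. (max 0 (t - c))\<^sup>2) has_real_derivative 2 * max 0 (t - c)) (at t)" for c t :: real
    by (rule DERIV_chain2[OF max_0_square_DERIV, THEN DERIV_cong, OF DERIV_diff[OF DERIV_ident DERIV_const]]) simp
  have d2: "((\<lambda>t. (max 0 (c - t))\<^sup>2) has_real_derivative - 2 * max 0 (c - t)) (at t)" for c t :: real
    by (rule DERIV_chain2[OF max_0_square_DERIV, THEN DERIV_cong, OF DERIV_diff[OF DERIV_const DERIV_ident]]) simp
  have "c1_field (\<lambda>x. (max 0 (x $ i - a $ i))\<^sup>2)" for i
    by (rule c1_field_compose[where h = "\<lambda>t. (max 0 (t - a $ i))\<^sup>2" and h' = "\<lambda>t. 2 * max 0 (t - a $ i)",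
          OF c1_field_coord])
       (auto intro!: continuous_intros d1)
  moreover have "c1_field (\<lambda>x. (max 0 (b $ i - x $ i))\<^sup>2)" for i
    by (rule c1_field_compose[where h = "\<lambda>t. (max 0 (b $ i - t))\<^sup>2" and h' = "\<lambda>t. - 2 * max 0 (b $ i - t)",
          OF c1_field_coord])
       (use d2 in \<open>auto intro!: continuous_intros\<close>)
  ultimately have "c1_field s"
    unfolding s_def by (intro c1_field_prod c1_field_mult)
  then have "c1_field (\<phi> k)" for k
    unfolding \<phi>_def
  proof (rule c1_field_compose[where h' = "\<lambda>t. real k / (1 + real k * t)\<^sup>2"])
    have nz: "1 + real k * s x \<noteq> 0" for x
      using s0[of x] by (metis add_nonneg_eq_0_iff mult_nonneg_nonneg of_nat_0_le_iff zero_le_one zero_neq_one)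
    then show "((\<lambda>t. real k * t / (1 + real k * t)) has_real_derivative real k / (1 + real k * s x)\<^sup>2) (at (s x))" for x
      by (auto intro!: derivative_eq_intros simp: power2_eq_square field_simps)
    show "continuous_on (range s) (\<lambda>t. real k / (1 + real k * t)\<^sup>2)"
      using nz by (auto intro!: continuous_intros)
  qed
  \<comment> \<open>A test function needs a compact set outside which it vanishes; the open box is
    replaced by its closure, which is why the closed box has to lie in
    \<open>\<Omega>\<close>.\<close>
  moreover have "\<phi> k x = 0" if "x \<notin> cbox a b" for k x
    using that out[of x] box_subset_cbox by (auto simp: \<phi>_def)
  ultimately have "test_fn \<Omega> (\<phi> k)" for k
    using assms by (intro c1_field_test_fn[OF _ compact_cbox]) auto
  moreover have "\<bar>\<phi> k x\<bar> \<le> indicator (box a b) x" for k x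
  proof -
    have "0 \<le> real k * s x" using s0[of x] by simp
    then have "\<bar>\<phi> k x\<bar> \<le> 1" by (simp add: \<phi>_def)
    then show ?thesis using out[of x] by (auto simp: \<phi>_def indicator_def)
  qed
  moreover have "(\<lambda>k. \<phi> k x) \<longlonglongrightarrow> indicator (box a b) x" for x
  proof (cases "x \<in> box a b")
    case True
    have "(\<lambda>k. \<phi> k x) \<longlonglongrightarrow> 1"
    proof -
      have "(\<lambda>k. 1 - 1 / (1 + real k * s x)) \<longlonglongrightarrow> 1 - 0"
      proof (intro tendsto_intros real_tendsto_divide_at_top[OF tendsto_const])
        show "LIM k sequentially. 1 + real k * s x :> at_top"
          by (intro filterlim_tendsto_add_at_top[OF tendsto_const] filterlim_at_top_mult_tendsto_pos[OF tendsto_const inside[OF True]] filterlim_real_sequentially)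
      qed
      moreover have "\<phi> k x = 1 - 1 / (1 + real k * s x)" for k
      proof -
        have "0 < 1 + real k * s x" using s0[of x] by (simp add: add_pos_nonneg)
        then show ?thesis by (simp add: \<phi>_def field_simps)
      qed
      ultimately show ?thesis by simp
    qed
    then show ?thesis using True by simp
  next
    case False
    then show ?thesis using out[OF False] by (simp add: \<phi>_def)
  qed
  ultimately show ?thesis by (rule that)
qed

section \<open>Square integrability of test functions and the fundamental lemma\<close>

lemma open_lebesgue [simp]: "open S \<Longrightarrow> S \<in> sets lebesgue"
  by (simp add: borel_open lborelD)

lemma continuous_measurable_lebesgue_on:
  fixes f :: "'a::euclidean_space \<Rightarrow> 'b::euclidean_space"
  shows "continuous_on UNIV f \<Longrightarrow> f \<in> borel_measurable (lebesgue_on S)"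
  by (intro measurable_restrict_space1 measurable_completion) (simp add: borel_measurable_continuous_onI)

lemma L2_continuous_compact_support:
  fixes f :: "real ^ 'd::finite \<Rightarrow> 'b::euclidean_space"
  assumes "continuous_on UNIV f" "compact K" "\<And>x. x \<notin> K \<Longrightarrow> f x = 0" and S: "S \<in> sets lebesgue"
  shows "L2 S f"
  unfolding L2_def
proof (intro conjI continuous_measurable_lebesgue_on)
  have "integrable lborel (\<lambda>x. indicator K x *\<^sub>R (norm (f x))\<^sup>2)"
    using assms(1,2) by (intro borel_integrable_compact) (auto intro!: continuous_intros intro: continuous_on_subset)
  moreover have "(\<lambda>x. indicator K x *\<^sub>R (norm (f x))\<^sup>2) = (\<lambda>x. (norm (f x))\<^sup>2)"
  proof
    show "indicator K x *\<^sub>R (norm (f x))\<^sup>2 = (norm (f x))\<^sup>2" for x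
      using assms(3)[of x] by (cases "x \<in> K") auto
  qed
  ultimately have "integrable lborel (\<lambda>x. (norm (f x))\<^sup>2)" by simp
  then have "integrable lebesgue (\<lambda>x. (norm (f x))\<^sup>2)"
    by (simp add: integrable_completion)
  then show "integrable (lebesgue_on S) (\<lambda>x. (norm (f x))\<^sup>2)"
    using S integrable_mult_indicator[of S lebesgue] by (subst integrable_restrict_space) (auto simp del: real_scaleR_def)
qed (use assms in auto)

lemma test_fn_continuous: "test_fn \<Omega> \<phi> \<Longrightarrow> continuous_on UNIV \<phi>"
  by (auto simp: test_fn_def intro!: continuous_at_imp_continuous_on differentiable_imp_continuous_within)

lemma test_fn_support:
  assumes "test_fn \<Omega> \<phi>"
  obtains K where "compact K" "K \<subseteq> \<Omega>" "\<And>x. x \<notin> K \<Longrightarrow> \<phi> x = 0" "\<And>x j. x \<notin> K \<Longrightarrow> pd \<phi> j x = 0"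
proof -
  obtain K where K: "compact K" "K \<subseteq> \<Omega>" "\<And>x. x \<notin> K \<Longrightarrow> \<phi> x = 0"
    using assms by (auto simp: test_fn_def)
  have "pd \<phi> j x = 0" if "x \<notin> K" for x j
  proof -
    have "((\<lambda>x. 0) has_derivative (\<lambda>h. 0)) (at x)" by simp
    then have "(\<phi> has_derivative (\<lambda>h. 0)) (at x)"
      by (rule has_derivative_transform_within_open[where s = "- K"])
         (use K that in \<open>auto simp: compact_imp_closed\<close>)
    then show ?thesis by (simp add: pd_def frechet_derivative_at[symmetric])
  qed
  with K show ?thesis by (rule that)
qed

lemma test_fn_L2: "test_fn \<Omega> \<phi> \<Longrightarrow> S \<in> sets lebesgue \<Longrightarrow> L2 S \<phi>"
  by (metis L2_continuous_compact_support test_fn_continuous test_fn_support)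

lemma test_fn_pd_L2: "test_fn \<Omega> \<phi> \<Longrightarrow> S \<in> sets lebesgue \<Longrightarrow> L2 S (pd \<phi> j)"
  by (metis L2_continuous_compact_support test_fn_def test_fn_support)

lemma L2_indicator:
  fixes B :: "(real ^ 'd::finite) set"
  assumes "B \<in> lmeasurable" "S \<in> sets lebesgue"
  shows "L2 S (indicator B :: _ \<Rightarrow> real)"
proof -
  have "integrable lebesgue (indicator B :: _ \<Rightarrow> real)"
    using assms(1) by (auto simp: fmeasurable_def intro: integrable_real_indicator)
  then have "integrable (lebesgue_on S) (indicator B :: _ \<Rightarrow> real)"
    using assms(2) integrable_mult_indicator[of S lebesgue] by (subst integrable_restrict_space) (auto simp del: real_scaleR_def)
  moreover have "(\<lambda>x. (norm (indicator B x :: real))\<^sup>2) = indicator B"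
    by (auto simp: indicator_def)
  ultimately show ?thesis by (simp add: L2_def)
qed

text \<open>The bumps converge to the indicator of the open box, whereas closed boxes generate the
  Borel sets and exhaust open sets; this identification links the two.\<close>

lemma lebesgue_cbox_box: "AE x in lebesgue. indicator (cbox a b) x = (indicator (box a b) x :: real)"
proof -
  have "cbox a b - box a b \<in> null_sets lebesgue"
    using negligible_iff_null_sets negligible_frontier_interval by blast
  then show ?thesis
    by (rule AE_I') (use box_subset_cbox[of a b] in \<open>auto simp: indicator_def\<close>)
qed

text \<open>Bumps converge boundedly to the indicator of a box, so the integral of \<open>g\<close>
  over every box in \<open>\<Omega>\<close> is 0. The criterion on box integrals then applies inside
  each of countably many closed boxes that exhaust \<open>\<Omega>\<close>.\<close>

lemma fundamental_lemma_calculus_of_variations: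
  fixes g :: "real ^ 'd::finite \<Rightarrow> real"
  assumes \<Omega>: "open \<Omega>" and g: "L2 \<Omega> g"
    and zero: "\<And>\<phi>. test_fn \<Omega> \<phi> \<Longrightarrow> (LINT x|lebesgue_on \<Omega>. g x * \<phi> x) = 0"
  shows "AE x in lebesgue_on \<Omega>. g x = 0"
proof -
  have \<Omega>m [simp]: "\<Omega> \<in> sets lebesgue" using \<Omega> by simp
  have int: "integrable (lebesgue_on \<Omega>) (\<lambda>x. g x * indicator B x)" if "B \<in> lmeasurable" for B
    using L2_inner_integrable[OF g L2_indicator[OF that]] by simp
  have box0: "(LINT x|lebesgue_on \<Omega>. g x * indicator (box a b) x) = 0" if ab: "cbox a b \<subseteq> \<Omega>" for a b
  proof -
    obtain \<phi> :: "nat \<Rightarrow> real ^ 'd \<Rightarrow> real" where test: "\<And>k. test_fn \<Omega> (\<phi> k)"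
      and le: "\<And>k x. \<bar>\<phi> k x\<bar> \<le> indicator (box a b) x"
      and lim: "\<And>x. (\<lambda>k. \<phi> k x) \<longlonglongrightarrow> indicator (box a b) x"
      by (rule test_fn_approximates_box[OF ab]) (rule that)
    have "(\<lambda>k. LINT x|lebesgue_on \<Omega>. g x * \<phi> k x) \<longlonglongrightarrow> (LINT x|lebesgue_on \<Omega>. g x * indicator (box a b) x)"
    proof (rule integral_dominated_convergence)
      show "integrable (lebesgue_on \<Omega>) (\<lambda>x. norm (g x * indicator (box a b) x))"
        by (intro integrable_norm int) simp
      show "(\<lambda>x. g x * indicator (box a b) x) \<in> borel_measurable (lebesgue_on \<Omega>)"
        using int[of "box a b"] by auto
      show "(\<lambda>x. g x * \<phi> k x) \<in> borel_measurable (lebesgue_on \<Omega>)" for k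
        using L2_measurable[OF g] L2_measurable[OF test_fn_L2[OF test \<Omega>m]] by simp
      show "AE x in lebesgue_on \<Omega>. (\<lambda>k. g x * \<phi> k x) \<longlonglongrightarrow> g x * indicator (box a b) x"
        by (intro AE_I2 tendsto_mult tendsto_const lim)
      show "AE x in lebesgue_on \<Omega>. norm (g x * \<phi> k x) \<le> norm (g x * indicator (box a b) x)" for k
        by (intro AE_I2) (simp add: abs_mult mult_left_mono le)
    qed
    then show ?thesis
      using zero[OF test] by (simp add: LIMSEQ_const_iff)
  qed
  have cbox0: "(LINT x|lebesgue. indicator (cbox a b) x * g x) = 0"
    and cboxi: "integrable lebesgue (\<lambda>x. indicator (cbox a b) x * g x)" if ab: "cbox a b \<subseteq> \<Omega>" for a b
  proof -
    have eq: "indicator \<Omega> x *\<^sub>R (g x * indicator (cbox a b) x) = indicator (cbox a b) x * g x" for x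
      using ab by (auto simp: indicator_def)
    show i: "integrable lebesgue (\<lambda>x. indicator (cbox a b) x * g x)"
      using int[of "cbox a b"] by (simp add: integrable_restrict_space eq del: real_scaleR_def)
    have "(LINT x|lebesgue. indicator (cbox a b) x * g x)
        = (LINT x|lebesgue_on \<Omega>. g x * indicator (cbox a b) x)"
      by (subst integral_restrict_space) (auto simp: eq simp del: real_scaleR_def)
    also have "\<dots> = (LINT x|lebesgue_on \<Omega>. g x * indicator (box a b) x)"
    proof (rule integral_cong_AE)
      show "AE x in lebesgue_on \<Omega>. g x * indicator (cbox a b) x = g x * indicator (box a b) x"
        using lebesgue_cbox_box[of a b] by (auto simp: AE_restrict_space_iff elim: AE_mp)
    qed (use int[of "cbox a b"] int[of "box a b"] in auto)
    finally show "(LINT x|lebesgue. indicator (cbox a b) x * g x) = 0"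
      using box0[OF ab] by simp
  qed
  \<comment> \<open>Cutting \<open>g\<close> off to one box makes it integrable on the whole space.
    Its integral over any other box is one over the intersection, again a box inside
    \<open>\<Omega>\<close>.\<close>
  have cboxAE: "AE x in lebesgue. x \<in> cbox c d \<longrightarrow> g x = 0" if cd: "cbox c d \<subseteq> \<Omega>" for c d
  proof -
    let ?h = "\<lambda>x. indicator (cbox c d) x * g x"
    \<comment> \<open>The criterion on box integrals is about Borel functions, so the Lebesgue
      measurable cut-off is replaced by a Borel representative.\<close>
    obtain h where h: "h \<in> borel_measurable lborel" "AE x in lborel. ?h x = h x"
      using completion_ex_borel_measurable_real[of ?h lborel] cboxi[OF cd] by auto
    have AEh: "AE x in lebesgue. ?h x = h x" using h(2) by (simp add: AE_completion_iff)
    have hm: "h \<in> borel_measurable lebesgue" using h(1) by (rule measurable_completion)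
    have "AE x in lborel. h x = 0"
    proof (rule AE_0_if_cbox_integrals_0)
      have "integrable lebesgue h"
        using cboxi[OF cd] by (rule integrable_cong_AE_imp) (use AEh hm in \<open>auto elim: AE_mp\<close>)
      then show "integrable lborel h" using h(1) by (simp add: integrable_completion)
      fix a b
      obtain e f where ef: "cbox a b \<inter> cbox c d = cbox e f"
        unfolding Int_interval by blast
      have "(\<lambda>x. indicator (cbox a b) x * ?h x) = (\<lambda>x. indicator (cbox e f) x * g x)"
        by (auto simp: indicator_def simp flip: ef)
      moreover have "cbox e f \<subseteq> \<Omega>" using cd ef by blast
      ultimately have gz: "(LINT x|lebesgue. indicator (cbox a b) x * ?h x) = 0"
        using cbox0[of e f] by (simp only:)
      have "(LINT x|lborel. indicator (cbox a b) x * h x) = (LINT x|lebesgue. indicator (cbox a b) x * h x)"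
        using h(1) by (intro integral_completion[symmetric]) simp
      also have "\<dots> = (LINT x|lebesgue. indicator (cbox a b) x * ?h x)"
      proof (rule integral_cong_AE)
        have [measurable]: "cbox a b \<in> sets lebesgue" by simp
        show "(\<lambda>x. indicator (cbox a b) x * h x) \<in> borel_measurable lebesgue"
          using hm by measurable
        show "(\<lambda>x. indicator (cbox a b) x * ?h x) \<in> borel_measurable lebesgue"
          by (rule borel_measurable_times[OF _ borel_measurable_integrable[OF cboxi[OF cd]]]) measurable
      qed (use AEh in \<open>auto elim: AE_mp\<close>)
      also have "\<dots> = 0" by (rule gz)
      finally show "(LINT x|lborel. indicator (cbox a b) x * h x) = 0" .
    qed
    then have "AE x in lebesgue. h x = 0" by (simp add: AE_completion_iff)
    with AEh show ?thesis by eventually_elim auto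
  qed
  obtain D where D: "countable D" "D \<subseteq> Pow \<Omega>" "\<And>X. X \<in> D \<Longrightarrow> \<exists>a b. X = cbox a b" "\<Union>D = \<Omega>"
    using open_countable_Union_open_cbox[OF \<Omega>] by metis
  have "AE x in lebesgue. \<forall>X\<in>D. x \<in> X \<longrightarrow> g x = 0"
  proof (subst AE_ball_countable[OF D(1)], safe)
    fix X assume "X \<in> D"
    then obtain a b where "X = cbox a b" "cbox a b \<subseteq> \<Omega>" using D by blast
    then show "AE x in lebesgue. x \<in> X \<longrightarrow> g x = 0" using cboxAE by simp
  qed
  then have "AE x in lebesgue. x \<in> \<Omega> \<longrightarrow> g x = 0"
    by eventually_elim (use D(4) in blast)
  then show ?thesis by (simp add: AE_restrict_space_iff)
qed

section \<open>Uniqueness and almost-everywhere linearity of weak gradients\<close>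

lemma weak_grad_s_L2: "weak_grad_s \<Omega> p g \<Longrightarrow> L2 \<Omega> p \<and> L2 \<Omega> g"
  by (simp add: weak_grad_s_def)

lemma weak_grad_s_unique:
  fixes \<Omega> :: "(real ^ 'd::finite) set"
  assumes "open \<Omega>" "weak_grad_s \<Omega> p g" "weak_grad_s \<Omega> p g'"
  shows "AE x in lebesgue_on \<Omega>. g x = g' x"
proof -
  have L: "L2 \<Omega> g" "L2 \<Omega> g'" using assms weak_grad_s_L2 by auto
  have "AE x in lebesgue_on \<Omega>. g x $ j - g' x $ j = 0" for j
  proof (rule fundamental_lemma_calculus_of_variations[OF assms(1)])
    show "L2 \<Omega> (\<lambda>x. g x $ j - g' x $ j)" by (intro L2_diff L2_vec_nth L)
    fix \<phi> assume t: "test_fn \<Omega> \<phi>"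
    have i: "integrable (lebesgue_on \<Omega>) (\<lambda>x. h x $ j * \<phi> x)" if "L2 \<Omega> h" for h :: "_ \<Rightarrow> real ^ 'd"
      using L2_inner_integrable[OF L2_vec_nth[OF that] test_fn_L2[OF t]] assms(1) by simp
    have "(LINT x|lebesgue_on \<Omega>. (g x $ j - g' x $ j) * \<phi> x)
        = (LINT x|lebesgue_on \<Omega>. g x $ j * \<phi> x) - (LINT x|lebesgue_on \<Omega>. g' x $ j * \<phi> x)"
      by (simp add: left_diff_distrib i L)
    also have "\<dots> = 0"
    proof -
      have "(LINT x|lebesgue_on \<Omega>. p x * pd \<phi> j x) = - (LINT x|lebesgue_on \<Omega>. g x $ j * \<phi> x)"
        using assms(2) t unfolding weak_grad_s_def by blast
      moreover have "(LINT x|lebesgue_on \<Omega>. p x * pd \<phi> j x) = - (LINT x|lebesgue_on \<Omega>. g' x $ j * \<phi> x)"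
        using assms(3) t unfolding weak_grad_s_def by blast
      ultimately show ?thesis by simp
    qed
    finally show "(LINT x|lebesgue_on \<Omega>. (g x $ j - g' x $ j) * \<phi> x) = 0" .
  qed
  then have "AE x in lebesgue_on \<Omega>. \<forall>j\<in>UNIV. g x $ j - g' x $ j = 0"
    by (subst AE_ball_countable) auto
  then show ?thesis by eventually_elim (simp add: vec_eq_iff)
qed

lemma weak_grad_s_sum:
  fixes \<Omega> :: "(real ^ 'd::finite) set"
  assumes "open \<Omega>" "\<And>i. i \<in> I \<Longrightarrow> weak_grad_s \<Omega> (p i) (g i)"
  shows "weak_grad_s \<Omega> (\<lambda>x. \<Sum>i\<in>I. a i *\<^sub>R p i x) (\<lambda>x. \<Sum>i\<in>I. a i *\<^sub>R g i x)"
  unfolding weak_grad_s_def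
proof (intro conjI allI impI L2_sum)
  fix i assume "i \<in> I"
  then show "L2 \<Omega> (p i)" "L2 \<Omega> (g i)" using assms weak_grad_s_L2 by auto
next
  fix \<phi> j assume t: "test_fn \<Omega> \<phi>"
  have L: "L2 \<Omega> (p i)" "L2 \<Omega> (\<lambda>x. g i x $ j)" if "i \<in> I" for i
    using weak_grad_s_L2[OF assms(2)[OF that]] L2_vec_nth[of \<Omega> "g i" j] by auto
  have "L2 \<Omega> \<phi>" "L2 \<Omega> (pd \<phi> j)"
    using test_fn_L2[OF t] test_fn_pd_L2[OF t] assms(1) by auto
  note * = L2ip_sum_left[where a = a, OF L(1) this(2)] L2ip_sum_left[where a = a, OF L(2) this(1)]
  have "(LINT x|lebesgue_on \<Omega>. (\<Sum>i\<in>I. a i *\<^sub>R p i x) * pd \<phi> j x)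
      = (\<Sum>i\<in>I. a i * (LINT x|lebesgue_on \<Omega>. p i x * pd \<phi> j x))"
    using *(1) by (simp add: L2ip_def)
  also have "\<dots> = (\<Sum>i\<in>I. a i * - (LINT x|lebesgue_on \<Omega>. g i x $ j * \<phi> x))"
    using assms(2) t by (intro sum.cong refl) (simp add: weak_grad_s_def)
  also have "\<dots> = - (LINT x|lebesgue_on \<Omega>. (\<Sum>i\<in>I. a i *\<^sub>R g i x) $ j * \<phi> x)"
    using *(2) by (simp add: L2ip_def sum_negf)
  finally show "(LINT x|lebesgue_on \<Omega>. (\<Sum>i\<in>I. a i *\<^sub>R p i x) * pd \<phi> j x)
      = - (LINT x|lebesgue_on \<Omega>. (\<Sum>i\<in>I. a i *\<^sub>R g i x) $ j * \<phi> x)" .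
qed

lemma weak_grad_v_sum:
  fixes \<Omega> :: "(real ^ 'd::finite) set"
  assumes "open \<Omega>" "\<And>i. i \<in> I \<Longrightarrow> weak_grad_v \<Omega> (v i) (G i)"
  shows "weak_grad_v \<Omega> (\<lambda>x. \<Sum>i\<in>I. a i *\<^sub>R v i x) (\<lambda>x. \<Sum>i\<in>I. a i *\<^sub>R G i x)"
  using weak_grad_s_sum[OF assms(1), of I "\<lambda>i x. v i x $ k" "\<lambda>i x. G i x $ k" a for k] assms(2)
  by (simp add: weak_grad_v_def)

lemma weak_grad_v_unique:
  fixes \<Omega> :: "(real ^ 'd::finite) set"
  assumes "open \<Omega>" "weak_grad_v \<Omega> v G" "weak_grad_v \<Omega> v G'"
  shows "AE x in lebesgue_on \<Omega>. G x = G' x"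
proof -
  have "AE x in lebesgue_on \<Omega>. G x $ i = G' x $ i" for i
    using assms(2,3) by (intro weak_grad_s_unique[OF assms(1), of "\<lambda>x. v x $ i"]) (auto simp: weak_grad_v_def)
  then have "AE x in lebesgue_on \<Omega>. \<forall>i\<in>UNIV. G x $ i = G' x $ i"
    by (subst AE_ball_countable) auto
  then show ?thesis by eventually_elim (simp add: vec_eq_iff)
qed

lemma grad_s_weak: "weak_grad_s \<Omega> p g \<Longrightarrow> weak_grad_s \<Omega> p (grad_s \<Omega> p)"
  unfolding grad_s_def by (rule someI[of "weak_grad_s \<Omega> p"])

lemma grad_v_weak: "weak_grad_v \<Omega> v G \<Longrightarrow> weak_grad_v \<Omega> v (grad_v \<Omega> v)"
  unfolding grad_v_def by (rule someI[of "weak_grad_v \<Omega> v"])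

lemma grad_s_sum_AE:
  fixes \<Omega> :: "(real ^ 'd::finite) set"
  assumes "open \<Omega>" "\<And>i. i \<in> I \<Longrightarrow> weak_grad_s \<Omega> (p i) (g i)"
  shows "AE x in lebesgue_on \<Omega>. grad_s \<Omega> (\<lambda>x. \<Sum>i\<in>I. a i *\<^sub>R p i x) x = (\<Sum>i\<in>I. a i *\<^sub>R grad_s \<Omega> (p i) x)"
proof -
  have "weak_grad_s \<Omega> (\<lambda>x. \<Sum>i\<in>I. a i *\<^sub>R p i x) (\<lambda>x. \<Sum>i\<in>I. a i *\<^sub>R grad_s \<Omega> (p i) x)"
    using assms grad_s_weak by (intro weak_grad_s_sum) auto
  then show ?thesis using weak_grad_s_unique[OF assms(1)] grad_s_weak by blast
qed

lemma grad_v_sum_AE: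
  fixes \<Omega> :: "(real ^ 'd::finite) set"
  assumes "open \<Omega>" "\<And>i. i \<in> I \<Longrightarrow> weak_grad_v \<Omega> (v i) (G i)"
  shows "AE x in lebesgue_on \<Omega>. grad_v \<Omega> (\<lambda>x. \<Sum>i\<in>I. a i *\<^sub>R v i x) x = (\<Sum>i\<in>I. a i *\<^sub>R grad_v \<Omega> (v i) x)"
proof -
  have "weak_grad_v \<Omega> (\<lambda>x. \<Sum>i\<in>I. a i *\<^sub>R v i x) (\<lambda>x. \<Sum>i\<in>I. a i *\<^sub>R grad_v \<Omega> (v i) x)"
    using assms grad_v_weak by (intro weak_grad_v_sum) auto
  then show ?thesis using weak_grad_v_unique[OF assms(1)] grad_v_weak by blast
qed

section \<open>Piecewise polynomials are weakly differentiable\<close>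

lemma c1_field_add:
  assumes "c1_field f" "c1_field g" shows "c1_field (\<lambda>x. f x + g x)"
proof -
  obtain F G where F: "continuous_on UNIV F" "\<And>x. (f has_derivative (\<lambda>h. F x \<bullet> h)) (at x)"
    and G: "continuous_on UNIV G" "\<And>x. (g has_derivative (\<lambda>h. G x \<bullet> h)) (at x)"
    using assms unfolding c1_field_def by blast
  have "((\<lambda>x. f x + g x) has_derivative (\<lambda>h. (F x + G x) \<bullet> h)) (at x)" for x
    using has_derivative_add[OF F(2) G(2)] by (simp add: inner_add_left)
  then show ?thesis
    unfolding c1_field_def using F(1) G(1)
    by (intro exI[of _ "\<lambda>x. F x + G x"] conjI allI continuous_on_add)
qed

lemma c1_field_sum: "(\<And>i. i \<in> I \<Longrightarrow> c1_field (f i)) \<Longrightarrow> c1_field (\<lambda>x. \<Sum>i\<in>I. f i x)"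
  by (induction I rule: infinite_finite_induct) (auto intro: c1_field_add c1_field_const)

lemma c1_field_power: "c1_field f \<Longrightarrow> c1_field (\<lambda>x. f x ^ n)"
  by (induction n) (auto intro: c1_field_mult c1_field_const)

text \<open>The polynomial of a cell makes sense on the whole space. Treating the cell function as
  the restriction of a global \<open>C^1\<close> function avoids one-sided derivatives at the edge
  of the cell.\<close>

lemma poly_on_c1:
  assumes "poly_on K simp l v"
  obtains q where "c1_field q" "\<And>x. x \<in> K \<Longrightarrow> v x = q x"
proof -
  obtain c where c: "\<And>x. x \<in> K \<Longrightarrow> v x = (\<Sum>\<alpha>\<in>mono_set simp l. c \<alpha> * (\<Prod>j\<in>UNIV. (x $ j) ^ (\<alpha> j)))"
    using assms unfolding poly_on_def by blast
  have "c1_field (\<lambda>x. \<Sum>\<alpha>\<in>mono_set simp l. c \<alpha> * (\<Prod>j\<in>UNIV. (x $ j) ^ (\<alpha> j)))"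
    by (intro c1_field_sum c1_field_mult c1_field_const c1_field_prod c1_field_power c1_field_coord)
  then show ?thesis using c by (rule that)
qed

lemma c1_field_lipschitz:
  assumes "c1_field f" "compact K" "convex K"
  obtains L where "L-lipschitz_on K f"
proof -
  obtain F where F: "continuous_on UNIV F" "\<And>x. (f has_derivative (\<lambda>h. F x \<bullet> h)) (at x)"
    using assms(1) unfolding c1_field_def by blast
  have "compact (F ` K)"
    using F(1) assms(2) by (meson compact_continuous_image continuous_on_subset subset_UNIV)
  then have "\<exists>B>0. \<forall>z\<in>F ` K. norm z \<le> B"
    using compact_imp_bounded bounded_pos by blast
  then obtain B where B: "0 < B" "\<And>x. x \<in> K \<Longrightarrow> norm (F x) \<le> B"
    by blast
  have "B-lipschitz_on K f"
  proof (rule bounded_derivative_imp_lipschitz)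
    show "(f has_derivative (\<lambda>h. F x \<bullet> h)) (at x within K)" for x
      using F(2) by (rule has_derivative_at_withinI)
    show "onorm (\<lambda>h. F x \<bullet> h) \<le> B" if "x \<in> K" for x
    proof (rule onorm_le)
      show "norm (F x \<bullet> h) \<le> B * norm h" for h
        using Cauchy_Schwarz_ineq2[of "F x" h] mult_right_mono[OF B(2)[OF that] norm_ge_zero[of h]] by simp
    qed
  qed (use B assms in auto)
  then show ?thesis by (rule that)
qed

text \<open>Pulled back to the segment parameter, the cells become finitely many closed sets
  covering an interval, and Lipschitz bounds with a common constant on such pieces combine to one on
  the interval, however the segment crosses the cells.\<close>

lemma piecewise_lipschitz_segment:
  fixes p :: "'a::real_normed_vector \<Rightarrow> real"
  assumes "finite T" "\<And>K. K \<in> T \<Longrightarrow> closed K" "\<And>K. K \<in> T \<Longrightarrow> L-lipschitz_on K p" "0 \<le> L"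
    and seg: "closed_segment x y \<subseteq> \<Union>T"
  shows "\<bar>p y - p x\<bar> \<le> L * norm (y - x)"
proof -
  define \<gamma> where "\<gamma> t = x + t *\<^sub>R (y - x)" for t
  have "(L * norm (y - x))-lipschitz_on {0..1} (\<lambda>t. p (\<gamma> t))"
  proof (rule lipschitz_on_closed_Union[where U = "\<lambda>K. \<gamma> -` K" and I = T])
    fix K assume K: "K \<in> T"
    have "continuous_on UNIV \<gamma>" unfolding \<gamma>_def by (intro continuous_intros)
    then show "closed (\<gamma> -` K)" using assms(2)[OF K] by (rule closed_vimage[rotated])
    show "(L * norm (y - x))-lipschitz_on (\<gamma> -` K) (\<lambda>t. p (\<gamma> t))"
    proof (rule lipschitz_onI)
      fix s t assume "s \<in> \<gamma> -` K" "t \<in> \<gamma> -` K"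
      then have "dist (p (\<gamma> s)) (p (\<gamma> t)) \<le> L * dist (\<gamma> s) (\<gamma> t)"
        using lipschitz_onD[OF assms(3)[OF K]] by simp
      also have "\<gamma> s - \<gamma> t = (s - t) *\<^sub>R (y - x)" by (simp add: \<gamma>_def algebra_simps)
      then have "dist (\<gamma> s) (\<gamma> t) = dist s t * norm (y - x)" by (simp add: dist_norm)
      finally show "dist (p (\<gamma> s)) (p (\<gamma> t)) \<le> L * norm (y - x) * dist s t" by (simp add: mult_ac)
    qed (use assms(4) in simp)
  next
    have "\<gamma> t \<in> \<Union>T" if "t \<in> {0..1}" for t
    proof -
      have "\<gamma> t = (1 - t) *\<^sub>R x + t *\<^sub>R y" by (simp add: \<gamma>_def algebra_simps)
      then have "\<gamma> t \<in> closed_segment x y" using that by (auto simp: in_segment)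
      then show ?thesis using seg by blast
    qed
    then show "{0..1} \<subseteq> (\<Union>K\<in>T. \<gamma> -` K)" by blast
  qed (use assms in auto)
  from lipschitz_onD[OF this, of 1 0] show ?thesis by (simp add: \<gamma>_def dist_norm)
qed

lemma lipschitz_boundary_negligible:
  fixes \<Omega> :: "(real ^ 'd::finite) set"
  assumes "open \<Omega>" "lipschitz_boundary \<Omega>"
  shows "negligible (frontier \<Omega>)"
proof (subst locally_negligible_alt, rule ballI)
  fix x assume x: "x \<in> frontier \<Omega>"
  then obtain r e g C where r: "r > 0" and e: "norm e = 1" and g: "C-lipschitz_on UNIV g"
    and eq: "\<Omega> \<inter> ball x r = {y \<in> ball x r. y \<bullet> e < g (y - (y \<bullet> e) *\<^sub>R e)}"
    using assms(2) unfolding lipschitz_boundary_def by meson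
  have cg: "continuous_on UNIV g" using g by (rule lipschitz_on_continuous_on)
  let ?U = "frontier \<Omega> \<inter> ball x r"
  \<comment> \<open>Parametrises the graph of \<open>g\<close> by the hyperplane orthogonal to
    \<open>e\<close>. The hyperplane is a null set, and a Lipschitz map of the space into itself
    preserves null sets.\<close>
  define F where "F z = z + g z *\<^sub>R e" for z
  have "negligible (F ` {z. e \<bullet> z = 0})"
  proof (rule negligible_locally_Lipschitz_image)
    show "negligible {z. e \<bullet> z = 0}" using e by (intro negligible_hyperplane) auto
    fix z
    have "norm (F y - F z) \<le> (1 + C) * norm (y - z)" for y
    proof -
      have "F y - F z = (y - z) + (g y - g z) *\<^sub>R e" by (simp add: F_def algebra_simps)
      then have "norm (F y - F z) \<le> norm (y - z) + \<bar>g y - g z\<bar>"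
        using norm_triangle_ineq[of "y - z" "(g y - g z) *\<^sub>R e"] e by simp
      moreover have "\<bar>g y - g z\<bar> \<le> C * norm (y - z)"
        using lipschitz_onD[OF g, of y z] by (simp add: dist_norm)
      ultimately show ?thesis by (simp add: distrib_right)
    qed
    then show "\<exists>T B. open T \<and> z \<in> T \<and> (\<forall>y\<in>{z. e \<bullet> z = 0} \<inter> T. norm (F y - F z) \<le> B * norm (y - z))"
      by (intro exI[of _ UNIV] exI[of _ "1 + C"]) auto
  qed simp
  moreover have "?U \<subseteq> F ` {z. e \<bullet> z = 0}"
  proof
    fix y assume y: "y \<in> ?U"
    define z where "z = y - (y \<bullet> e) *\<^sub>R e"
    have ee: "e \<bullet> e = 1" using e by (simp add: power2_norm_eq_inner[symmetric])
    then have z0: "e \<bullet> z = 0" by (simp add: z_def inner_diff_right inner_commute)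
    have "y \<notin> \<Omega>" using y assms(1) frontier_disjoint_eq by blast
    then have ge: "g z \<le> y \<bullet> e" using eq y unfolding z_def by force
    \<comment> \<open>Inside the ball, the points strictly above the graph form an open set disjoint
      from \<open>\<Omega>\<close>, so none of them is in its closure.\<close>
    have "\<not> g z < y \<bullet> e"
    proof
      assume gt: "g z < y \<bullet> e"
      define V where "V = ball x r \<inter> {w. g (w - (w \<bullet> e) *\<^sub>R e) < w \<bullet> e}"
      have "open {w. g (w - (w \<bullet> e) *\<^sub>R e) < w \<bullet> e}"
        by (intro open_Collect_less continuous_intros continuous_on_compose2[OF cg]) auto
      then have "open V" unfolding V_def by blast
      moreover have "y \<in> V" using gt y by (auto simp: V_def z_def)
      moreover have "y \<in> closure \<Omega>" using y by (simp add: frontier_def)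
      ultimately obtain w where "w \<in> V" "w \<in> \<Omega>" by (meson closure_iff_nhds_not_empty disjoint_iff subset_refl)
      then show False using eq unfolding V_def by force
    qed
    with ge have "F z = y" by (simp add: F_def z_def)
    then show "y \<in> F ` {z. e \<bullet> z = 0}" using z0 by blast
  qed
  ultimately have "negligible ?U" by (rule negligible_subset)
  then show "\<exists>U. openin (top_of_set (frontier \<Omega>)) U \<and> x \<in> U \<and> negligible U"
    using x r by (intro exI[of _ ?U]) (auto intro: openin_open_Int)
qed

section \<open>Difference quotients: limits, bounds and translation\<close>

lemma integrable_lborel_bounded_support:
  fixes f :: "'a::euclidean_space \<Rightarrow> real"
  assumes "f \<in> borel_measurable borel" "bounded S" "S \<in> sets borel" "\<And>x. \<bar>f x\<bar> \<le> C * indicator S x"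
  shows "integrable lborel f"
proof (rule Bochner_Integration.integrable_bound)
  show "integrable lborel (\<lambda>x. C * indicator S x :: real)"
    using assms(2,3) emeasure_bounded_finite[of S]
    by (intro integrable_mult_right integrable_real_indicator) auto
  show "AE x in lborel. norm (f x) \<le> norm (C * indicator S x :: real)"
    using assms(4) by (intro AE_I2) (metis abs_ge_self order_trans real_norm_def)
qed (use assms in simp)

text \<open>The null sequence may have either sign: the test function is shifted by
  \<open>k n\<close>, the piecewise polynomial by \<open>- k n\<close>.\<close>

lemma has_derivative_quotient_tendsto:
  fixes f :: "'a::real_normed_vector \<Rightarrow> real"
  assumes "(f has_derivative D) (at x)" "k \<longlonglongrightarrow> 0" "\<And>n. k n \<noteq> 0"
  shows "(\<lambda>n. (f (x + k n *\<^sub>R e) - f x) / k n) \<longlonglongrightarrow> D e"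
proof -
  interpret D: bounded_linear D using assms(1) by (rule has_derivative_bounded_linear)
  have "((\<lambda>t. x + t *\<^sub>R e) has_derivative (\<lambda>t. t *\<^sub>R e)) (at 0)"
    by (auto intro!: derivative_eq_intros)
  moreover have "(f has_derivative D) (at (x + 0 *\<^sub>R e))" using assms(1) by simp
  ultimately have "((\<lambda>t. f (x + t *\<^sub>R e)) has_derivative (\<lambda>t. D (t *\<^sub>R e))) (at 0)"
    by (rule has_derivative_compose)
  then have "((\<lambda>t. f (x + t *\<^sub>R e)) has_real_derivative D e) (at 0)"
    by (simp add: has_field_derivative_def D.scaleR mult.commute[of _ "D e"] mult_commute_abs)
  then have "((\<lambda>t. (f (x + t *\<^sub>R e) - f x) / t) \<longlongrightarrow> D e) (at 0)"
    by (simp add: has_field_derivative_iff)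
  moreover have "filterlim k (at 0) sequentially"
    using assms(2,3) by (intro filterlim_atI) auto
  ultimately show ?thesis by (rule filterlim_compose)
qed

text \<open>Compact support bounds the partial derivative uniformly, and the mean value inequality
  passes the bound to all difference quotients, which gives the dominating constant.\<close>

lemma test_fn_lipschitz:
  assumes "test_fn \<Omega> \<phi>"
  obtains M where "0 \<le> M" "\<And>x t. \<bar>\<phi> (x + t *\<^sub>R axis j 1) - \<phi> x\<bar> \<le> M * \<bar>t\<bar>"
proof -
  obtain K where K: "compact K" "\<And>x j. x \<notin> K \<Longrightarrow> pd \<phi> j x = 0"
    using test_fn_support[OF assms] by metis
  have "continuous_on K (pd \<phi> j)"
    using assms by (auto simp: test_fn_def intro: continuous_on_subset)
  then have "bounded (pd \<phi> j ` K)" using K(1) by (simp add: compact_continuous_image compact_imp_bounded)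
  then obtain M where M: "0 < M" "\<And>x. x \<in> K \<Longrightarrow> \<bar>pd \<phi> j x\<bar> \<le> M"
    unfolding bounded_pos by auto
  have bd: "\<bar>pd \<phi> j x\<bar> \<le> M" for x using M K(2)[of x j] by (cases "x \<in> K") auto
  have "\<bar>\<phi> (x + t *\<^sub>R axis j 1) - \<phi> x\<bar> \<le> M * \<bar>t\<bar>" for x t
  proof -
    have "((\<lambda>s. \<phi> (x + s *\<^sub>R axis j 1)) has_real_derivative pd \<phi> j (x + s *\<^sub>R axis j 1)) (at s)" for s
    proof -
      let ?y = "x + s *\<^sub>R axis j 1"
      have d: "(\<phi> has_derivative frechet_derivative \<phi> (at ?y)) (at ?y)"
        using assms frechet_derivative_works unfolding test_fn_def by blast
      interpret D: bounded_linear "frechet_derivative \<phi> (at ?y)" using d by (rule has_derivative_bounded_linear)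
      have "((\<lambda>s. x + s *\<^sub>R axis j 1) has_derivative (\<lambda>t. t *\<^sub>R axis j 1)) (at s)"
        by (auto intro!: derivative_eq_intros)
      from has_derivative_compose[OF this d] show ?thesis
        by (simp add: has_field_derivative_def D.scaleR pd_def mult_commute_abs)
    qed
    then have "norm (\<phi> (x + t *\<^sub>R axis j 1) - \<phi> (x + 0 *\<^sub>R axis j 1)) \<le> M * norm (t - 0)"
      by (intro field_differentiable_bound[where S = UNIV]) (auto simp: bd)
    then show ?thesis by simp
  qed
  with M(1) show ?thesis by (intro that[of M]) auto
qed

lemma lborel_integral_shift:
  fixes f :: "'a::euclidean_space \<Rightarrow> real"
  assumes "f \<in> borel_measurable borel"
  shows "(LINT x|lborel. f (x + c)) = (LINT x|lborel. f x)"
proof -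
  have "(LINT x|lborel. f x) = (LINT x|distr lborel borel ((+) c). f x)"
    by (simp add: lborel_distr_plus)
  also have "\<dots> = (LINT x|lborel. f (c + x))"
    using assms by (intro integral_distr) auto
  finally show ?thesis by (simp add: add.commute)
qed

text \<open>Instead of integrating by parts on every cell, the difference quotient is moved from the
  test function to \<open>p\<close> by translation invariance; \<open>p\<close> is Lipschitz along segments in \<open>\<Omega>\<close>, so that
  dominated convergence applies on both sides.\<close>

lemma piecewise_c1_weak_grad:
  fixes \<Omega> :: "(real ^ 'd::finite) set"
  assumes \<Omega>: "open \<Omega>" "bounded \<Omega>" and T: "finite T" "\<Omega> \<subseteq> \<Union>T"
    and cells: "\<And>K. K \<in> T \<Longrightarrow> convex K \<and> compact K"
    and cont: "continuous_on (closure \<Omega>) p"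
    and piece: "\<And>K. K \<in> T \<Longrightarrow> \<exists>q. c1_field q \<and> (\<forall>x\<in>K. p x = q x)"
  shows "\<exists>g. weak_grad_s \<Omega> p g"
proof -
  have \<Omega>m [simp]: "\<Omega> \<in> sets lebesgue" "\<Omega> \<in> sets borel" using \<Omega> by auto
  have \<Omega>l: "\<Omega> \<in> lmeasurable" using \<Omega> by (simp add: lmeasurable_open)
  have "\<exists>L. L-lipschitz_on K p" if K: "K \<in> T" for K
  proof -
    obtain q where q: "c1_field q" "\<forall>x\<in>K. p x = q x" using piece[OF K] by blast
    obtain L where "L-lipschitz_on K q" using c1_field_lipschitz[OF q(1)] cells[OF K] by blast
    then have "L-lipschitz_on K p" using q(2) by (auto simp: lipschitz_on_def)
    then show ?thesis ..
  qed
  then obtain Lf where Lf: "\<And>K. K \<in> T \<Longrightarrow> (Lf K)-lipschitz_on K p" by metis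
  \<comment> \<open>One constant for all cells: a sum of finitely many nonnegative numbers dominates
    each of them.\<close>
  define L where "L = (\<Sum>K\<in>T. Lf K)"
  have Lf0: "0 \<le> Lf K" if "K \<in> T" for K using Lf[OF that] by (rule lipschitz_on_nonneg)
  have L0: "0 \<le> L" unfolding L_def using Lf0 by (rule sum_nonneg)
  have L: "L-lipschitz_on K p" if "K \<in> T" for K
    using Lf[OF that] subset_refl
    by (rule lipschitz_on_mono) (auto simp: L_def intro!: member_le_sum that Lf0 T)
  \<comment> \<open>Extension by zero gives translates a meaning everywhere. It may jump at the
    boundary, so the Lipschitz bound \<open>seg\<close> asks for a ball inside
    \<open>\<Omega>\<close>.\<close>
  define pt where "pt x = indicator \<Omega> x * p x" for x
  have pt_on: "pt x = p x" if "x \<in> \<Omega>" for x using that by (simp add: pt_def)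
  have pt_meas [measurable]: "pt \<in> borel_measurable borel"
    using borel_measurable_continuous_on_indicator[of \<Omega> p] continuous_on_subset[OF cont closure_subset]
    by (simp add: pt_def[abs_def])
  have "bounded (p ` closure \<Omega>)"
    using \<Omega> cont by (simp add: compact_continuous_image compact_imp_bounded)
  then have "\<exists>B>0. \<forall>x\<in>closure \<Omega>. \<bar>p x\<bar> \<le> B" unfolding bounded_pos by simp
  then obtain B where B: "0 < B" "\<And>x. x \<in> \<Omega> \<Longrightarrow> \<bar>p x\<bar> \<le> B"
    using closure_subset by blast
  have pt_bd: "\<bar>pt x\<bar> \<le> B * indicator \<Omega> x" for x
    using B by (auto simp: pt_def indicator_def)
  have seg: "\<bar>pt (x + t *\<^sub>R e) - pt x\<bar> \<le> L * \<bar>t\<bar>"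
    if "norm e = 1" "cball x \<bar>t\<bar> \<subseteq> \<Omega>" for x e t
  proof -
    have ends: "x \<in> cball x \<bar>t\<bar>" "x + t *\<^sub>R e \<in> cball x \<bar>t\<bar>"
      using that(1) by (auto simp: dist_norm)
    then have "closed_segment x (x + t *\<^sub>R e) \<subseteq> \<Union>T"
      using closed_segment_subset[OF ends convex_cball] that(2) T(2) by blast
    then have "\<bar>p (x + t *\<^sub>R e) - p x\<bar> \<le> L * norm (x + t *\<^sub>R e - x)"
      using T(1) cells L L0 by (intro piecewise_lipschitz_segment) (auto simp: compact_imp_closed)
    then show ?thesis using that ends by (auto simp: pt_on subset_iff)
  qed
  \<comment> \<open>Here \<open>p\<close> agrees near each point with one \<open>C^1\<close>
    function. What is missing from \<open>\<Omega>\<close> lies on the frontiers of finitely many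
    convex cells, a null set.\<close>
  define G where "G = \<Omega> \<inter> (\<Union>K\<in>T. interior K)"
  have G: "open G" "G \<subseteq> \<Omega>" using \<Omega> by (auto simp: G_def)
  have deriv: "(pt has_derivative frechet_derivative p (at x)) (at x)" if x: "x \<in> G" for x
  proof -
    obtain K where K: "K \<in> T" "x \<in> interior K" "x \<in> \<Omega>" using x by (auto simp: G_def)
    obtain q where q: "c1_field q" "\<forall>x\<in>K. p x = q x" using piece[OF K(1)] by blast
    obtain D where D: "(q has_derivative D) (at x)" using q(1) unfolding c1_field_def by blast
    have "(p has_derivative D) (at x)"
      by (rule has_derivative_transform_within_open[OF D, of "interior K"])
         (use K q interior_subset[of K] in auto)
    moreover have "(pt has_derivative D) (at x)"
      by (rule has_derivative_transform_within_open[OF D, of "interior K \<inter> \<Omega>"])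
         (use K q interior_subset[of K] \<Omega> pt_on in auto)
    ultimately show ?thesis by (metis frechet_derivative_at)
  qed
  define g where "g x = (\<chi> j. indicator G x * pd p j x)" for x
  have quot: "(\<lambda>n. (pt (x + k n *\<^sub>R axis j 1) - pt x) / k n) \<longlonglongrightarrow> g x $ j"
    if "x \<in> G" "k \<longlonglongrightarrow> 0" "\<And>n. k n \<noteq> 0" for x k j
    using has_derivative_quotient_tendsto[OF deriv[OF that(1)] that(2,3)] that(1)
    by (simp add: g_def pd_def)
  \<comment> \<open>An arbitrary null sequence: along it \<open>g\<close> is a pointwise limit of
    difference quotients, which shows that it is measurable and bounded by \<open>L\<close>.\<close>
  define k0 where "k0 n = 1 / real (Suc n)" for n
  have k0: "k0 \<longlonglongrightarrow> 0" "k0 n \<noteq> 0" for n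
    unfolding k0_def by (rule LIMSEQ_Suc[OF lim_const_over_n]) simp
  have gj_meas [measurable]: "(\<lambda>x. g x $ j) \<in> borel_measurable borel" for j
  proof (rule borel_measurable_LIMSEQ_real)
    have [measurable]: "G \<in> sets borel" using G by simp
    show "(\<lambda>x. indicator G x * ((pt (x + k0 n *\<^sub>R axis j 1) - pt x) / k0 n)) \<in> borel_measurable borel" for n
      by measurable
    show "(\<lambda>n. indicator G x * ((pt (x + k0 n *\<^sub>R axis j 1) - pt x) / k0 n)) \<longlonglongrightarrow> g x $ j" for x
    proof (cases "x \<in> G")
      case True
      then show ?thesis using quot[OF True k0] by simp
    qed (simp add: g_def)
  qed
  have g_bd: "\<bar>g x $ j\<bar> \<le> L * indicator \<Omega> x" for x j
  proof (cases "x \<in> G")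
    case True
    then have x: "x \<in> \<Omega>" using G by blast
    then obtain \<epsilon> where \<epsilon>: "\<epsilon> > 0" "cball x \<epsilon> \<subseteq> \<Omega>" using \<Omega>(1) open_contains_cball by blast
    have "\<forall>\<^sub>F n in sequentially. \<bar>k0 n\<bar> < \<epsilon>"
      using order_tendstoD(2)[OF tendsto_rabs_zero[OF k0(1)] \<epsilon>(1)] .
    then have "\<forall>\<^sub>F n in sequentially. \<bar>(pt (x + k0 n *\<^sub>R axis j 1) - pt x) / k0 n\<bar> \<le> L"
    proof eventually_elim
      case (elim n)
      have "\<bar>pt (x + k0 n *\<^sub>R axis j 1) - pt x\<bar> \<le> L * \<bar>k0 n\<bar>"
        using elim \<epsilon>(2) by (intro seg) auto
      then show ?case using k0(2)[of n] by (simp add: abs_divide divide_le_eq)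
    qed
    then have "\<bar>g x $ j\<bar> \<le> L"
      by (rule tendsto_upperbound[OF tendsto_rabs[OF quot[OF True k0]]]) simp
    then show ?thesis using x by simp
  qed (use L0 in \<open>simp add: g_def\<close>)
  have L2p: "L2 \<Omega> p"
  proof (rule L2_bounded_mult[OF L2_indicator[OF \<Omega>l \<Omega>m(1)], where C = B])
    show "p \<in> borel_measurable (lebesgue_on \<Omega>)"
      using continuous_on_subset[OF cont closure_subset]
      by (intro continuous_imp_measurable_on_sets_lebesgue) auto
  qed (use B in simp)
  have L2g: "L2 \<Omega> g"
  proof (rule L2_vec_lambda, rule L2_bounded_mult[OF L2_indicator[OF \<Omega>l \<Omega>m(1)], where C = L])
    show "(\<lambda>x. g x $ j) \<in> borel_measurable (lebesgue_on \<Omega>)" for j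
      by (intro measurable_restrict_space1 measurable_completion) simp
    show "norm (g x $ j) \<le> L * norm (indicator \<Omega> x :: real)" if "x \<in> \<Omega>" for x j
      using g_bd[of x j] that by simp
  qed
  have "(LINT x|lebesgue_on \<Omega>. p x * pd \<phi> j x) = - (LINT x|lebesgue_on \<Omega>. g x $ j * \<phi> x)"
    if test: "test_fn \<Omega> \<phi>" for \<phi> j
  proof -
    let ?e = "axis j 1 :: real ^ 'd"
    have e: "norm ?e = 1" by (simp add: norm_axis)
    obtain K where K: "compact K" "K \<subseteq> \<Omega>" "\<And>x. x \<notin> K \<Longrightarrow> \<phi> x = 0"
      by (rule test_fn_support[OF test]) (rule that)
    obtain M where M: "0 \<le> M" "\<And>x t. \<bar>\<phi> (x + t *\<^sub>R ?e) - \<phi> x\<bar> \<le> M * \<bar>t\<bar>"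
      by (rule test_fn_lipschitz[OF test, of j]) (rule that)
    \<comment> \<open>A uniform distance from the support to the complement of
      \<open>\<Omega>\<close>. Steps of length at most \<open>\<delta>\<close> that start in the
      support never reach the jump of \<open>pt\<close>.\<close>
    obtain \<delta> where \<delta>: "\<delta> > 0" "(\<Union>x\<in>K. cball x \<delta>) \<subseteq> \<Omega>"
      by (rule compact_subset_open_imp_cball_epsilon_subset[OF K(1) \<Omega>(1) K(2)]) (rule that)
    define k where "k n = \<delta> / real (Suc n)" for n
    have klim: "k \<longlonglongrightarrow> 0"
      unfolding k_def by (rule LIMSEQ_Suc[OF lim_const_over_n])
    have k: "0 < k n" "k n \<le> \<delta>" for n
      using \<delta>(1) by (auto simp: k_def divide_le_eq)
    have \<phi>c: "continuous_on UNIV \<phi>" using test by (rule test_fn_continuous)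
    then have \<phi>_meas [measurable]: "\<phi> \<in> borel_measurable borel" by (rule borel_measurable_continuous_onI)
    have "continuous_on UNIV (pd \<phi> j)" using test by (simp add: test_fn_def)
    then have pd_meas [measurable]: "pd \<phi> j \<in> borel_measurable borel" by (rule borel_measurable_continuous_onI)
    have "bounded (\<phi> ` K)"
      using \<phi>c K(1) by (meson compact_continuous_image compact_imp_bounded continuous_on_subset subset_UNIV)
    then have "\<exists>C>0. \<forall>x\<in>K. \<bar>\<phi> x\<bar> \<le> C" unfolding bounded_pos by simp
    then obtain C where C: "0 < C" "\<And>x. x \<in> K \<Longrightarrow> \<bar>\<phi> x\<bar> \<le> C" by blast
    have \<phi>_bd: "\<bar>\<phi> x\<bar> \<le> C * indicator K x" for x using C K(3) by (cases "x \<in> K") auto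
    have C': "\<bar>\<phi> x\<bar> \<le> C" for x using C K(3)[of x] by (cases "x \<in> K") auto
    have K_borel: "K \<in> sets borel" "bounded K" using K(1) by (auto simp: borel_compact compact_imp_bounded)
    define I where "I n = (LINT x|lborel. pt x * ((\<phi> (x + k n *\<^sub>R ?e) - \<phi> x) / k n))" for n
    have "I \<longlonglongrightarrow> (LINT x|lborel. pt x * pd \<phi> j x)"
      unfolding I_def
    proof (rule integral_dominated_convergence)
      show "integrable lborel (\<lambda>x. B * M * indicator \<Omega> x)"
        using B M \<Omega> by (intro integrable_lborel_bounded_support[where C = "B * M" and S = \<Omega>]) auto
      show "AE x in lborel. (\<lambda>n. pt x * ((\<phi> (x + k n *\<^sub>R ?e) - \<phi> x) / k n)) \<longlonglongrightarrow> pt x * pd \<phi> j x"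
      proof (intro AE_I2 tendsto_mult tendsto_const)
        fix x
        have "(\<phi> has_derivative frechet_derivative \<phi> (at x)) (at x)"
          using test frechet_derivative_works unfolding test_fn_def by blast
        from has_derivative_quotient_tendsto[OF this klim, of ?e] k(1)
        show "(\<lambda>n. (\<phi> (x + k n *\<^sub>R ?e) - \<phi> x) / k n) \<longlonglongrightarrow> pd \<phi> j x"
          by (simp add: pd_def less_imp_neq[THEN not_sym])
      qed
      have "\<bar>pt x\<bar> * \<bar>(\<phi> (x + k n *\<^sub>R ?e) - \<phi> x) / k n\<bar> \<le> (B * indicator \<Omega> x) * M" for n x
        using M(2)[of x "k n"] k(1)[of n] B(1)
        by (intro mult_mono pt_bd) (auto simp: abs_divide divide_le_eq)
      then show "AE x in lborel. norm (pt x * ((\<phi> (x + k n *\<^sub>R ?e) - \<phi> x) / k n)) \<le> B * M * indicator \<Omega> x" for n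
        by (intro AE_I2) (simp add: abs_mult mult_ac)
    qed measurable
    moreover have "I \<longlonglongrightarrow> (LINT x|lborel. - (g x $ j * \<phi> x))"
    proof -
      \<comment> \<open>Discrete integration by parts: translation by \<open>k n\<close> turns
        \<open>pt x * \<phi> (x + k n *\<^sub>R e)\<close> into
        \<open>pt (x - k n *\<^sub>R e) * \<phi> x\<close>, and the quotient now falls on
        \<open>pt\<close>, with step \<open>- k n\<close>.\<close>
      have "I n = (LINT x|lborel. - ((pt (x + (- k n) *\<^sub>R ?e) - pt x) / (- k n)) * \<phi> x)" for n
      proof -
        have i1: "integrable lborel (\<lambda>x. pt x * \<phi> (x + k n *\<^sub>R ?e))"
        proof (rule integrable_lborel_bounded_support[where C = "B * C" and S = \<Omega>])
          have "\<bar>pt x\<bar> * \<bar>\<phi> (x + k n *\<^sub>R ?e)\<bar> \<le> (B * indicator \<Omega> x) * C" for x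
            using B(1) by (intro mult_mono pt_bd C') auto
          then show "\<bar>pt x * \<phi> (x + k n *\<^sub>R ?e)\<bar> \<le> B * C * indicator \<Omega> x" for x
            by (simp add: abs_mult mult_ac)
        qed (use \<Omega> in auto)
        have i2: "integrable lborel (\<lambda>x. pt x * \<phi> x)"
        proof (rule integrable_lborel_bounded_support[where C = "B * C" and S = \<Omega>])
          have "\<bar>pt x\<bar> * \<bar>\<phi> x\<bar> \<le> (B * indicator \<Omega> x) * C" for x
            using B(1) by (intro mult_mono pt_bd C') auto
          then show "\<bar>pt x * \<phi> x\<bar> \<le> B * C * indicator \<Omega> x" for x
            by (simp add: abs_mult mult_ac)
        qed (use \<Omega> in auto)
        have i3: "integrable lborel (\<lambda>x. pt (x + (- k n) *\<^sub>R ?e) * \<phi> x)"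
        proof (rule integrable_lborel_bounded_support[where C = "B * C" and S = K])
          have "\<bar>pt y\<bar> \<le> B" for y using pt_bd[of y] B(1) by (cases "y \<in> \<Omega>") auto
          then have "\<bar>pt (x + (- k n) *\<^sub>R ?e)\<bar> * \<bar>\<phi> x\<bar> \<le> B * (C * indicator K x)" for x
            using B(1) by (intro mult_mono \<phi>_bd) auto
          then show "\<bar>pt (x + (- k n) *\<^sub>R ?e) * \<phi> x\<bar> \<le> B * C * indicator K x" for x
            by (simp add: abs_mult mult_ac)
        qed (use K_borel in auto)
        have shift: "(LINT x|lborel. pt (x + (- k n) *\<^sub>R ?e) * \<phi> x) = (LINT x|lborel. pt x * \<phi> (x + k n *\<^sub>R ?e))"
          using lborel_integral_shift[of "\<lambda>x. pt (x + (- k n) *\<^sub>R ?e) * \<phi> x" "k n *\<^sub>R ?e"] by simp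
        have "I n = ((LINT x|lborel. pt x * \<phi> (x + k n *\<^sub>R ?e)) - (LINT x|lborel. pt x * \<phi> x)) / k n"
        proof -
          have "pt x * ((\<phi> (x + k n *\<^sub>R ?e) - \<phi> x) / k n)
              = (pt x * \<phi> (x + k n *\<^sub>R ?e) - pt x * \<phi> x) / k n" for x
            by (simp add: right_diff_distrib)
          then show ?thesis
            unfolding I_def using i1 i2
            by (simp only: integral_divide_zero Bochner_Integration.integral_diff)
        qed
        also have "\<dots> = (LINT x|lborel. - ((pt (x + (- k n) *\<^sub>R ?e) - pt x) / (- k n)) * \<phi> x)"
        proof -
          have "- ((pt (x + (- k n) *\<^sub>R ?e) - pt x) / (- k n)) * \<phi> x
              = (pt (x + (- k n) *\<^sub>R ?e) * \<phi> x - pt x * \<phi> x) / k n" for x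
            by (simp add: left_diff_distrib)
          then show ?thesis unfolding shift[symmetric] using i2 i3 by (simp only: integral_divide_zero Bochner_Integration.integral_diff)
        qed
        finally show ?thesis .
      qed
      then have "I = (\<lambda>n. LINT x|lborel. - ((pt (x + (- k n) *\<^sub>R ?e) - pt x) / (- k n)) * \<phi> x)" by blast
      moreover have "(\<lambda>n. LINT x|lborel. - ((pt (x + (- k n) *\<^sub>R ?e) - pt x) / (- k n)) * \<phi> x)
          \<longlonglongrightarrow> (LINT x|lborel. - (g x $ j * \<phi> x))"
      proof (rule integral_dominated_convergence)
        show "integrable lborel (\<lambda>x. L * C * indicator K x)"
          using L0 C K_borel by (intro integrable_lborel_bounded_support[where C = "L * C" and S = K]) auto
        have "negligible (\<Union>K\<in>T. frontier K)"
          using T(1) cells by (intro negligible_Union) (auto intro!: negligible_convex_frontier)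
        then have "AE x in lebesgue. x \<notin> (\<Union>K\<in>T. frontier K)"
          by (intro AE_not_in) (simp add: negligible_iff_null_sets)
        then have "AE x in lborel. x \<notin> (\<Union>K\<in>T. frontier K)" by (simp add: AE_completion_iff)
        then show "AE x in lborel. (\<lambda>n. - ((pt (x + (- k n) *\<^sub>R ?e) - pt x) / (- k n)) * \<phi> x)
            \<longlonglongrightarrow> - (g x $ j * \<phi> x)"
        proof eventually_elim
          case (elim x)
          show ?case
          proof (cases "x \<in> \<Omega>")
            case True
            then obtain K' where K': "K' \<in> T" "x \<in> K'" using T(2) by blast
            then have "x \<in> interior K'"
              using elim closure_subset[of K'] by (auto simp: frontier_def)
            then have "x \<in> G" using K' True by (auto simp: G_def)
            moreover have "(\<lambda>n. - k n) \<longlonglongrightarrow> 0" using tendsto_minus[OF klim] by simp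
            moreover have "- k n \<noteq> 0" for n using k(1)[of n] by simp
            ultimately have "(\<lambda>n. (pt (x + (- k n) *\<^sub>R ?e) - pt x) / (- k n)) \<longlonglongrightarrow> g x $ j"
              by (rule quot)
            from tendsto_mult[OF tendsto_minus[OF this] tendsto_const] show ?thesis by simp
          next
            case False
            then have "\<phi> x = 0" using K by blast
            then show ?thesis by simp
          qed
        qed
        \<comment> \<open>Off \<open>K\<close> the test function is 0. On \<open>K\<close> the
          shifted point stays within \<open>\<delta>\<close>, hence in \<open>\<Omega>\<close>,
          where \<open>seg\<close> bounds the quotient.\<close>
        have "\<bar>(pt (x + (- k n) *\<^sub>R ?e) - pt x) / (- k n)\<bar> * \<bar>\<phi> x\<bar> \<le> L * C * indicator K x" for n x
        proof (cases "x \<in> K")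
          case True
          have "cball x \<bar>- k n\<bar> \<subseteq> cball x \<delta>" using k[of n] by (intro subset_cball) simp
          then have "\<bar>pt (x + (- k n) *\<^sub>R ?e) - pt x\<bar> \<le> L * \<bar>- k n\<bar>"
            using \<delta>(2) True by (intro seg e) blast
          then have "\<bar>(pt (x + (- k n) *\<^sub>R ?e) - pt x) / (- k n)\<bar> \<le> L"
            using k(1)[of n] by (simp add: abs_divide divide_le_eq)
          from mult_mono[OF this C'[of x] L0] True show ?thesis
            by (simp only: indicator_simps mult_1_right abs_ge_zero)
        qed (simp add: K(3))
        then show "AE x in lborel. norm (- ((pt (x + (- k n) *\<^sub>R ?e) - pt x) / (- k n)) * \<phi> x) \<le> L * C * indicator K x" for n
          by (intro AE_I2) (simp add: abs_mult)
      qed measurable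
      ultimately show ?thesis by simp
    qed
    ultimately have eq: "(LINT x|lborel. pt x * pd \<phi> j x) = (LINT x|lborel. - (g x $ j * \<phi> x))"
      by (rule LIMSEQ_unique)
    have "(LINT x|lebesgue_on \<Omega>. p x * pd \<phi> j x) = (LINT x|lebesgue. pt x * pd \<phi> j x)"
      by (subst integral_restrict_space) (simp_all add: pt_def mult.assoc)
    also have "\<dots> = (LINT x|lborel. pt x * pd \<phi> j x)"
      by (rule integral_completion) simp
    also have "\<dots> = - (LINT x|lborel. g x $ j * \<phi> x)" using eq by simp
    also have "(LINT x|lborel. g x $ j * \<phi> x) = (LINT x|lebesgue. g x $ j * \<phi> x)"
      by (rule integral_completion[symmetric]) simp
    also have "\<dots> = (LINT x|lebesgue_on \<Omega>. g x $ j * \<phi> x)"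
    proof (subst integral_restrict_space)
      have "(\<lambda>x. g x $ j * \<phi> x) = (\<lambda>x. indicator \<Omega> x *\<^sub>R (g x $ j * \<phi> x))"
        using G(2) by (auto simp: g_def indicator_def fun_eq_iff)
      then show "(LINT x|lebesgue. g x $ j * \<phi> x) = (LINT x|lebesgue. indicator \<Omega> x *\<^sub>R (g x $ j * \<phi> x))"
        by (simp only:)
    qed simp
    finally show ?thesis .
  qed
  then have "weak_grad_s \<Omega> p g"
    using L2p L2g by (simp add: weak_grad_s_def)
  then show ?thesis by blast
qed

section \<open>Projection, test spaces and functionals\<close>

lemma triangulation_cell:
  assumes "triangulation \<Omega> simp T" "K \<in> T"
  shows "convex K" "compact K" "K \<subseteq> closure \<Omega>" "K \<in> sets lebesgue"
proof -
  have "convex K \<and> compact K"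
  proof (cases simp)
    case True
    then have "polytope K" using assms simplex_imp_polytope unfolding triangulation_def by metis
    then show ?thesis by (simp add: polytope_imp_compact polytope_imp_convex)
  next
    case False
    then obtain A :: "real ^ 'a ^ 'a" and b where K: "K = (\<lambda>x. A *v x + b) ` cbox 0 One"
      using assms unfolding triangulation_def by metis
    have "K = (+) b ` ((*v) A ` cbox 0 One)" unfolding K image_image by (simp add: add.commute)
    moreover have "convex ((*v) A ` cbox 0 One)" by (intro convex_linear_image) auto
    ultimately have "convex K" by (simp only: convex_translation)
    moreover have "compact K"
      unfolding K
      by (intro compact_continuous_image compact_cbox continuous_on_add continuous_on_const
          matrix_vector_mult_linear_continuous_on)
    ultimately show ?thesis ..
  qed
  then show "convex K" "compact K" by auto
  then show "K \<in> sets lebesgue" by (intro fmeasurableD lmeasurable_compact)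
  have "\<Union>T = closure \<Omega>" using assms(1) by (simp add: triangulation_def)
  then show "K \<subseteq> closure \<Omega>" using assms(2) by blast
qed

lemma Yh_weak_grad:
  fixes \<Omega> :: "(real ^ 'd::finite) set"
  assumes "open \<Omega>" "bounded \<Omega>" and T: "triangulation \<Omega> simp T" and v: "v \<in> Yh \<Omega> simp T l"
  shows "\<exists>g. weak_grad_s \<Omega> v g"
proof (rule piecewise_c1_weak_grad[OF assms(1,2)])
  show "finite T" "\<Omega> \<subseteq> \<Union>T" using T closure_subset[of \<Omega>] by (auto simp: triangulation_def)
  show "convex K \<and> compact K" if "K \<in> T" for K using triangulation_cell[OF T that] by simp
  show "continuous_on (closure \<Omega>) v" using v by (simp add: Yh_def)
  fix K assume "K \<in> T"
  then have "poly_on K simp l v" using v by (simp add: Yh_def)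
  then show "\<exists>q. c1_field q \<and> (\<forall>x\<in>K. v x = q x)" by (rule poly_on_c1) blast
qed

text \<open>Cells reach up to the boundary of \<open>\<Omega>\<close>, whereas weak gradients are
  determined inside only; a null frontier bridges the gap.\<close>

lemma AE_lebesgue_on_closure:
  fixes \<Omega> :: "'a::euclidean_space set"
  assumes "AE x in lebesgue_on \<Omega>. P x" "open \<Omega>" "negligible (frontier \<Omega>)"
    and "S \<subseteq> closure \<Omega>" "S \<in> sets lebesgue"
  shows "AE x in lebesgue_on S. P x"
proof -
  have "AE x in lebesgue. x \<in> \<Omega> \<longrightarrow> P x"
    using assms(1,2) by (simp add: AE_restrict_space_iff)
  moreover have "AE x in lebesgue. x \<notin> frontier \<Omega>"
    using assms(3) by (intro AE_not_in) (simp add: negligible_iff_null_sets)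
  ultimately have "AE x in lebesgue. x \<in> S \<longrightarrow> P x"
  proof eventually_elim
    case (elim x)
    then show ?case using assms(2,4) by (auto simp: frontier_def interior_open)
  qed
  then show ?thesis using assms(5) by (simp add: AE_restrict_space_iff)
qed

lemma L2_closure:
  fixes \<Omega> :: "(real ^ 'd::finite) set" and v :: "real ^ 'd \<Rightarrow> 'b::euclidean_space"
  assumes v: "L2 \<Omega> v" and \<Omega>: "open \<Omega>" "negligible (frontier \<Omega>)"
    and S: "S \<subseteq> closure \<Omega>" "S \<in> sets lebesgue"
  shows "L2 S v"
proof -
  have L: "L2 S (\<lambda>x. indicator \<Omega> x *\<^sub>R v x)"
    unfolding L2_def
  proof
    have "(\<lambda>x. indicator \<Omega> x *\<^sub>R v x) \<in> borel_measurable lebesgue"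
      using L2_measurable[OF v] \<Omega>(1) by (simp add: borel_measurable_restrict_space_iff)
    then show "(\<lambda>x. indicator \<Omega> x *\<^sub>R v x) \<in> borel_measurable (lebesgue_on S)"
      by (rule measurable_restrict_space1)
    have "(\<lambda>x. (norm (indicator \<Omega> x *\<^sub>R v x))\<^sup>2) = (\<lambda>x. indicator \<Omega> x *\<^sub>R (norm (v x))\<^sup>2)"
      by (auto simp: indicator_def)
    moreover have "integrable lebesgue (\<lambda>x. indicator \<Omega> x *\<^sub>R (norm (v x))\<^sup>2)"
      using v \<Omega>(1) by (simp add: L2_def integrable_restrict_space del: real_scaleR_def)
    ultimately have "integrable lebesgue (\<lambda>x. (norm (indicator \<Omega> x *\<^sub>R v x))\<^sup>2)" by (simp only:)
    from integrable_mult_indicator[OF S(2) this] S(2)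
    show "integrable (lebesgue_on S) (\<lambda>x. (norm (indicator \<Omega> x *\<^sub>R v x))\<^sup>2)"
      by (simp add: integrable_restrict_space)
  qed
  have "AE x in lebesgue_on \<Omega>. indicator \<Omega> x *\<^sub>R v x = v x"
    by (intro AE_I2) simp
  then have "AE x in lebesgue_on S. indicator \<Omega> x *\<^sub>R v x = v x"
    using \<Omega> S by (rule AE_lebesgue_on_closure)
  then show ?thesis using S(2) L by (rule L2_cong_AE)
qed

lemma L2_continuous_on_compact:
  fixes f :: "real ^ 'd::finite \<Rightarrow> 'b::euclidean_space"
  assumes "compact K" "continuous_on K f"
  shows "L2 K f"
proof -
  have "bounded (f ` K)" using assms by (simp add: compact_continuous_image compact_imp_bounded)
  then obtain B where "\<forall>y\<in>f ` K. norm y \<le> B" unfolding bounded_iff by blast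
  moreover have "K \<in> sets lebesgue" using assms(1) by (intro fmeasurableD lmeasurable_compact)
  moreover from this have "f \<in> borel_measurable (lebesgue_on K)"
    using assms(2) by (intro continuous_imp_measurable_on_sets_lebesgue)
  moreover have "K \<in> lmeasurable" using assms(1) by (rule lmeasurable_compact)
  ultimately show ?thesis
    by (intro L2_bounded_mult[OF L2_indicator[of K K], where C = B]) auto
qed

lemma Yhv_continuous:
  assumes "v \<in> Yhv \<Omega> simp T l" shows "continuous_on (closure \<Omega>) v"
proof -
  have "continuous_on (closure \<Omega>) (\<lambda>x. \<chi> i. v x $ i)"
    using assms by (intro continuous_on_vec_lambda) (simp add: Yhv_def Yh_def)
  then show ?thesis by simp
qed

lemma Proj_sum:
  assumes "loc_stable_proj \<Omega> simp T l Proj" "\<And>i. i \<in> I \<Longrightarrow> L2 \<Omega> (g i)"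
  shows "Proj (\<lambda>x. \<Sum>i\<in>I. a i *\<^sub>R g i x) = (\<lambda>x. \<Sum>i\<in>I. a i *\<^sub>R Proj (g i) x)"
proof -
  have lin: "Proj (\<lambda>x. \<alpha> *\<^sub>R u x + \<beta> *\<^sub>R v x) = (\<lambda>x. \<alpha> *\<^sub>R Proj u x + \<beta> *\<^sub>R Proj v x)"
    if "L2 \<Omega> u" "L2 \<Omega> v" for u v \<alpha> \<beta>
    using assms(1) that unfolding loc_stable_proj_def by blast
  have zero: "Proj (\<lambda>x. 0) = (\<lambda>x. 0)"
    using lin[OF L2_zero L2_zero, of 0 0] by simp
  show ?thesis using assms(2)
  proof (induction I rule: infinite_finite_induct)
    case (insert i I)
    then show ?case
      using lin[of "g i" "\<lambda>x. \<Sum>i\<in>I. a i *\<^sub>R g i x" "a i" 1] L2_sum[of I \<Omega> g a] by simp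
  qed (simp_all add: zero)
qed

text \<open>\<open>Proj\<close> acts on functions, not on their classes modulo null sets. Local
  stability applied to \<open>u - v\<close>, which has zero norm on the patch, shows that it
  respects equality almost everywhere.\<close>

lemma Proj_cong_AE:
  fixes \<Omega> :: "(real ^ 'd::finite) set"
  assumes P: "loc_stable_proj \<Omega> simp T l Proj" and T: "triangulation \<Omega> simp T" and K: "K \<in> T"
    and \<Omega>: "open \<Omega>" "negligible (frontier \<Omega>)" and uv: "L2 \<Omega> u" "L2 \<Omega> v"
    and eq: "AE x in lebesgue_on \<Omega>. u x = v x"
  shows "AE x in lebesgue_on K. Proj u x = Proj v x"
proof -
  \<comment> \<open>Written as a combination with factors 1 and -1 to match the linearity clause of
    \<open>loc_stable_proj\<close>.\<close>
  define w where "w x = 1 *\<^sub>R u x + (- 1) *\<^sub>R v x" for x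
  have w: "L2 \<Omega> w" using L2_diff[OF uv] by (simp add: w_def[abs_def])
  have "Proj w = (\<lambda>x. 1 *\<^sub>R Proj u x + (- 1) *\<^sub>R Proj v x)"
    using P uv unfolding loc_stable_proj_def w_def[abs_def] by blast
  then have Pw: "Proj w x = Proj u x - Proj v x" for x by simp
  have "Proj w \<in> Yhv \<Omega> simp T (l - 1)" using P w unfolding loc_stable_proj_def by blast
  then have L2K: "L2 K (Proj w)"
    using triangulation_cell[OF T K] Yhv_continuous continuous_on_subset
    by (intro L2_continuous_on_compact) blast+
  have "patch T K \<subseteq> closure \<Omega>"
    using triangulation_cell(3)[OF T] by (auto simp: patch_def)
  moreover have "patch T K \<in> sets lebesgue"
    unfolding patch_def using T triangulation_cell(4)[OF T]
    by (intro sets.finite_Union) (auto simp: triangulation_def)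
  moreover have "AE x in lebesgue_on \<Omega>. w x = 0"
    using eq by eventually_elim (simp add: w_def)
  ultimately have "AE x in lebesgue_on (patch T K). w x = 0"
    using AE_lebesgue_on_closure \<Omega> by blast
  then have "L2sq (patch T K) w = 0"
    unfolding L2sq_def by (intro integral_eq_zero_AE) (auto elim: AE_mp)
  moreover obtain C where "\<forall>K\<in>T. \<forall>v. L2 \<Omega> v \<longrightarrow> L2sq K (Proj v) \<le> C * L2sq (patch T K) v"
    using P unfolding loc_stable_proj_def by blast
  then have "L2sq K (Proj w) \<le> C * L2sq (patch T K) w" using K w by blast
  ultimately have "L2sq K (Proj w) = 0" using L2sq_nonneg[of K "Proj w"] by simp
  then have "AE x in lebesgue_on K. (norm (Proj w x))\<^sup>2 = 0"
    using L2K unfolding L2sq_def L2_def by (subst (asm) integral_nonneg_eq_0_iff_AE) auto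
  then show ?thesis by eventually_elim (simp add: Pw)
qed

lemma Pistar_L2:
  fixes \<Omega> :: "(real ^ 'd::finite) set"
  assumes P: "loc_stable_proj \<Omega> simp T l Proj" and T: "triangulation \<Omega> simp T" and K: "K \<in> T"
    and \<Omega>: "open \<Omega>" "negligible (frontier \<Omega>)" and g: "L2 \<Omega> g"
  shows "L2 K (Pistar Proj g)"
  unfolding Pistar_def
proof (rule L2_diff)
  show "L2 K g" using g \<Omega> triangulation_cell(3,4)[OF T K] by (rule L2_closure)
  have "Proj g \<in> Yhv \<Omega> simp T (l - 1)" using P g unfolding loc_stable_proj_def by blast
  then show "L2 K (Proj g)"
    using triangulation_cell[OF T K] Yhv_continuous continuous_on_subset
    by (intro L2_continuous_on_compact) blast+
qed

text \<open>Two sources of error are separated: the chosen gradient of the sum differs from the sum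
  of gradients on a null set, which \<open>Proj_cong_AE\<close> absorbs, and on that sum
  \<open>Proj\<close> is exactly linear.\<close>

lemma Pistar_grad_sum_AE:
  fixes \<Omega> :: "(real ^ 'd::finite) set"
  assumes P: "loc_stable_proj \<Omega> simp T l Proj" and T: "triangulation \<Omega> simp T" and K: "K \<in> T"
    and \<Omega>: "open \<Omega>" "negligible (frontier \<Omega>)" and p: "\<And>i. i \<in> I \<Longrightarrow> \<exists>g. weak_grad_s \<Omega> (p i) g"
  shows "AE x in lebesgue_on K. Pistar Proj (grad_s \<Omega> (\<lambda>x. \<Sum>i\<in>I. a i *\<^sub>R p i x)) x
      = (\<Sum>i\<in>I. a i *\<^sub>R Pistar Proj (grad_s \<Omega> (p i)) x)"
proof -
  let ?g = "grad_s \<Omega> (\<lambda>x. \<Sum>i\<in>I. a i *\<^sub>R p i x)" and ?h = "\<lambda>x. \<Sum>i\<in>I. a i *\<^sub>R grad_s \<Omega> (p i) x"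
  have w: "weak_grad_s \<Omega> (p i) (grad_s \<Omega> (p i))" if "i \<in> I" for i
    using p[OF that] grad_s_weak by blast
  have eq: "AE x in lebesgue_on \<Omega>. ?g x = ?h x"
    by (rule grad_s_sum_AE[OF \<Omega>(1) w])
  have "weak_grad_s \<Omega> (\<lambda>x. \<Sum>i\<in>I. a i *\<^sub>R p i x) ?g"
    by (rule grad_s_weak[OF weak_grad_s_sum[OF \<Omega>(1) w]])
  then have Lg: "L2 \<Omega> ?g" by (simp add: weak_grad_s_L2)
  have Lh: "L2 \<Omega> ?h" using w weak_grad_s_L2 by (intro L2_sum) blast
  have "AE x in lebesgue_on K. Proj ?g x = Proj ?h x"
    by (rule Proj_cong_AE[OF P T K \<Omega> Lg Lh eq])
  moreover have "AE x in lebesgue_on K. ?g x = ?h x"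
    using eq \<Omega> triangulation_cell(3,4)[OF T K] by (rule AE_lebesgue_on_closure)
  moreover have "Proj ?h = (\<lambda>x. \<Sum>i\<in>I. a i *\<^sub>R Proj (grad_s \<Omega> (p i)) x)"
    using w weak_grad_s_L2 by (intro Proj_sum[OF P]) blast
  ultimately show ?thesis
    by (elim AE_mp) (simp add: Pistar_def scaleR_diff_right sum_subtractf)
qed

lemma tau_ip_sum:
  fixes \<Omega> :: "(real ^ 'd::finite) set"
  assumes P: "loc_stable_proj \<Omega> simp T l Proj" and T: "triangulation \<Omega> simp T"
    and \<Omega>: "open \<Omega>" "negligible (frontier \<Omega>)" and p: "\<And>i. i \<in> I \<Longrightarrow> \<exists>g. weak_grad_s \<Omega> (p i) g"
  shows "tau_ip T \<tau> (Pistar Proj (grad_s \<Omega> (\<lambda>x. \<Sum>i\<in>I. a i *\<^sub>R p i x)))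
      (Pistar Proj (grad_s \<Omega> (\<lambda>x. \<Sum>j\<in>I. b j *\<^sub>R p j x)))
    = (\<Sum>j\<in>I. b j * (\<Sum>i\<in>I. a i * tau_ip T \<tau> (Pistar Proj (grad_s \<Omega> (p i))) (Pistar Proj (grad_s \<Omega> (p j)))))"
proof -
  let ?P = "\<lambda>p. Pistar Proj (grad_s \<Omega> p)"
  have w: "weak_grad_s \<Omega> (p i) (grad_s \<Omega> (p i))" if "i \<in> I" for i
    using p[OF that] grad_s_weak by blast
  have L: "L2 K (?P (p i))" if "K \<in> T" "i \<in> I" for K i
    by (rule Pistar_L2[OF P T that(1) \<Omega> weak_grad_s_L2[OF w[OF that(2)], THEN conjunct2]])
  have Ls: "L2 K (?P (\<lambda>x. \<Sum>i\<in>I. a i *\<^sub>R p i x))" if "K \<in> T" for K a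
    by (rule Pistar_L2[OF P T that \<Omega>
          weak_grad_s_L2[OF grad_s_weak[OF weak_grad_s_sum[OF \<Omega>(1) w]], THEN conjunct2]])
  have "L2ip K (?P (\<lambda>x. \<Sum>i\<in>I. a i *\<^sub>R p i x)) (?P (\<lambda>x. \<Sum>j\<in>I. b j *\<^sub>R p j x))
      = (\<Sum>j\<in>I. b j * (\<Sum>i\<in>I. a i * L2ip K (?P (p i)) (?P (p j))))" if K: "K \<in> T" for K
  proof -
    have "L2ip K (?P (\<lambda>x. \<Sum>i\<in>I. a i *\<^sub>R p i x)) (?P (\<lambda>x. \<Sum>j\<in>I. b j *\<^sub>R p j x))
        = L2ip K (\<lambda>x. \<Sum>i\<in>I. a i *\<^sub>R ?P (p i) x) (\<lambda>x. \<Sum>j\<in>I. b j *\<^sub>R ?P (p j) x)"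
      by (intro L2ip_cong_AE Pistar_grad_sum_AE[OF P T K \<Omega> p] Ls[OF K] L2_sum L[OF K])
    also have "\<dots> = (\<Sum>j\<in>I. b j * (\<Sum>i\<in>I. a i * L2ip K (?P (p i)) (?P (p j))))"
      by (intro L2ip_sum_sum L[OF K])
    finally show ?thesis .
  qed
  then have "tau_ip T \<tau> (?P (\<lambda>x. \<Sum>i\<in>I. a i *\<^sub>R p i x)) (?P (\<lambda>x. \<Sum>j\<in>I. b j *\<^sub>R p j x))
      = (\<Sum>K\<in>T. \<Sum>j\<in>I. \<Sum>i\<in>I. b j * (a i * (\<tau> K * L2ip K (?P (p i)) (?P (p j)))))"
    by (simp add: tau_ip_def sum_distrib_left mult_ac)
  also have "\<dots> = (\<Sum>j\<in>I. \<Sum>i\<in>I. \<Sum>K\<in>T. b j * (a i * (\<tau> K * L2ip K (?P (p i)) (?P (p j)))))"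
    by (subst sum.swap, intro sum.cong refl, rule sum.swap)
  finally show ?thesis by (simp add: tau_ip_def sum_distrib_left)
qed

section \<open>The space \<open>H10\<close> and its dual\<close>

lemma test_fn_lincomb:
  assumes "test_fn \<Omega> f" "test_fn \<Omega> g"
  shows "test_fn \<Omega> (\<lambda>x. a * f x + b * g x)"
    and "pd (\<lambda>x. a * f x + b * g x) j x = a * pd f j x + b * pd g j x"
proof -
  have d: "f differentiable at x" "g differentiable at x" for x
    using assms by (auto simp: test_fn_def)
  have pd: "pd (\<lambda>x. a * f x + b * g x) j x = a * pd f j x + b * pd g j x" for j x
  proof -
    have "((\<lambda>x. a * f x + b * g x) has_derivative
        (\<lambda>h. a * frechet_derivative f (at x) h + b * frechet_derivative g (at x) h)) (at x)"
      using d[of x, THEN frechet_derivative_works[THEN iffD1]]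
      by (intro has_derivative_add has_derivative_mult_right)
    from frechet_derivative_at[OF this] show ?thesis by (simp add: pd_def fun_eq_iff)
  qed
  then show "pd (\<lambda>x. a * f x + b * g x) j x = a * pd f j x + b * pd g j x" .
  obtain K where K: "compact K" "K \<subseteq> \<Omega>" "\<And>x. x \<notin> K \<Longrightarrow> f x = 0"
    using assms(1) by (auto simp: test_fn_def)
  obtain K' where K': "compact K'" "K' \<subseteq> \<Omega>" "\<And>x. x \<notin> K' \<Longrightarrow> g x = 0"
    using assms(2) by (auto simp: test_fn_def)
  have "pd (\<lambda>x. a * f x + b * g x) j = (\<lambda>x. a * pd f j x + b * pd g j x)" for j
    using pd by blast
  then have "continuous_on UNIV (pd (\<lambda>x. a * f x + b * g x) j)" for j
    using assms by (auto simp: test_fn_def intro!: continuous_intros)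
  then show "test_fn \<Omega> (\<lambda>x. a * f x + b * g x)"
    unfolding test_fn_def using d K K'
    by (intro conjI allI exI[of _ "K \<union> K'"]) (auto intro!: derivative_intros compact_Un)
qed

lemma H10_lincomb:
  fixes \<Omega> :: "(real ^ 'd::finite) set"
  assumes \<Omega>: "open \<Omega>" and "H10 \<Omega> u" "H10 \<Omega> v"
  shows "H10 \<Omega> (\<lambda>x. a *\<^sub>R u x + b *\<^sub>R v x)"
proof -
  obtain G \<phi> where u: "weak_grad_v \<Omega> u G" "\<And>k i. test_fn \<Omega> (\<lambda>x. \<phi> k x $ i)"
    "(\<lambda>k. L2sq \<Omega> (\<lambda>x. \<phi> k x - u x)) \<longlonglongrightarrow> 0" "(\<lambda>k. L2sq \<Omega> (\<lambda>x. jac (\<phi> k) x - G x)) \<longlonglongrightarrow> 0"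
    using assms(2) unfolding H10_def by blast
  obtain H \<psi> where v: "weak_grad_v \<Omega> v H" "\<And>k i. test_fn \<Omega> (\<lambda>x. \<psi> k x $ i)"
    "(\<lambda>k. L2sq \<Omega> (\<lambda>x. \<psi> k x - v x)) \<longlonglongrightarrow> 0" "(\<lambda>k. L2sq \<Omega> (\<lambda>x. jac (\<psi> k) x - H x)) \<longlonglongrightarrow> 0"
    using assms(3) unfolding H10_def by blast
  have L2_field: "L2 \<Omega> f" "L2 \<Omega> F" if "weak_grad_v \<Omega> f F" for f F
    using that weak_grad_s_L2 unfolding weak_grad_v_def by (blast intro: L2_vec_lambda)+
  have L2_test: "L2 \<Omega> f" "L2 \<Omega> (jac f)" if "\<And>i. test_fn \<Omega> (\<lambda>x. f x $ i)" for f :: "real ^ 'd \<Rightarrow> real ^ 'd"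
    using \<Omega> by (auto intro!: L2_vec_lambda test_fn_L2[OF that] test_fn_pd_L2[OF that] simp: jac_def)
  have comb: "(\<lambda>k. L2sq \<Omega> (\<lambda>x. (a *\<^sub>R f k x + b *\<^sub>R g k x) - (a *\<^sub>R F x + b *\<^sub>R G x))) \<longlonglongrightarrow> 0"
    if "\<And>k. L2 \<Omega> (f k)" "\<And>k. L2 \<Omega> (g k)" "L2 \<Omega> F" "L2 \<Omega> G"
      "(\<lambda>k. L2sq \<Omega> (\<lambda>x. f k x - F x)) \<longlonglongrightarrow> 0" "(\<lambda>k. L2sq \<Omega> (\<lambda>x. g k x - G x)) \<longlonglongrightarrow> 0"
    for f g :: "nat \<Rightarrow> real ^ 'd \<Rightarrow> 'c::euclidean_space" and F G
  proof (rule Lim_null_comparison)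
    show "(\<lambda>k. 2 * (a\<^sup>2 * L2sq \<Omega> (\<lambda>x. f k x - F x)) + 2 * (b\<^sup>2 * L2sq \<Omega> (\<lambda>x. g k x - G x))) \<longlonglongrightarrow> 0"
      using that(5,6) by (auto intro!: tendsto_eq_intros)
    have "(\<lambda>x. (a *\<^sub>R f k x + b *\<^sub>R g k x) - (a *\<^sub>R F x + b *\<^sub>R G x))
        = (\<lambda>x. a *\<^sub>R (f k x - F x) + b *\<^sub>R (g k x - G x))" for k
      by (simp add: algebra_simps)
    then have "L2sq \<Omega> (\<lambda>x. (a *\<^sub>R f k x + b *\<^sub>R g k x) - (a *\<^sub>R F x + b *\<^sub>R G x))
        \<le> 2 * (a\<^sup>2 * L2sq \<Omega> (\<lambda>x. f k x - F x)) + 2 * (b\<^sup>2 * L2sq \<Omega> (\<lambda>x. g k x - G x))" for k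
      using L2sq_add_le[OF L2_scaleR[OF L2_diff[OF that(1)[of k] that(3)], of a] L2_scaleR[OF L2_diff[OF that(2)[of k] that(4)], of b]]
      by (simp only: L2sq_scaleR)
    then show "\<forall>\<^sub>F k in sequentially. norm (L2sq \<Omega> (\<lambda>x. (a *\<^sub>R f k x + b *\<^sub>R g k x) - (a *\<^sub>R F x + b *\<^sub>R G x)))
        \<le> 2 * (a\<^sup>2 * L2sq \<Omega> (\<lambda>x. f k x - F x)) + 2 * (b\<^sup>2 * L2sq \<Omega> (\<lambda>x. g k x - G x))"
      by (simp add: L2sq_nonneg)
  qed
  have jac: "jac (\<lambda>x. a *\<^sub>R \<phi> k x + b *\<^sub>R \<psi> k x) x = a *\<^sub>R jac (\<phi> k) x + b *\<^sub>R jac (\<psi> k) x" for k x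
    by (simp add: jac_def vec_eq_iff test_fn_lincomb(2)[OF u(2) v(2)])
  \<comment> \<open>The two-term combination is an instance of the finite sum rule with index set
    \<open>bool\<close>.\<close>
  have "weak_grad_v \<Omega> (\<lambda>x. a *\<^sub>R u x + b *\<^sub>R v x) (\<lambda>x. a *\<^sub>R G x + b *\<^sub>R H x)"
    using weak_grad_v_sum[OF \<Omega>, of UNIV "\<lambda>i. if i then u else v" "\<lambda>i. if i then G else H"
        "\<lambda>i. if i then a else b"] u(1) v(1) by (simp add: UNIV_bool add.commute)
  moreover have "(\<lambda>k. L2sq \<Omega> (\<lambda>x. (a *\<^sub>R \<phi> k x + b *\<^sub>R \<psi> k x) - (a *\<^sub>R u x + b *\<^sub>R v x))) \<longlonglongrightarrow> 0"
    using u v by (intro comb L2_field L2_test)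
  moreover have "(\<lambda>k. L2sq \<Omega> (\<lambda>x. jac (\<lambda>x. a *\<^sub>R \<phi> k x + b *\<^sub>R \<psi> k x) x - (a *\<^sub>R G x + b *\<^sub>R H x))) \<longlonglongrightarrow> 0"
    unfolding jac using u v by (intro comb L2_field L2_test)
  moreover have "test_fn \<Omega> (\<lambda>x. (a *\<^sub>R \<phi> k x + b *\<^sub>R \<psi> k x) $ i)" for k i
    using test_fn_lincomb(1)[OF u(2) v(2)] by simp
  ultimately show ?thesis
    unfolding H10_def
    by (intro exI[of _ "\<lambda>x. a *\<^sub>R G x + b *\<^sub>R H x"] conjI
        exI[of _ "\<lambda>k x. a *\<^sub>R \<phi> k x + b *\<^sub>R \<psi> k x"] allI)
qed

lemma H10_zero:
  fixes \<Omega> :: "(real ^ 'd::finite) set"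
  assumes "open \<Omega>" shows "H10 \<Omega> (\<lambda>x. 0)"
proof -
  have t: "test_fn \<Omega> (\<lambda>x. 0)"
    by (rule c1_field_test_fn[OF c1_field_const, of "{}"]) auto
  have "jac (\<lambda>x::real ^ 'd. 0::real ^ 'd) x = 0" for x
    by (simp add: jac_def pd_def vec_eq_iff frechet_derivative_const)
  then show ?thesis
    unfolding H10_def using t weak_grad_v_sum[OF assms, of "{}"]
    by (intro exI[of _ "\<lambda>x. 0"] conjI exI[of _ "\<lambda>(k::nat) (x::real ^ 'd). 0 :: real ^ 'd"])
       (auto simp: L2sq_def)
qed

lemma H10_sum:
  fixes \<Omega> :: "(real ^ 'd::finite) set"
  assumes "open \<Omega>" "\<And>i. i \<in> I \<Longrightarrow> H10 \<Omega> (v i)"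
  shows "H10 \<Omega> (\<lambda>x. \<Sum>i\<in>I. a i *\<^sub>R v i x)"
  using assms(2)
proof (induction I rule: infinite_finite_induct)
  case (insert i I)
  then show ?case
    using H10_lincomb[OF assms(1), of "v i" "\<lambda>x. \<Sum>i\<in>I. a i *\<^sub>R v i x" "a i" 1] by simp
qed (simp_all add: H10_zero assms(1))

lemma Hm1_sum:
  fixes \<Omega> :: "(real ^ 'd::finite) set"
  assumes "open \<Omega>" "Hm1 \<Omega> f" "\<And>i. i \<in> I \<Longrightarrow> H10 \<Omega> (v i)"
  shows "f (\<lambda>x. \<Sum>i\<in>I. a i *\<^sub>R v i x) = (\<Sum>i\<in>I. a i * f (v i))"
proof -
  have lin: "f (\<lambda>x. \<alpha> *\<^sub>R u x + \<beta> *\<^sub>R v x) = \<alpha> * f u + \<beta> * f v" if "H10 \<Omega> u" "H10 \<Omega> v" for u v \<alpha> \<beta>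
    using assms(2) that unfolding Hm1_def by blast
  have zero: "f (\<lambda>x. 0) = 0"
    using lin[OF H10_zero H10_zero, of 0 0] assms(1) by simp
  show ?thesis using assms(3)
  proof (induction I rule: infinite_finite_induct)
    case (insert i I)
    then show ?case
      using lin[of "v i" "\<lambda>x. \<Sum>i\<in>I. a i *\<^sub>R v i x" "a i" 1] H10_sum[OF assms(1), of I v a] by simp
  qed (simp_all add: zero)
qed

lemma H10_grad_v:
  fixes \<Omega> :: "(real ^ 'd::finite) set"
  assumes "H10 \<Omega> v"
  shows "weak_grad_v \<Omega> v (grad_v \<Omega> v)" "L2 \<Omega> (grad_v \<Omega> v)" "L2 \<Omega> v"
proof -
  show w: "weak_grad_v \<Omega> v (grad_v \<Omega> v)" using assms grad_v_weak unfolding H10_def by blast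
  then show "L2 \<Omega> (grad_v \<Omega> v)" "L2 \<Omega> v"
    using weak_grad_s_L2 unfolding weak_grad_v_def by (blast intro: L2_vec_lambda)+
qed

lemma L2sq_grad_scaleR:
  fixes \<Omega> :: "(real ^ 'd::finite) set"
  assumes "open \<Omega>" "H10 \<Omega> v"
  shows "L2sq \<Omega> (grad_v \<Omega> (\<lambda>x. c *\<^sub>R v x)) = c\<^sup>2 * L2sq \<Omega> (grad_v \<Omega> v)"
proof -
  have eq: "AE x in lebesgue_on \<Omega>. grad_v \<Omega> (\<lambda>x. c *\<^sub>R v x) x = c *\<^sub>R grad_v \<Omega> v x"
    using grad_v_sum_AE[OF assms(1), of "{()}" "\<lambda>_. v" "\<lambda>_. grad_v \<Omega> v" "\<lambda>_. c"] H10_grad_v(1)[OF assms(2)] by simp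
  have "H10 \<Omega> (\<lambda>x. c *\<^sub>R v x)" using H10_lincomb[OF assms(1,2,2), of c 0] by simp
  note L = H10_grad_v(2)[OF this] L2_scaleR[OF H10_grad_v(2)[OF assms(2)], of c]
  have "L2sq \<Omega> (grad_v \<Omega> (\<lambda>x. c *\<^sub>R v x)) = L2sq \<Omega> (\<lambda>x. c *\<^sub>R grad_v \<Omega> v x)"
    unfolding L2sq_eq_L2ip by (rule L2ip_cong_AE[OF eq eq L L])
  then show ?thesis by (simp add: L2sq_scaleR)
qed

text \<open>Scaling \<open>v\<close> to unit gradient norm makes it a competitor in the supremum
  that defines the dual norm.\<close>

lemma Hm1_bound:
  fixes \<Omega> :: "(real ^ 'd::finite) set"
  assumes \<Omega>: "open \<Omega>" and f: "Hm1 \<Omega> f" and v: "H10 \<Omega> v"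
  shows "\<bar>f v\<bar> \<le> Hm1_norm \<Omega> f * sqrt (L2sq \<Omega> (grad_v \<Omega> v))"
proof -
  obtain C where C: "\<And>v. H10 \<Omega> v \<Longrightarrow> \<bar>f v\<bar> \<le> C * sqrt (L2sq \<Omega> (grad_v \<Omega> v))"
    using f unfolding Hm1_def by blast
  define s where "s = sqrt (L2sq \<Omega> (grad_v \<Omega> v))"
  have s: "0 \<le> s" "s\<^sup>2 = L2sq \<Omega> (grad_v \<Omega> v)" by (simp_all add: s_def L2sq_nonneg)
  show ?thesis
  proof (cases "s = 0")
    case True
    \<comment> \<open>A vanishing gradient norm rules out the scaling; the continuity estimate gives
      \<open>f v = 0\<close> directly.\<close>
    then show ?thesis using C[OF v] by (simp add: s_def)
  next
    case False
    with s have s0: "0 < s" by simp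
    let ?S = "{\<bar>f v\<bar> | v. H10 \<Omega> v \<and> L2sq \<Omega> (grad_v \<Omega> v) \<le> 1}"
    \<comment> \<open>A real \<open>Sup\<close> is an upper bound only if the set is bounded. The
      constant \<open>C\<close> may be negative when all gradients vanish, hence
      \<open>max C 0\<close>.\<close>
    have "bdd_above ?S"
    proof (rule bdd_aboveI[of _ "max C 0"])
      fix y assume "y \<in> ?S"
      then obtain w where w: "y = \<bar>f w\<bar>" "H10 \<Omega> w" "L2sq \<Omega> (grad_v \<Omega> w) \<le> 1" by blast
      have "y \<le> C * sqrt (L2sq \<Omega> (grad_v \<Omega> w))" using C w by simp
      also have "\<dots> \<le> max C 0 * 1"
        using w(3) L2sq_nonneg[of \<Omega> "grad_v \<Omega> w"] by (intro mult_mono) auto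
      finally show "y \<le> max C 0" by simp
    qed
    moreover have "\<bar>f (\<lambda>x. (1 / s) *\<^sub>R v x)\<bar> \<in> ?S"
    proof -
      have "H10 \<Omega> (\<lambda>x. (1 / s) *\<^sub>R v x)" using H10_lincomb[OF \<Omega> v v, of "1 / s" 0] by simp
      moreover have "L2sq \<Omega> (grad_v \<Omega> (\<lambda>x. (1 / s) *\<^sub>R v x)) \<le> 1"
        unfolding L2sq_grad_scaleR[OF \<Omega> v] s(2)[symmetric] using s0 by (simp add: power_divide)
      ultimately show ?thesis by blast
    qed
    ultimately have "\<bar>f (\<lambda>x. (1 / s) *\<^sub>R v x)\<bar> \<le> Hm1_norm \<Omega> f"
      unfolding Hm1_norm_def by (intro cSup_upper)
    moreover have "f (\<lambda>x. (1 / s) *\<^sub>R v x) = (1 / s) * f v"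
      using Hm1_sum[OF \<Omega> f, of "{()}" "\<lambda>_. v" "\<lambda>_. 1 / s"] v by simp
    ultimately show ?thesis
      using s0 by (simp add: s_def[symmetric] abs_mult divide_le_eq)
  qed
qed

section \<open>The reduced-order scheme\<close>

text \<open>A continuous advecting field is bounded on the compact closure, so the product with a
  square-integrable gradient stays square integrable without a Sobolev embedding.\<close>

lemma L2_advection:
  fixes \<Omega> :: "(real ^ 'd::finite) set"
  assumes "bounded \<Omega>" and \<Omega>: "\<Omega> \<in> sets lebesgue" and G: "L2 \<Omega> G" and w: "continuous_on (closure \<Omega>) w"
  shows "L2 \<Omega> (\<lambda>x. (G x :: real ^ 'd ^ 'd) *v w x)"
proof (rule L2_vec_lambda)
  fix i
  have "bounded (w ` closure \<Omega>)"
    using assms(1) w by (simp add: compact_continuous_image compact_imp_bounded)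
  then obtain B where "\<forall>y\<in>w ` closure \<Omega>. norm y \<le> B" unfolding bounded_iff by blast
  then have B: "norm (w x) \<le> B" if "x \<in> \<Omega>" for x using that closure_subset[of \<Omega>] by blast
  have "w \<in> borel_measurable (lebesgue_on \<Omega>)"
    using continuous_on_subset[OF w closure_subset] \<Omega> by (intro continuous_imp_measurable_on_sets_lebesgue)
  moreover note L2_measurable[OF L2_vec_nth[OF G, of i]]
  ultimately have "(\<lambda>x. G x $ i \<bullet> w x) \<in> borel_measurable (lebesgue_on \<Omega>)"
    by (intro borel_measurable_inner)
  moreover have "norm (G x $ i \<bullet> w x) \<le> B * norm (G x $ i)" if "x \<in> \<Omega>" for x
    using Cauchy_Schwarz_ineq2[of "G x $ i" "w x"] mult_left_mono[OF B[OF that] norm_ge_zero[of "G x $ i"]]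
    by (simp add: mult.commute)
  ultimately have "L2 \<Omega> (\<lambda>x. G x $ i \<bullet> w x)"
    by (rule L2_bounded_mult[OF L2_vec_nth[OF G, of i]])
  then show "L2 \<Omega> (\<lambda>x. (G x *v w x) $ i)"
    by (simp add: matrix_vector_mul_component)
qed

text \<open>A single sum over pairs makes the quadratic convection term one linear combination, to
  which \<open>L2ip_sum_sum\<close> applies.\<close>

lemma matrix_vector_mult_sum_sum:
  fixes G :: "nat \<Rightarrow> real ^ 'm::finite ^ 'k::finite"
  shows "(\<Sum>j\<in>J. b j *\<^sub>R G j) *v (\<Sum>i\<in>I. a i *\<^sub>R v i) = (\<Sum>(j, i)\<in>J \<times> I. (b j * a i) *\<^sub>R (G j *v v i))"
proof -
  have left: "(\<Sum>j\<in>J. b j *\<^sub>R G j) *v y = (\<Sum>j\<in>J. b j *\<^sub>R (G j *v y))" for y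
    by (induction J rule: infinite_finite_induct)
       (auto simp: matrix_vector_mult_add_rdistrib scaleR_matrix_vector_assoc)
  have right: "M *v (\<Sum>i\<in>I. a i *\<^sub>R v i) = (\<Sum>i\<in>I. a i *\<^sub>R (M *v v i))" for M :: "real ^ 'm ^ 'k"
    by (induction I rule: infinite_finite_induct)
       (auto simp: matrix_vector_right_distrib matrix_vector_mult_scaleR)
  show ?thesis
    unfolding left unfolding right by (simp add: scaleR_sum_right sum.cartesian_product)
qed

lemma L2ip_diff_left:
  assumes "L2 S u" "L2 S v" "L2 S w"
  shows "L2ip S (\<lambda>x. u x - v x) w = L2ip S u w - L2ip S v w"
  using L2_inner_integrable[OF assms(1,3)] L2_inner_integrable[OF assms(2,3)]
  by (simp add: L2ip_def inner_diff_left)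

lemma L2ip_scaleR_left: "L2ip S (\<lambda>x. a *\<^sub>R u x) v = a * L2ip S u v"
  by (simp add: L2ip_def)

lemma tau_sq_nonneg: "(\<And>K. K \<in> T \<Longrightarrow> 0 < \<tau> K) \<Longrightarrow> 0 \<le> tau_sq T \<tau> v"
  unfolding tau_sq_def tau_ip_def
  by (intro sum_nonneg mult_nonneg_nonneg) (auto simp: L2sq_eq_L2ip[symmetric] L2sq_nonneg less_imp_le)

text \<open>Collects what all time steps share; the functional \<open>f\<close> and the previous
  velocity vary and remain arguments of the lemmas.\<close>

locale lps_rom =
  fixes \<Omega> :: "(real ^ 'd::finite) set"
    and simp :: bool and T :: "(real ^ 'd) set set" and l :: nat
    and Proj :: "(real ^ 'd \<Rightarrow> real ^ 'd) \<Rightarrow> (real ^ 'd \<Rightarrow> real ^ 'd)"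
    and \<tau> :: "(real ^ 'd) set \<Rightarrow> real"
    and r :: nat and \<phi> :: "nat \<Rightarrow> real ^ 'd \<Rightarrow> real ^ 'd" and \<psi> :: "nat \<Rightarrow> real ^ 'd \<Rightarrow> real"
    and \<nu> \<sigma> dt :: real
  assumes open_dom: "open \<Omega>" and bounded_dom: "bounded \<Omega>" and frontier: "negligible (frontier \<Omega>)"
    and tri: "triangulation \<Omega> simp T" and Proj: "loc_stable_proj \<Omega> simp T l Proj"
    and tau: "\<And>K. K \<in> T \<Longrightarrow> 0 < \<tau> K"
    and modes_u: "\<And>i. i < r \<Longrightarrow> \<phi> i \<in> Xh \<Omega> simp T l"
    and orth_u: "\<And>i j. i < r \<Longrightarrow> j < r \<Longrightarrow> L2ip \<Omega> (\<phi> i) (\<phi> j) = (if i = j then 1 else 0)"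
    and modes_p: "\<And>i. i < r \<Longrightarrow> \<psi> i \<in> Qh \<Omega> simp T l"
    and orth_p: "\<And>i j. i < r \<Longrightarrow> j < r \<Longrightarrow> L2ip \<Omega> (\<psi> i) (\<psi> j) = (if i = j then 1 else 0)"
    and nu: "0 < \<nu>" and sigma: "0 < \<sigma>" and dt: "0 < dt"
begin

definition U :: "(nat \<Rightarrow> real) \<Rightarrow> real ^ 'd \<Rightarrow> real ^ 'd" where
  "U a = (\<lambda>x. \<Sum>i<r. a i *\<^sub>R \<phi> i x)"

definition Q :: "(nat \<Rightarrow> real) \<Rightarrow> real ^ 'd \<Rightarrow> real" where
  "Q b = (\<lambda>x. \<Sum>i<r. b i *\<^sub>R \<psi> i x)"

lemma span_u: "u \<in> span_modes r \<phi> \<longleftrightarrow> (\<exists>a. u = U a)"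
  by (auto simp: span_modes_def U_def)

lemma span_p: "p \<in> span_modes r \<psi> \<longleftrightarrow> (\<exists>b. p = Q b)"
  by (auto simp: span_modes_def Q_def)

lemma dom_lebesgue: "\<Omega> \<in> sets lebesgue"
  using open_dom by simp

lemma phi_H10: "i < r \<Longrightarrow> H10 \<Omega> (\<phi> i)"
  using modes_u by (simp add: Xh_def)

lemma phi_continuous: "i < r \<Longrightarrow> continuous_on (closure \<Omega>) (\<phi> i)"
  using modes_u by (intro Yhv_continuous[of _ _ simp T l]) (simp add: Xh_def)

lemma U_H10: "H10 \<Omega> (U a)"
  unfolding U_def by (rule H10_sum[OF open_dom]) (simp add: phi_H10)

lemma U_L2: "L2 \<Omega> (U a)"
  by (rule H10_grad_v(3)[OF U_H10])

lemma U_continuous: "continuous_on (closure \<Omega>) (U a)"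
  unfolding U_def by (intro continuous_intros phi_continuous) simp

lemma psi_weak_grad: "i < r \<Longrightarrow> \<exists>g. weak_grad_s \<Omega> (\<psi> i) g"
  using modes_p unfolding Qh_def by (rule Yh_weak_grad[OF open_dom bounded_dom tri])

lemma psi_L2: "i < r \<Longrightarrow> L2 \<Omega> (\<psi> i)"
  using psi_weak_grad weak_grad_s_L2 by blast

lemma Q_L2: "L2 \<Omega> (Q b)"
  unfolding Q_def by (intro L2_sum psi_L2) simp

section \<open>The forms of the scheme in modal coefficients\<close>

lemma grad_U: "AE x in lebesgue_on \<Omega>. grad_v \<Omega> (U a) x = (\<Sum>i<r. a i *\<^sub>R grad_v \<Omega> (\<phi> i) x)"
  unfolding U_def by (rule grad_v_sum_AE[OF open_dom H10_grad_v(1)]) (simp add: phi_H10)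

lemma phi_grad_L2: "i < r \<Longrightarrow> L2 \<Omega> (grad_v \<Omega> (\<phi> i))"
  using H10_grad_v(2) phi_H10 by blast

lemma advection_sum:
  "L2ip \<Omega> (\<lambda>x. grad_v \<Omega> (U b) x *v U a x) (U c)
    = (\<Sum>j<r. \<Sum>i<r. \<Sum>k<r. b j * a i * c k * L2ip \<Omega> (\<lambda>x. grad_v \<Omega> (\<phi> j) x *v \<phi> i x) (\<phi> k))"
proof -
  let ?N = "\<lambda>q x. grad_v \<Omega> (\<phi> (fst q)) x *v \<phi> (snd q) x" and ?I = "{..<r} \<times> {..<r}"
  have N: "L2 \<Omega> (?N q)" if "q \<in> ?I" for q
    using that by (intro L2_advection bounded_dom dom_lebesgue phi_grad_L2 phi_continuous) auto
  have "AE x in lebesgue_on \<Omega>. grad_v \<Omega> (U b) x *v U a x = (\<Sum>q\<in>?I. (b (fst q) * a (snd q)) *\<^sub>R ?N q x)"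
    using grad_U[of b] by eventually_elim (simp add: U_def matrix_vector_mult_sum_sum case_prod_unfold)
  then have "L2ip \<Omega> (\<lambda>x. grad_v \<Omega> (U b) x *v U a x) (U c)
      = L2ip \<Omega> (\<lambda>x. \<Sum>q\<in>?I. (b (fst q) * a (snd q)) *\<^sub>R ?N q x) (U c)"
    by (rule L2ip_cong_AE)
       (auto intro!: L2_advection bounded_dom dom_lebesgue H10_grad_v(2) U_H10 U_continuous U_L2 L2_sum N)
  also have "\<dots> = (\<Sum>k<r. c k * (\<Sum>q\<in>?I. (b (fst q) * a (snd q)) * L2ip \<Omega> (?N q) (\<phi> k)))"
    unfolding U_def by (rule L2ip_sum_sum[OF N]) (auto intro: H10_grad_v(3) phi_H10)
  also have "\<dots> = (\<Sum>k<r. \<Sum>q\<in>?I. b (fst q) * a (snd q) * c k * L2ip \<Omega> (?N q) (\<phi> k))"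
    by (simp add: sum_distrib_left mult_ac)
  also have "\<dots> = (\<Sum>q\<in>?I. \<Sum>k<r. b (fst q) * a (snd q) * c k * L2ip \<Omega> (?N q) (\<phi> k))"
    by (rule sum.swap)
  finally show ?thesis
    by (simp add: sum.cartesian_product')
qed

text \<open>In the second half the gradient falls on the test function, so its coefficient already
  indexes the outermost sum; only the first half is reordered to bring it there.\<close>

lemma btri_sum:
  "btri \<Omega> (U a) (U a) (U c) = (\<Sum>k<r. c k *
      ((\<Sum>j<r. \<Sum>i<r. a j * a i * L2ip \<Omega> (\<lambda>x. grad_v \<Omega> (\<phi> j) x *v \<phi> i x) (\<phi> k))
     - (\<Sum>i<r. \<Sum>m<r. a i * a m * L2ip \<Omega> (\<lambda>x. grad_v \<Omega> (\<phi> k) x *v \<phi> i x) (\<phi> m))) / 2)"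
proof -
  let ?N = "\<lambda>j i k. L2ip \<Omega> (\<lambda>x. grad_v \<Omega> (\<phi> j) x *v \<phi> i x) (\<phi> k)"
  have "(\<Sum>j<r. \<Sum>i<r. \<Sum>k<r. a j * a i * c k * ?N j i k) = (\<Sum>k<r. \<Sum>j<r. \<Sum>i<r. a j * a i * c k * ?N j i k)"
  proof -
    have "(\<Sum>j<r. \<Sum>i<r. \<Sum>k<r. a j * a i * c k * ?N j i k) = (\<Sum>j<r. \<Sum>k<r. \<Sum>i<r. a j * a i * c k * ?N j i k)"
      by (intro sum.cong refl sum.swap)
    also have "\<dots> = (\<Sum>k<r. \<Sum>j<r. \<Sum>i<r. a j * a i * c k * ?N j i k)" by (rule sum.swap)
    finally show ?thesis .
  qed
  then show ?thesis
    unfolding btri_def advection_sum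
    by (simp add: sum_distrib_left sum_subtractf right_diff_distrib diff_divide_distrib sum_divide_distrib mult_ac)
qed

text \<open>Orthonormality turns the mass matrix into the identity; this is the source of coercivity
  in the velocity coefficients.\<close>

lemma mass_sum: "L2ip \<Omega> (\<lambda>x. (1 / dt) *\<^sub>R (U a x - U w x)) (U c) = (\<Sum>k<r. c k * ((a k - w k) / dt))"
proof -
  have "(\<lambda>x. (1 / dt) *\<^sub>R (U a x - U w x)) = (\<lambda>x. \<Sum>i<r. ((a i - w i) / dt) *\<^sub>R \<phi> i x)"
    by (simp add: U_def scaleR_sum_right scaleR_diff_left scaleR_diff_right sum_subtractf diff_divide_distrib fun_eq_iff)
  moreover have "L2ip \<Omega> (\<lambda>x. \<Sum>i<r. ((a i - w i) / dt) *\<^sub>R \<phi> i x) (U c)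
      = (\<Sum>k<r. c k * (\<Sum>i<r. ((a i - w i) / dt) * L2ip \<Omega> (\<phi> i) (\<phi> k)))"
    unfolding U_def by (rule L2ip_sum_sum) (auto intro: H10_grad_v(3) phi_H10)
  moreover have "(\<Sum>i<r. ((a i - w i) / dt) * L2ip \<Omega> (\<phi> i) (\<phi> k)) = (a k - w k) / dt" if "k < r" for k
  proof -
    have "(\<Sum>i<r. ((a i - w i) / dt) * L2ip \<Omega> (\<phi> i) (\<phi> k)) = (\<Sum>i<r. if i = k then (a i - w i) / dt else 0)"
      using that by (intro sum.cong) (auto simp: orth_u)
    then show ?thesis using that by simp
  qed
  ultimately show ?thesis by simp
qed

lemma pressure_mass_sum: "L2ip \<Omega> (Q b) (Q c) = (\<Sum>k<r. c k * b k)"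
proof -
  have "L2ip \<Omega> (Q b) (Q c) = (\<Sum>k<r. c k * (\<Sum>i<r. b i * L2ip \<Omega> (\<psi> i) (\<psi> k)))"
    unfolding Q_def by (rule L2ip_sum_sum) (auto intro: psi_L2)
  moreover have "(\<Sum>i<r. b i * L2ip \<Omega> (\<psi> i) (\<psi> k)) = b k" if "k < r" for k
  proof -
    have "(\<Sum>i<r. b i * L2ip \<Omega> (\<psi> i) (\<psi> k)) = (\<Sum>i<r. if i = k then b i else 0)"
      using that by (intro sum.cong) (auto simp: orth_p)
    then show ?thesis using that by simp
  qed
  ultimately show ?thesis by simp
qed

lemma stiffness_sum:
  "L2ip \<Omega> (grad_v \<Omega> (U a)) (grad_v \<Omega> (U c))
    = (\<Sum>k<r. c k * (\<Sum>i<r. a i * L2ip \<Omega> (grad_v \<Omega> (\<phi> i)) (grad_v \<Omega> (\<phi> k))))"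
proof -
  have "L2ip \<Omega> (grad_v \<Omega> (U a)) (grad_v \<Omega> (U c))
      = L2ip \<Omega> (\<lambda>x. \<Sum>i<r. a i *\<^sub>R grad_v \<Omega> (\<phi> i) x) (\<lambda>x. \<Sum>i<r. c i *\<^sub>R grad_v \<Omega> (\<phi> i) x)"
    by (rule L2ip_cong_AE[OF grad_U grad_U]) (auto intro!: H10_grad_v(2) U_H10 L2_sum phi_H10)
  also have "\<dots> = (\<Sum>k<r. c k * (\<Sum>i<r. a i * L2ip \<Omega> (grad_v \<Omega> (\<phi> i)) (grad_v \<Omega> (\<phi> k))))"
    by (rule L2ip_sum_sum) (auto intro: phi_grad_L2)
  finally show ?thesis .
qed

lemma div_L2: "H10 \<Omega> v \<Longrightarrow> L2 \<Omega> (div_w \<Omega> v)"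
  using L2_sum[of UNIV \<Omega> "\<lambda>i x. grad_v \<Omega> v x $ i $ i" "\<lambda>_. 1"] H10_grad_v(2)[of \<Omega> v]
  by (simp add: div_w_def L2_vec_nth)

lemma div_sum:
  "L2ip \<Omega> (Q b) (div_w \<Omega> (U c)) = (\<Sum>k<r. c k * (\<Sum>i<r. b i * L2ip \<Omega> (\<psi> i) (div_w \<Omega> (\<phi> k))))"
proof -
  have "AE x in lebesgue_on \<Omega>. div_w \<Omega> (U c) x = (\<Sum>k<r. c k *\<^sub>R div_w \<Omega> (\<phi> k) x)"
    using grad_U[of c]
  proof eventually_elim
    case (elim x)
    then have "div_w \<Omega> (U c) x = (\<Sum>i\<in>UNIV. \<Sum>k<r. c k * grad_v \<Omega> (\<phi> k) x $ i $ i)"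
      by (simp add: div_w_def)
    also have "\<dots> = (\<Sum>k<r. \<Sum>i\<in>UNIV. c k * grad_v \<Omega> (\<phi> k) x $ i $ i)"
      by (rule sum.swap)
    finally show ?case by (simp add: div_w_def sum_distrib_left)
  qed
  then have "L2ip \<Omega> (Q b) (div_w \<Omega> (U c)) = L2ip \<Omega> (Q b) (\<lambda>x. \<Sum>k<r. c k *\<^sub>R div_w \<Omega> (\<phi> k) x)"
    by (intro L2ip_cong_AE[OF _ _ Q_L2 Q_L2 div_L2[OF U_H10] L2_sum]) (auto intro: div_L2 phi_H10)
  also have "\<dots> = (\<Sum>k<r. c k * (\<Sum>i<r. b i * L2ip \<Omega> (\<psi> i) (div_w \<Omega> (\<phi> k))))"
    unfolding Q_def by (rule L2ip_sum_sum) (auto intro: psi_L2 div_L2 phi_H10)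
  finally show ?thesis .
qed

lemma stabilization_sum:
  "tau_ip T \<tau> (Pistar Proj (grad_s \<Omega> (Q b))) (Pistar Proj (grad_s \<Omega> (Q c)))
    = (\<Sum>k<r. c k * (\<Sum>i<r. b i *
        tau_ip T \<tau> (Pistar Proj (grad_s \<Omega> (\<psi> i))) (Pistar Proj (grad_s \<Omega> (\<psi> k)))))"
  unfolding Q_def by (rule tau_ip_sum[OF Proj tri open_dom frontier]) (simp add: psi_weak_grad)

text \<open>Both equations are linear in the test function, so it suffices that their residuals
  vanish on each mode: \<open>2 r\<close> equations for \<open>2 r\<close> coefficients.\<close>

lemma step_exists:
  assumes f: "Hm1 \<Omega> f" and w: "w \<in> span_modes r \<phi>"
  shows "\<exists>u\<in>span_modes r \<phi>. \<exists>p\<in>span_modes r \<psi>.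
    LPS_step \<Omega> T Proj \<tau> \<nu> \<sigma> dt (span_modes r \<phi>) (span_modes r \<psi>) f w u p"
proof -
  obtain wc where wc: "w = U wc" using w span_u by blast
  define N where "N j i k = L2ip \<Omega> (\<lambda>x. grad_v \<Omega> (\<phi> j) x *v \<phi> i x) (\<phi> k)" for j i k
  define A where "A i k = L2ip \<Omega> (grad_v \<Omega> (\<phi> i)) (grad_v \<Omega> (\<phi> k))" for i k
  define D where "D i k = L2ip \<Omega> (\<psi> i) (div_w \<Omega> (\<phi> k))" for i k
  define S where "S i k = tau_ip T \<tau> (Pistar Proj (grad_s \<Omega> (\<psi> i))) (Pistar Proj (grad_s \<Omega> (\<psi> k)))" for i k
  define E where "E a b k = (a k - wc k) / dt
      + ((\<Sum>j<r. \<Sum>i<r. a j * a i * N j i k) - (\<Sum>i<r. \<Sum>m<r. a i * a m * N k i m)) / 2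
      + \<nu> * (\<Sum>i<r. a i * A i k) - (\<Sum>i<r. b i * D i k) - f (\<phi> k)" for a b :: "nat \<Rightarrow> real" and k
  define H where "H a b k = (\<Sum>i<r. a i * D k i) + (\<Sum>i<r. b i * S i k) + \<sigma> * b k"
    for a b :: "nat \<Rightarrow> real" and k
  have fU: "f (U c) = (\<Sum>k<r. c k * f (\<phi> k))" for c
    unfolding U_def by (rule Hm1_sum[OF open_dom f]) (simp add: phi_H10)
  \<comment> \<open>Arbitrary \<open>c\<close> returns the equation from \<open>E = 0\<close>, while
    the coefficients of the solution in place of \<open>c\<close> give its energy identity.\<close>
  have mom: "L2ip \<Omega> (\<lambda>x. (1 / dt) *\<^sub>R (U a x - w x)) (U c) + btri \<Omega> (U a) (U a) (U c)
        + \<nu> * L2ip \<Omega> (grad_v \<Omega> (U a)) (grad_v \<Omega> (U c)) - L2ip \<Omega> (Q b) (div_w \<Omega> (U c)) - f (U c)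
      = (\<Sum>k<r. c k * E a b k)" for a b c
    unfolding wc mass_sum btri_sum stiffness_sum div_sum fU E_def N_def[symmetric] A_def[symmetric] D_def[symmetric]
    by (simp add: distrib_left right_diff_distrib sum.distrib sum_subtractf sum_distrib_left mult.left_commute[of \<nu>])
  \<comment> \<open>The matrix \<open>D\<close> of the pressure term reappears transposed, which is
    why the two terms cancel when the equations are added.\<close>
  have divQ: "L2ip \<Omega> (div_w \<Omega> (U a)) (Q c) = (\<Sum>k<r. c k * (\<Sum>i<r. a i * D k i))" for a c
  proof -
    have "L2ip \<Omega> (div_w \<Omega> (U a)) (Q c) = (\<Sum>i<r. \<Sum>k<r. a i * (c k * D k i))"
      by (subst L2ip_commute) (simp add: div_sum D_def sum_distrib_left)
    also have "\<dots> = (\<Sum>k<r. \<Sum>i<r. a i * (c k * D k i))" by (rule sum.swap)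
    finally show ?thesis by (simp add: sum_distrib_left mult_ac)
  qed
  have mass: "L2ip \<Omega> (div_w \<Omega> (U a)) (Q c)
        + tau_ip T \<tau> (Pistar Proj (grad_s \<Omega> (Q b))) (Pistar Proj (grad_s \<Omega> (Q c))) + \<sigma> * L2ip \<Omega> (Q b) (Q c)
      = (\<Sum>k<r. c k * H a b k)" for a b c
    unfolding divQ stabilization_sum pressure_mass_sum H_def S_def[symmetric]
    by (simp add: distrib_left sum.distrib sum_distrib_left mult.left_commute[of \<sigma>])
  \<comment> \<open>Velocity coefficients occupy the indices below \<open>r\<close>, pressure
    coefficients those from \<open>r\<close> to \<open>2 r - 1\<close>.\<close>
  define F where "F x i = (if i < r then E x (\<lambda>i. x (r + i)) i else H x (\<lambda>i. x (r + i)) (i - r))"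
    for x :: "nat \<Rightarrow> real" and i
  define g where "g k = wc k / dt + f (\<phi> k)" for k
  \<comment> \<open>\<open>m\<close> bounds the quadratic part from below. \<open>R\<close> is
    chosen so that \<open>m * R\<^sup>2\<close> exceeds the linear part, at most
    \<open>R * (\<Sum>k<r. \<bar>g k\<bar>)\<close> on the cube; the summand 1 makes this
    strict.\<close>
  define m where "m = min (1 / dt) \<sigma>"
  have m: "0 < m" "m \<le> 1 / dt" "m \<le> \<sigma>" using dt sigma by (auto simp: m_def)
  define R where "R = (\<Sum>k<r. \<bar>g k\<bar>) / m + 1"
  have R: "0 < R" "(\<Sum>k<r. \<bar>g k\<bar>) < m * R"
    using m(1) by (auto simp: R_def distrib_left intro!: add_nonneg_pos divide_nonneg_pos sum_nonneg)
  have split: "(\<Sum>i<r + r. h i) = (\<Sum>i<r. h i) + (\<Sum>i<r. h (r + i))" for h :: "nat \<Rightarrow> real"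
    by (simp add: sum.nat_group lessThan_atLeast0 sum.atLeastLessThan_concat[of 0 r "r + r" h, symmetric]
        sum.shift_bounds_nat_ivl[of h 0 r r, simplified] add.commute)
  have "\<exists>x. \<forall>i<r + r. F x i = 0"
  proof (rule box_coercive_zero[OF _ R(1)])
    fix i
    show "continuous_on UNIV (\<lambda>x. F x i)"
      unfolding F_def E_def H_def using dt by (cases "i < r") (auto intro!: continuous_intros)
  next
    fix x :: "nat \<Rightarrow> real"
    assume le: "\<forall>i<r + r. \<bar>x i\<bar> \<le> R" and "\<exists>i<r + r. \<bar>x i\<bar> = R"
    then obtain i0 where i0: "i0 < r + r" "\<bar>x i0\<bar> = R" by blast
    define b where "b i = x (r + i)" for i
    have "(\<Sum>i<r + r. F x i * x i) = (\<Sum>k<r. x k * E x b k) + (\<Sum>k<r. b k * H x b k)"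
      unfolding split by (simp add: F_def b_def[abs_def] mult.commute)
    \<comment> \<open>Testing with the unknown itself: \<open>btri\<close> vanishes by
      skew-symmetry, and the two pressure terms cancel by symmetry of the inner product.\<close>
    also have "\<dots> = (\<Sum>k<r. x k * ((x k - wc k) / dt)) + \<nu> * L2sq \<Omega> (grad_v \<Omega> (U x)) - f (U x)
        + tau_sq T \<tau> (Pistar Proj (grad_s \<Omega> (Q b))) + \<sigma> * (\<Sum>k<r. b k * b k)"
      unfolding mom[symmetric] mass[symmetric] wc mass_sum pressure_mass_sum
      by (simp add: btri_def L2sq_eq_L2ip tau_sq_def L2ip_commute[of _ "div_w \<Omega> (U x)"])
    also have "\<dots> \<ge> (\<Sum>k<r. x k * ((x k - wc k) / dt)) - f (U x) + \<sigma> * (\<Sum>k<r. b k * b k)"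
      using mult_nonneg_nonneg[OF less_imp_le[OF nu] L2sq_nonneg, of \<Omega> "grad_v \<Omega> (U x)"]
        tau_sq_nonneg[of T \<tau> "Pistar Proj (grad_s \<Omega> (Q b))", OF tau] by simp
    finally have ge: "(\<Sum>k<r. x k * ((x k - wc k) / dt)) - f (U x) + \<sigma> * (\<Sum>k<r. b k * b k)
        \<le> (\<Sum>i<r + r. F x i * x i)" .
    have "(\<Sum>k<r. x k * ((x k - wc k) / dt)) - f (U x) = 1 / dt * (\<Sum>k<r. x k * x k) - (\<Sum>k<r. x k * g k)"
      by (simp add: fU g_def sum_distrib_left sum.distrib[symmetric] sum_subtractf[symmetric]
          right_diff_distrib distrib_left diff_divide_distrib diff_diff_eq)
    moreover have "m * (\<Sum>k<r. x k * x k) \<le> 1 / dt * (\<Sum>k<r. x k * x k)"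
      using m by (intro mult_right_mono sum_nonneg) auto
    moreover have "m * (\<Sum>k<r. b k * b k) \<le> \<sigma> * (\<Sum>k<r. b k * b k)"
      using m by (intro mult_right_mono sum_nonneg) auto
    \<comment> \<open>One coordinate has modulus \<open>R\<close>, so its square alone already gives
      the bound.\<close>
    moreover have "m * (R * R) \<le> m * (\<Sum>k<r. x k * x k) + m * (\<Sum>k<r. b k * b k)"
    proof -
      have "x i0 * x i0 \<le> (\<Sum>i<r + r. x i * x i)"
        using i0 by (intro member_le_sum[where f = "\<lambda>i. x i * x i"]) auto
      moreover have "x i0 * x i0 = R * R" using i0(2) by (metis abs_mult_self_eq)
      ultimately show ?thesis
        using m(1) by (simp add: split b_def distrib_left[symmetric])
    qed
    moreover have "(\<Sum>k<r. x k * g k) \<le> R * (\<Sum>k<r. \<bar>g k\<bar>)"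
      unfolding sum_distrib_left
    proof (rule sum_mono)
      fix k assume "k \<in> {..<r}"
      then have "\<bar>x k\<bar> * \<bar>g k\<bar> \<le> R * \<bar>g k\<bar>" using le by (intro mult_right_mono) auto
      then show "x k * g k \<le> R * \<bar>g k\<bar>" using abs_ge_self[of "x k * g k"] by (simp add: abs_mult)
    qed
    moreover have "R * (\<Sum>k<r. \<bar>g k\<bar>) < R * (m * R)" using R by simp
    ultimately show "0 < (\<Sum>i<r + r. F x i * x i)" using ge by (simp add: mult_ac)
  qed
  then obtain x where x: "\<And>i. i < r + r \<Longrightarrow> F x i = 0" by blast
  define b where "b i = x (r + i)" for i
  have E0: "E x b k = 0" if "k < r" for k
    using x[of k] that by (simp add: F_def b_def[abs_def])
  have H0: "H x b k = 0" if "k < r" for k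
    using x[of "r + k"] that by (simp add: F_def b_def[abs_def])
  have "LPS_step \<Omega> T Proj \<tau> \<nu> \<sigma> dt (span_modes r \<phi>) (span_modes r \<psi>) f w (U x) (Q b)"
    unfolding LPS_step_def
  proof (intro conjI ballI)
    fix v assume "v \<in> span_modes r \<phi>"
    then obtain c where "v = U c" using span_u by blast
    then show "L2ip \<Omega> (\<lambda>y. (1 / dt) *\<^sub>R (U x y - w y)) v + btri \<Omega> (U x) (U x) v
        + \<nu> * L2ip \<Omega> (grad_v \<Omega> (U x)) (grad_v \<Omega> v) - L2ip \<Omega> (Q b) (div_w \<Omega> v) = f v"
      using mom[of x c b] E0 by simp
  next
    fix q assume "q \<in> span_modes r \<psi>"
    then obtain c where "q = Q c" using span_p by blast
    then show "L2ip \<Omega> (div_w \<Omega> (U x)) q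
        + tau_ip T \<tau> (Pistar Proj (grad_s \<Omega> (Q b))) (Pistar Proj (grad_s \<Omega> q)) + \<sigma> * L2ip \<Omega> (Q b) q = 0"
      using mass[of x c b] H0 by simp
  qed
  then show ?thesis using span_u span_p by blast
qed

lemma step_energy:
  assumes f: "Hm1 \<Omega> f" and w: "w \<in> span_modes r \<phi>" and u: "u \<in> span_modes r \<phi>" and p: "p \<in> span_modes r \<psi>"
    and step: "LPS_step \<Omega> T Proj \<tau> \<nu> \<sigma> dt (span_modes r \<phi>) (span_modes r \<psi>) f w u p"
  shows "L2sq \<Omega> u + L2sq \<Omega> (\<lambda>x. u x - w x)
      + dt * (\<nu> * L2sq \<Omega> (grad_v \<Omega> u) + tau_sq T \<tau> (Pistar Proj (grad_s \<Omega> p)) + \<sigma> * L2sq \<Omega> p)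
    \<le> L2sq \<Omega> w + dt / \<nu> * (Hm1_norm \<Omega> f)\<^sup>2"
proof -
  have H: "H10 \<Omega> u" "H10 \<Omega> w" using u w span_u U_H10 by auto
  note L = H10_grad_v(3)[OF H(1)] H10_grad_v(3)[OF H(2)]
  define s where "s = sqrt (L2sq \<Omega> (grad_v \<Omega> u))"
  have s: "s\<^sup>2 = L2sq \<Omega> (grad_v \<Omega> u)" by (simp add: s_def L2sq_nonneg)
  define t where "t = tau_sq T \<tau> (Pistar Proj (grad_s \<Omega> p))"
  define q where "q = \<sigma> * L2sq \<Omega> p"
  define n where "n = Hm1_norm \<Omega> f"
  have t: "0 \<le> t" unfolding t_def using tau by (rule tau_sq_nonneg)
  have q: "0 \<le> q" unfolding q_def using sigma L2sq_nonneg by (intro mult_nonneg_nonneg) auto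
  have diff: "L2ip \<Omega> (\<lambda>x. u x - w x) v = L2ip \<Omega> u v - L2ip \<Omega> w v" if "L2 \<Omega> v" for v
    using L that by (intro L2ip_diff_left)
  \<comment> \<open>The polarisation step: twice \<open>(u - w, u)\<close> is
    \<open>L2sq \<Omega> u - L2sq \<Omega> w\<close> plus this quantity.\<close>
  have sq: "L2sq \<Omega> (\<lambda>x. u x - w x) = L2sq \<Omega> u - 2 * L2ip \<Omega> w u + L2sq \<Omega> w"
    unfolding L2sq_eq_L2ip
    by (subst diff[OF L2_diff[OF L]], subst (1 2) L2ip_commute) (simp add: diff L L2ip_commute[of _ u w])
  have "(L2sq \<Omega> u - L2ip \<Omega> w u) / dt + \<nu> * s\<^sup>2 + t + q = f u"
  proof -
    have "L2ip \<Omega> (\<lambda>x. (1 / dt) *\<^sub>R (u x - w x)) u + btri \<Omega> u u u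
        + \<nu> * L2ip \<Omega> (grad_v \<Omega> u) (grad_v \<Omega> u) - L2ip \<Omega> p (div_w \<Omega> u) = f u"
      using step u unfolding LPS_step_def by blast
    moreover have "L2ip \<Omega> (div_w \<Omega> u) p + tau_ip T \<tau> (Pistar Proj (grad_s \<Omega> p)) (Pistar Proj (grad_s \<Omega> p))
        + \<sigma> * L2ip \<Omega> p p = 0"
      using step p unfolding LPS_step_def by blast
    ultimately show ?thesis
      unfolding L2ip_scaleR_left diff[OF L(1)]
      by (simp add: btri_def s t_def q_def tau_sq_def L2sq_eq_L2ip L2ip_commute[of _ "div_w \<Omega> u"])
  qed
  then have "L2sq \<Omega> u - L2ip \<Omega> w u + dt * (\<nu> * s\<^sup>2 + t + q) = dt * f u"
    using dt by (simp add: field_simps)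
  \<comment> \<open>Young's inequality as the square \<open>(\<nu> * s - n)\<^sup>2 \<ge> 0\<close>.
    Half the viscous term is spent; doubling the energy identity leaves a full one and the data
    factor \<open>dt / \<nu>\<close>.\<close>
  moreover have "f u \<le> \<nu> / 2 * s\<^sup>2 + n\<^sup>2 / (2 * \<nu>)"
  proof -
    have "f u \<le> n * s" using Hm1_bound[OF open_dom f H(1)] by (simp add: n_def s_def)
    moreover have "0 \<le> (\<nu> * s - n)\<^sup>2 / (2 * \<nu>)" using nu by simp
    then have "n * s \<le> \<nu> / 2 * s\<^sup>2 + n\<^sup>2 / (2 * \<nu>)"
      using nu by (simp add: power2_diff power_mult_distrib field_simps power2_eq_square)
    ultimately show ?thesis by simp
  qed
  then have "dt * f u \<le> dt * (\<nu> / 2 * s\<^sup>2 + n\<^sup>2 / (2 * \<nu>))" using dt by (intro mult_left_mono) auto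
  moreover have "0 \<le> dt * t" "0 \<le> dt * q" using dt t q by auto
  moreover have "dt * (\<nu> / 2 * s\<^sup>2 + n\<^sup>2 / (2 * \<nu>)) = dt * (\<nu> * s\<^sup>2) / 2 + dt / \<nu> * n\<^sup>2 / 2"
    using nu by (simp add: field_simps)
  moreover have "dt * (\<nu> * s\<^sup>2 + t + q) = dt * (\<nu> * s\<^sup>2) + dt * t + dt * q"
    by (simp add: distrib_left)
  \<comment> \<open>All products are replaced by variables, which leaves a linear inequality: double
    the identity and drop one copy of each of the nonnegative \<open>t'\<close> and
    \<open>q'\<close>.\<close>
  moreover have "x + (x - 2 * y + z) + d \<le> z + k"
    if "x - y + d = c" "c \<le> e" "0 \<le> t'" "0 \<le> q'" "e = h / 2 + k / 2" "d = h + t' + q'"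
    for x y z d c e t' q' h k :: real
    using that by linarith
  ultimately have "L2sq \<Omega> u + (L2sq \<Omega> u - 2 * L2ip \<Omega> w u + L2sq \<Omega> w) + dt * (\<nu> * s\<^sup>2 + t + q)
      \<le> L2sq \<Omega> w + dt / \<nu> * n\<^sup>2"
    by blast
  then show ?thesis unfolding sq s[symmetric] t_def[symmetric] q_def[symmetric] n_def[symmetric] .
qed

end

theorem theorem1:
  fixes \<Omega> :: "(real ^ 'd::finite) set"
    and simp :: bool and T :: "(real ^ 'd) set set" and l :: nat
    and Proj :: "(real ^ 'd \<Rightarrow> real ^ 'd) \<Rightarrow> (real ^ 'd \<Rightarrow> real ^ 'd)"
    and \<tau> :: "(real ^ 'd) set \<Rightarrow> real"
    and r :: nat and \<phi> :: "nat \<Rightarrow> real ^ 'd \<Rightarrow> real ^ 'd" and \<psi> :: "nat \<Rightarrow> real ^ 'd \<Rightarrow> real"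
    and \<nu> \<sigma> Tend :: real and N :: nat
    and f :: "nat \<Rightarrow> (real ^ 'd \<Rightarrow> real ^ 'd) \<Rightarrow> real"
    and u0 :: "real ^ 'd \<Rightarrow> real ^ 'd"
  defines "dt \<equiv> Tend / real N"
    and "Xr \<equiv> span_modes r \<phi>"
    and "Qr \<equiv> span_modes r \<psi>"
  assumes dim: "CARD('d) = 2 \<or> CARD('d) = 3"
    and dom: "polyhedral_domain \<Omega>" and lip: "lipschitz_boundary \<Omega>"
    and tri: "triangulation \<Omega> simp T"
    and l: "l \<ge> 2"
    and Proj: "loc_stable_proj \<Omega> simp T l Proj"
    and tau: "\<forall>K\<in>T. \<tau> K > 0"
    and modes_u: "\<forall>i<r. \<phi> i \<in> Xh \<Omega> simp T l"
    and orth_u: "\<forall>i<r. \<forall>j<r. L2ip \<Omega> (\<phi> i) (\<phi> j) = (if i = j then 1 else 0)"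
    and modes_p: "\<forall>i<r. \<psi> i \<in> Qh \<Omega> simp T l"
    and orth_p: "\<forall>i<r. \<forall>j<r. L2ip \<Omega> (\<psi> i) (\<psi> j) = (if i = j then 1 else 0)"
    and nu: "\<nu> > 0" and sigma: "\<sigma> > 0"
    and Tend: "Tend > 0" and N: "N \<ge> 1"
    and f: "\<forall>n<N. Hm1 \<Omega> (f (Suc n))"
    and u0: "u0 \<in> Xr"
  shows "(\<forall>n<N. \<forall>w\<in>Xr. \<exists>u\<in>Xr. \<exists>p\<in>Qr. LPS_step \<Omega> T Proj \<tau> \<nu> \<sigma> dt Xr Qr (f (Suc n)) w u p)
       \<and> (\<forall>u p. u 0 = u0 \<longrightarrow>
            (\<forall>n<N. u (Suc n) \<in> Xr \<and> p (Suc n) \<in> Qr \<and>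
                   LPS_step \<Omega> T Proj \<tau> \<nu> \<sigma> dt Xr Qr (f (Suc n)) (u n) (u (Suc n)) (p (Suc n))) \<longrightarrow>
            (\<forall>k\<le>N.
               L2sq \<Omega> (u k) + (\<Sum>n<k. L2sq \<Omega> (\<lambda>x. u (Suc n) x - u n x))
               + dt * (\<Sum>n<k. \<nu> * L2sq \<Omega> (grad_v \<Omega> (u (Suc n)))
                               + tau_sq T \<tau> (Pistar Proj (grad_s \<Omega> (p (Suc n))))
                               + \<sigma> * L2sq \<Omega> (p (Suc n)))
               \<le> L2sq \<Omega> u0 + 4 * dt / \<nu> * (\<Sum>n<N. (Hm1_norm \<Omega> (f (Suc n)))\<^sup>2)))"
proof -
  have \<Omega>: "open \<Omega>" "bounded \<Omega>" using dom by (auto simp: polyhedral_domain_def)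
  have dt0: "0 < dt" using Tend N by (simp add: dt_def)
  interpret lps_rom \<Omega> simp T l Proj \<tau> r \<phi> \<psi> \<nu> \<sigma> dt
    by unfold_locales
      (use \<Omega> lipschitz_boundary_negligible[OF \<Omega>(1) lip] tri Proj tau modes_u orth_u modes_p orth_p
        nu sigma dt0 in auto)
  \<comment> \<open>The induction carries the factor 1 and the data up to \<open>k\<close> only, so
    that each step adds exactly one instance of \<open>step_energy\<close>.\<close>
  have energy: "L2sq \<Omega> (u k) + (\<Sum>n<k. L2sq \<Omega> (\<lambda>x. u (Suc n) x - u n x))
      + dt * (\<Sum>n<k. \<nu> * L2sq \<Omega> (grad_v \<Omega> (u (Suc n)))
        + tau_sq T \<tau> (Pistar Proj (grad_s \<Omega> (p (Suc n)))) + \<sigma> * L2sq \<Omega> (p (Suc n)))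
      \<le> L2sq \<Omega> u0 + dt / \<nu> * (\<Sum>n<k. (Hm1_norm \<Omega> (f (Suc n)))\<^sup>2)"
    if init: "u 0 = u0" and step: "\<And>n. n < N \<Longrightarrow> u (Suc n) \<in> Xr \<and> p (Suc n) \<in> Qr \<and>
        LPS_step \<Omega> T Proj \<tau> \<nu> \<sigma> dt Xr Qr (f (Suc n)) (u n) (u (Suc n)) (p (Suc n))"
      and k: "k \<le> N" for u p k
    using k
  proof (induction k)
    case 0
    then show ?case by (simp add: init)
  next
    case (Suc k)
    then have k: "k < N" by simp
    \<comment> \<open>The previous velocity has to lie in the reduced space: the initial condition
      gives this for \<open>k = 0\<close>, the preceding step otherwise.\<close>
    have "u k \<in> Xr" using init u0 step k by (cases k) auto
    then have "L2sq \<Omega> (u (Suc k)) + L2sq \<Omega> (\<lambda>x. u (Suc k) x - u k x)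
        + dt * (\<nu> * L2sq \<Omega> (grad_v \<Omega> (u (Suc k)))
          + tau_sq T \<tau> (Pistar Proj (grad_s \<Omega> (p (Suc k)))) + \<sigma> * L2sq \<Omega> (p (Suc k)))
        \<le> L2sq \<Omega> (u k) + dt / \<nu> * (Hm1_norm \<Omega> (f (Suc k)))\<^sup>2"
      using step[OF k] f k unfolding Xr_def Qr_def by (intro step_energy) auto
    with Suc show ?case by (simp add: distrib_left)
  qed
  \<comment> \<open>Nonnegativity of the squared dual norms permits extending the sum to
    \<open>N\<close> and enlarging the factor to 4.\<close>
  have mono: "dt / \<nu> * (\<Sum>n<k. (Hm1_norm \<Omega> (f (Suc n)))\<^sup>2)
      \<le> 4 * dt / \<nu> * (\<Sum>n<N. (Hm1_norm \<Omega> (f (Suc n)))\<^sup>2)" if "k \<le> N" for k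
    using that dt0 nu by (intro mult_mono sum_mono2 sum_nonneg divide_right_mono) auto
  show ?thesis
  proof (intro conjI allI impI ballI)
    fix n w assume "n < N" "w \<in> Xr"
    then show "\<exists>u\<in>Xr. \<exists>p\<in>Qr. LPS_step \<Omega> T Proj \<tau> \<nu> \<sigma> dt Xr Qr (f (Suc n)) w u p"
      using f step_exists unfolding Xr_def Qr_def by blast
  next
    fix u p k
    assume "u 0 = u0" "\<forall>n<N. u (Suc n) \<in> Xr \<and> p (Suc n) \<in> Qr \<and>
        LPS_step \<Omega> T Proj \<tau> \<nu> \<sigma> dt Xr Qr (f (Suc n)) (u n) (u (Suc n)) (p (Suc n))" "k \<le> N"
    then show "L2sq \<Omega> (u k) + (\<Sum>n<k. L2sq \<Omega> (\<lambda>x. u (Suc n) x - u n x))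
        + dt * (\<Sum>n<k. \<nu> * L2sq \<Omega> (grad_v \<Omega> (u (Suc n)))
          + tau_sq T \<tau> (Pistar Proj (grad_s \<Omega> (p (Suc n)))) + \<sigma> * L2sq \<Omega> (p (Suc n)))
        \<le> L2sq \<Omega> u0 + 4 * dt / \<nu> * (\<Sum>n<N. (Hm1_norm \<Omega> (f (Suc n)))\<^sup>2)"
      by (intro order_trans[OF energy add_left_mono[OF mono]]) blast+
  qed
qed

end
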